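(* Let $m\ge 2$ and $1\le p_i<\infty$ for $i=1,\dots,m$, with $\frac1p=\sum_{i=1}^m\frac1{p_i}$. Let $\frac{\alpha_i}{n}=\frac1{p_i}-\frac1{q_i}\in(0,1)$, $\alpha=\sum_{i=1}^m\alpha_i$, $\frac1q=\sum_{i=1}^m\frac1{q_i}$. Let $\vec\omega=(\omega_1,\dots,\omega_m)\in A_{\vec P,q}$ with $\omega_i^{q_i}\in A_\infty$ for $i=1,\dots,m$, and let $(\vec\varphi_1,\varphi_2)=(\varphi_{11},\dots,\varphi_{1m},\varphi_2)$ be non-negative measurable functions on $\mathbb R^n\times(0,\infty)$ satisfying $$[\vec\varphi_1,\varphi_2]_B:=\sup_{x\in\mathbb R^n,r>0}\varphi_2(x,r)^{-1}\int_r^\infty\frac{\operatorname{essinf}_{t<\eta<\infty}\prod_{i=1}^m\varphi_{1i}(x,\eta)\|\omega_i\|_{L^{p_i}(B(x,\eta))}}{\prod_{i=1}^m\|\omega_i\|_{L^{q_i}(B(x,t))}}\frac{dt}{t}<\infty.$$ (i) If $\min_k p_k>1$, then $\mathcal I_{\alpha,m}$ is bounded from $M^{p_1,\varphi_{11}}(\omega_1^{p_1})\times\cdots\times M^{p_m,\varphi_{1m}}(\omega_m^{p_m})$ to $M^{q,\varphi_2}(u_{\vec\omega}^q)$. (ii) If $\min_k p_k=1$, then $\mathcal I_{\alpha,m}$ is bounded from $M^{p_1,\varphi_{11}}(\omega_1^{p_1})\times\cdots\times M^{p_m,\varphi_{1m}}(\omega_m^{p_m})$ to $WM^{q,\varp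hi_2}(u_{\vec\omega}^q)$.
   Context: A weight is a nonnegative locally integrable function on $\mathbb R^n$, positive a.e.; $w(E)=\int_E w$. $B(x,r)$ is the open ball. For $1\le s<\infty$ and a ball $B$: $\|w\|_{L^s(B)}=(\int_B w^s)^{1/s}$, $\|f\|_{L^s(B,w)}=(\int_B|f|^s w)^{1/s}$, $\|f\|_{WL^s(B,w)}=\sup_{\lambda>0}\lambda\,w(\{x\in B:|f(x)|>\lambda\})^{1/s}$. $A_\infty=\bigcup_{1\le p<\infty}A_p$. Generalized weighted Morrey space: $M^{s,\varphi}(w)$ is the set of $f$ with $\|f\|_{M^{s,\varphi}(w)}:=\sup_{x,r>0}\varphi(x,r)^{-1}w(B(x,r))^{-1/s}\|f\|_{L^s(B(x,r),w)}<\infty$; $WM^{s,\varphi}(w)$ is the same with $WL^s$ in place of $L^s$. $u_{\vec\omega}=\prod_i\omega_i$; $\vec\omega\in A_{\vec P,q}$ means $\sup_B\big(\frac1{|B|}\int_B u_{\vec\omega}^q\big)^{1/q}\prod_{i=1}^m\big(\frac1{|B|}\int_B\omega_i^{-p_i'}\big)^{1/p_i'}<\infty$, where for $p_i=1$ the $i$-th factor is $(\inf_B\omega_i)^{-1}$. The multilinear fractional integral operator is $\mathcal I_{\alpha,m}(\vec f)(x)=\int_{(\mathbb R^n)^m}\frac{f_1(y_1)\cdots f_m(y_m)}{(|x-y_1|+\cdots+|x-y_m|)^{mn-\alpha}}\,dy_1\cdots dy_m$. Boundedness means $\|T(\vec f)\|_Y\le C\prod\|f_i\|_{X_i}$. 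*)

theory Defs
  imports "HOL-Analysis.Analysis"
begin

definition wball :: "('a::euclidean_space \<Rightarrow> real) \<Rightarrow> 'a \<Rightarrow> real \<Rightarrow> real" where
  "wball w x r = set_lebesgue_integral lborel (ball x r) w"

definition bavg :: "('a::euclidean_space \<Rightarrow> real) \<Rightarrow> 'a \<Rightarrow> real \<Rightarrow> real" where
  "bavg g x r = set_lebesgue_integral lborel (ball x r) g / measure lborel (ball x r)"

definition ess_inf_on :: "'b measure \<Rightarrow> 'b set \<Rightarrow> ('b \<Rightarrow> real) \<Rightarrow> real" where
  "ess_inf_on M A f = Sup {c. AE y in M. y \<in> A \<longrightarrow> c \<le> f y}"

definition weight :: "('a::euclidean_space \<Rightarrow> real) \<Rightarrow> bool" where
  "weight w \<longleftrightarrow> w \<in> borel_measurable lborel \<and> (\<forall>x. 0 \<le> w x) \<and>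
     (AE x in lborel. 0 < w x) \<and> (\<forall>x r. set_integrable lborel (ball x r) w)"

definition Ap_weight :: "real \<Rightarrow> ('a::euclidean_space \<Rightarrow> real) \<Rightarrow> bool" where
  "Ap_weight p w \<longleftrightarrow> weight w \<and> 1 \<le> p \<and>
    (\<exists>C. \<forall>x r. 0 < r \<longrightarrow>
      (if p = 1 then bavg w x r \<le> C * ess_inf_on lborel (ball x r) w
       else set_integrable lborel (ball x r) (\<lambda>y. w y powr (- 1 / (p - 1))) \<and>
            bavg w x r * (bavg (\<lambda>y. w y powr (- 1 / (p - 1))) x r) powr (p - 1) \<le> C))"

definition A_inf :: "('a::euclidean_space \<Rightarrow> real) \<Rightarrow> bool" where
  "A_inf w \<longleftrightarrow> (\<exists>p. 1 \<le> p \<and> Ap_weight p w)"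

definition APq :: "nat \<Rightarrow> (nat \<Rightarrow> real) \<Rightarrow> real \<Rightarrow> (nat \<Rightarrow> 'a::euclidean_space \<Rightarrow> real) \<Rightarrow> bool" where
  "APq m p q \<omega> \<longleftrightarrow> (\<exists>C. \<forall>x r. 0 < r \<longrightarrow>
     set_integrable lborel (ball x r) (\<lambda>y. (\<Prod>i<m. \<omega> i y) powr q) \<and>
     (\<forall>i<m. 1 < p i \<longrightarrow>
        set_integrable lborel (ball x r) (\<lambda>y. \<omega> i y powr (- (p i / (p i - 1))))) \<and>
     (\<forall>i<m. p i = 1 \<longrightarrow> 0 < ess_inf_on lborel (ball x r) (\<omega> i)) \<and>
     (bavg (\<lambda>y. (\<Prod>i<m. \<omega> i y) powr q) x r) powr (1 / q) *
       (\<Prod>i<m. if p i = 1 then 1 / ess_inf_on lborel (ball x r) (\<omega> i)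
               else (bavg (\<lambda>y. \<omega> i y powr (- (p i / (p i - 1)))) x r) powr ((p i - 1) / p i))
       \<le> C)"

definition Lnorm_ball :: "real \<Rightarrow> ('a::euclidean_space \<Rightarrow> real) \<Rightarrow> 'a \<Rightarrow> real \<Rightarrow> real" where
  "Lnorm_ball s w x r = (set_lebesgue_integral lborel (ball x r) (\<lambda>y. w y powr s)) powr (1 / s)"

text \<open>Generalized weighted Morrey space: ||f||_{L^s(B,w)} \<le> K phi(x,r) w(B)^{1/s} for all balls,
  written after raising both sides to the power s (so phi = 0 is handled correctly).\<close>
definition morrey_bound :: "real \<Rightarrow> ('a::euclidean_space \<Rightarrow> real \<Rightarrow> real) \<Rightarrow> ('a \<Rightarrow> real) \<Rightarrow> ('a \<Rightarrow> real) \<Rightarrow> real \<Rightarrow> bool" where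
  "morrey_bound s \<phi> w f K \<longleftrightarrow> (\<forall>x r. 0 < r \<longrightarrow>
     (\<integral>\<^sup>+ y\<in>ball x r. ennreal (\<bar>f y\<bar> powr s * w y) \<partial>lborel)
       \<le> ennreal ((K * \<phi> x r) powr s * wball w x r))"

definition in_morrey :: "real \<Rightarrow> ('a::euclidean_space \<Rightarrow> real \<Rightarrow> real) \<Rightarrow> ('a \<Rightarrow> real) \<Rightarrow> ('a \<Rightarrow> real) \<Rightarrow> bool" where
  "in_morrey s \<phi> w f \<longleftrightarrow> f \<in> borel_measurable lborel \<and> (\<exists>K\<ge>0. morrey_bound s \<phi> w f K)"

definition morrey_norm :: "real \<Rightarrow> ('a::euclidean_space \<Rightarrow> real \<Rightarrow> real) \<Rightarrow> ('a \<Rightarrow> real) \<Rightarrow> ('a \<Rightarrow> real) \<Rightarrow> real" where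
  "morrey_norm s \<phi> w f = Inf {K. 0 \<le> K \<and> morrey_bound s \<phi> w f K}"

definition wmorrey_bound :: "real \<Rightarrow> ('a::euclidean_space \<Rightarrow> real \<Rightarrow> real) \<Rightarrow> ('a \<Rightarrow> real) \<Rightarrow> ('a \<Rightarrow> real) \<Rightarrow> real \<Rightarrow> bool" where
  "wmorrey_bound s \<phi> w f K \<longleftrightarrow> (\<forall>x r lam. 0 < r \<longrightarrow> 0 < lam \<longrightarrow>
     ennreal (lam powr s) * (\<integral>\<^sup>+ y\<in>{y \<in> ball x r. lam < \<bar>f y\<bar>}. ennreal (w y) \<partial>lborel)
       \<le> ennreal ((K * \<phi> x r) powr s * wball w x r))"

definition in_wmorrey :: "real \<Rightarrow> ('a::euclidean_space \<Rightarrow> real \<Rightarrow> real) \<Rightarrow> ('a \<Rightarrow> real) \<Rightarrow> ('a \<Rightarrow> real) \<Rightarrow> bool" where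
  "in_wmorrey s \<phi> w f \<longleftrightarrow> f \<in> borel_measurable lborel \<and> (\<exists>K\<ge>0. wmorrey_bound s \<phi> w f K)"

definition wmorrey_norm :: "real \<Rightarrow> ('a::euclidean_space \<Rightarrow> real \<Rightarrow> real) \<Rightarrow> ('a \<Rightarrow> real) \<Rightarrow> ('a \<Rightarrow> real) \<Rightarrow> real" where
  "wmorrey_norm s \<phi> w f = Inf {K. 0 \<le> K \<and> wmorrey_bound s \<phi> w f K}"

definition mfrac_kernel :: "nat \<Rightarrow> real \<Rightarrow> (nat \<Rightarrow> 'a::euclidean_space \<Rightarrow> real) \<Rightarrow> 'a \<Rightarrow> (nat \<Rightarrow> 'a) \<Rightarrow> real" where
  "mfrac_kernel m \<alpha> f x y = (\<Prod>i<m. f i (y i)) /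
      (\<Sum>i<m. dist x (y i)) powr (real m * real DIM('a) - \<alpha>)"

definition mfrac_int :: "nat \<Rightarrow> real \<Rightarrow> (nat \<Rightarrow> 'a::euclidean_space \<Rightarrow> real) \<Rightarrow> 'a \<Rightarrow> real" where
  "mfrac_int m \<alpha> f x = (\<integral> y. mfrac_kernel m \<alpha> f x y \<partial>(\<Pi>\<^sub>M i\<in>{..<m}. (lborel :: 'a measure)))"

definition mfrac_defined :: "nat \<Rightarrow> real \<Rightarrow> (nat \<Rightarrow> 'a::euclidean_space \<Rightarrow> real) \<Rightarrow> bool" where
  "mfrac_defined m \<alpha> f \<longleftrightarrow> (AE x in lborel.
      integrable (\<Pi>\<^sub>M i\<in>{..<m}. (lborel :: 'a measure)) (mfrac_kernel m \<alpha> f x))"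

text \<open>The condition [phi_1, phi_2]_B < infinity, written multiplicatively.\<close>
definition phiB_finite :: "nat \<Rightarrow> (nat \<Rightarrow> real) \<Rightarrow> (nat \<Rightarrow> real) \<Rightarrow> (nat \<Rightarrow> 'a::euclidean_space \<Rightarrow> real)
     \<Rightarrow> (nat \<Rightarrow> 'a \<Rightarrow> real \<Rightarrow> real) \<Rightarrow> ('a \<Rightarrow> real \<Rightarrow> real) \<Rightarrow> bool" where
  "phiB_finite m p q \<omega> \<phi>1 \<phi>2 \<longleftrightarrow> (\<exists>C. \<forall>x r. 0 < r \<longrightarrow>
     (\<integral>\<^sup>+ t\<in>{r<..}. ennreal (
         ess_inf_on lborel {t<..} (\<lambda>\<eta>. \<Prod>i<m. \<phi>1 i x \<eta> * Lnorm_ball (p i) (\<omega> i) x \<eta>)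
         / (\<Prod>i<m. Lnorm_ball (q i) (\<omega> i) x t) / t) \<partial>lborel)
       \<le> ennreal (C * \<phi>2 x r))"

end

theory Submission
  imports Defs
begin

text \<open>
  Let \<open>V\<^sub>i\<close> and \<open>W\<close> be the measures with densities \<open>\<omega>\<^sub>i powr q\<^sub>i\<close> and \<open>(\<Prod>\<omega>\<^sub>i) powr Q\<close>. Since the \<open>V\<^sub>i\<close> are
  \<open>A\<^sub>\<infinity>\<close> weights, Holder's inequality with negative powers bounds \<open>\<Prod>V\<^sub>i(B) powr (1/q\<^sub>i)\<close> by a multiple of
  \<open>W(B) powr (1/Q)\<close>, the reverse of the usual inequality. Hence the joint condition on the weights bounds the
  product of the one-variable off-diagonal constants; each of these is at least one, so
  every \<open>\<omega>\<^sub>i\<close> satisfies the one-variable condition by itself, and all the measures are doubling and reverse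
  doubling.

  Writing the kernel as an integral over scales bounds the operator by
  \<open>\<integral> \<Prod>T\<^sub>i(x,t) dt/t\<close>, where \<open>T\<^sub>i(x,t)\<close> is a rescaled average of \<open>\<bar>f\<^sub>i\<bar>\<close> over \<open>B(x,t)\<close>. As in Hedberg's
  inequality, the integrand has one bound decaying at infinity and another decaying at zero, and balancing
  them dominates the potential by a power of a maximal function. For the weak type estimate this is a
  multilinear maximal function with respect to \<open>W\<close>, which the Vitali covering lemma controls for all exponents
  \<open>p\<^sub>i \<ge> 1\<close> at once. For the strong type estimate it is a composition of two maximal functions, one adapted to
  the dual weight of \<open>\<omega>\<^sub>i\<close> and one to \<open>V\<^sub>i\<close>.

  On a ball \<open>B(x,r)\<close> the scales \<open>t < r\<close> see only the restrictions of the \<open>f\<^sub>i\<close> to \<open>B(x,2r)\<close>. The scales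
  \<open>t \<ge> r\<close> are bounded pointwise by the integral in the condition on the Morrey functions, because
  the local norms of the \<open>f\<^sub>i\<close> increase with the radius and therefore lie below the essential infimum.
\<close>

text \<open>Both the covering argument and Hedberg's scheme need information on every factor, while
  the hypothesis is one condition on a product. What separates the factors is a lower bound:
  Holder's inequality for the identity \<open>1 = w * w^(-1)\<close> keeps each normalised
  one-variable constant from being small, so no factor can be compensated by another. Scales are
  measured not by the radius but by \<open>G\<close>, the geometric mean of the V_i(B) with
  exponents Q/q_i, which is comparable to W(B). The weight conditions contribute
  \<open>G^(-1/Q)\<close>; off the exceptional set the local energies contribute at most a multiple
  of \<open>G^(1/P)\<close>. Since P < Q, the first bound decreases and the product of both
  increases in \<open>G\<close>, and reverse doubling of \<open>G\<close> makes them integrable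
  against dt/t at large and at small radii. In the strong type case the factors are balanced one at
  a time: each has a bound free of the scale, and a single factor is integrated over the scales.
  Integrals are kept in the extended nonnegative reals with \<open>0 * top = 0\<close>, so
  finiteness of the potential is never presupposed; almost everywhere it is a consequence.\<close>

section \<open>Real powers on the extended nonnegative reals and the Holder inequality\<close>

text \<open>Meant for positive exponents: \<open>epow top a = top\<close> and \<open>epow 0 a = 0\<close> for every \<open>a\<close>.\<close>

definition epow :: "ennreal \<Rightarrow> real \<Rightarrow> ennreal" where
  "epow x a = (if x = top then top else ennreal (enn2real x powr a))"

lemma epow_ennreal [simp]: "0 \<le> x \<Longrightarrow> epow (ennreal x) a = ennreal (x powr a)"
  by (simp add: epow_def)

lemma epow_top [simp]: "epow top a = top"
  by (simp add: epow_def)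

lemma epow_0 [simp]: "epow 0 a = 0"
  by (simp add: epow_def)

lemma epow_one [simp]: "epow 1 a = 1"
  by (simp add: epow_def)

lemma epow_measurable [measurable (raw)]:
  assumes [measurable]: "f \<in> borel_measurable M"
  shows "(\<lambda>x. epow (f x) a) \<in> borel_measurable M"
  unfolding epow_def by measurable

lemma epow_mono: "x \<le> y \<Longrightarrow> 0 \<le> a \<Longrightarrow> epow x a \<le> epow y a"
  by (cases x; cases y) (auto intro!: ennreal_leI powr_mono2 simp: top_unique ennreal_le_iff)

lemma epow_mult: "0 < a \<Longrightarrow> epow (x * y) a = epow x a * epow y a"
  by (cases x; cases y)
    (auto simp: ennreal_mult[symmetric] powr_mult ennreal_mult_top ennreal_top_mult)

lemma epow_epow: "0 < a \<Longrightarrow> epow (epow x a) b = epow x (a * b)"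
  by (cases x) (auto simp: powr_powr)

lemma epow_1 [simp]: "epow x 1 = x"
  by (cases x) auto

lemma epow_add: "0 < a \<Longrightarrow> 0 < b \<Longrightarrow> epow x (a + b) = epow x a * epow x b"
  by (cases x) (auto simp: powr_add ennreal_mult)

lemma epow_eq_0_iff [simp]: "epow x a = 0 \<longleftrightarrow> x = 0"
  by (cases x) auto

lemma epow_eq_top_iff [simp]: "epow x a = top \<longleftrightarrow> x = top"
  by (cases x) auto

lemma epow_prod: "finite I \<Longrightarrow> 0 < a \<Longrightarrow> epow (\<Prod>i\<in>I. x i) a = (\<Prod>i\<in>I. epow (x i) a)"
  by (induction I rule: finite_induct) (auto simp: epow_mult)

lemma epow_add_le:
  assumes "0 < a"
  shows "epow (x + y) a \<le> ennreal (2 powr a) * (epow x a + epow y a)"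
proof -
  have "x + y \<le> 2 * max x y"
    by (simp add: mult_2 add_mono)
  then have "epow (x + y) a \<le> epow (2 * max x y) a"
    using assms by (intro epow_mono) auto
  also have "\<dots> = ennreal (2 powr a) * epow (max x y) a"
    using assms epow_ennreal[of 2 a] by (simp add: epow_mult)
  also have "epow (max x y) a \<le> epow x a + epow y a"
    by (auto simp: max_def)
  finally show ?thesis
    by (simp add: mult_left_mono)
qed

section \<open>Weighted AM-GM and Holder's inequality for finitely many functions\<close>

lemma weighted_am_gm:
  fixes \<theta> x :: "'i \<Rightarrow> real"
  assumes "finite I" "\<And>i. i \<in> I \<Longrightarrow> 0 \<le> \<theta> i" "(\<Sum>i\<in>I. \<theta> i) = 1" "\<And>i. i \<in> I \<Longrightarrow> 0 \<le> x i"
  shows "(\<Prod>i\<in>I. x i powr \<theta> i) \<le> (\<Sum>i\<in>I. \<theta> i * x i)"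
proof (cases "\<exists>i\<in>I. x i = 0")
  case True
  then have "(\<Prod>i\<in>I. x i powr \<theta> i) = 0"
    using assms(1) by auto
  moreover have "0 \<le> (\<Sum>i\<in>I. \<theta> i * x i)"
    by (simp add: sum_nonneg assms)
  ultimately show ?thesis by linarith
next
  case False
  then have pos: "0 < x i" if "i \<in> I" for i
    using that assms(4)[OF that] by (metis order_le_imp_less_or_eq)
  have ne: "I \<noteq> {}" using assms(3) by auto
  \<comment> \<open>Jensen's inequality for \<open>exp\<close> at the points
    \<open>ln (x i)\<close>; this is why zero values were split off first, where
    \<open>0 powr t = 0\<close> kills the product.\<close>
  have "exp (\<Sum>i\<in>I. \<theta> i *\<^sub>R ln (x i)) \<le> (\<Sum>i\<in>I. \<theta> i * exp (ln (x i)))"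
    using assms ne by (intro convex_on_sum[OF _ _ exp_convex]) auto
  moreover have "exp (\<Sum>i\<in>I. \<theta> i *\<^sub>R ln (x i)) = (\<Prod>i\<in>I. x i powr \<theta> i)"
    using pos assms(1) by (auto simp: exp_sum powr_def intro!: prod.cong dest: pos)
  ultimately show ?thesis
    using pos by (auto simp: intro!: order_trans[OF _ eq_refl] sum.cong)
qed

text \<open>Dividing each function by its own integral reduces the claim to the pointwise AM-GM
  inequality, whose integral adds the exponents up to one. Degenerate integrals come first: a zero
  integral kills the product almost everywhere even if another factor is infinite, by the convention
  \<open>0 * top = 0\<close>, and an infinite integral without a zero one makes the right side
  infinite. The measure is arbitrary because counting measure on the centres of a covering is also
  used.\<close>

lemma Holder_nn_integral:
  fixes f :: "'i \<Rightarrow> 'b \<Rightarrow> ennreal" and \<theta> :: "'i \<Rightarrow> real"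
  assumes fin: "finite I" and pos: "\<And>i. i \<in> I \<Longrightarrow> 0 < \<theta> i" and one: "(\<Sum>i\<in>I. \<theta> i) = 1"
    and meas [measurable]: "\<And>i. i \<in> I \<Longrightarrow> f i \<in> borel_measurable M"
  shows "(\<integral>\<^sup>+x. (\<Prod>i\<in>I. epow (f i x) (\<theta> i)) \<partial>M) \<le> (\<Prod>i\<in>I. epow (\<integral>\<^sup>+x. f i x \<partial>M) (\<theta> i))"
proof (cases "\<exists>i\<in>I. (\<integral>\<^sup>+x. f i x \<partial>M) = 0")
  case True
  then obtain i where i: "i \<in> I" "(\<integral>\<^sup>+x. f i x \<partial>M) = 0" by auto
  then have "AE x in M. f i x = 0"
    by (subst (asm) nn_integral_0_iff_AE) auto
  then have "AE x in M. (\<Prod>i\<in>I. epow (f i x) (\<theta> i)) = 0"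
    by eventually_elim (use i fin in \<open>auto simp: prod_zero_iff\<close>)
  then have "(\<integral>\<^sup>+x. (\<Prod>i\<in>I. epow (f i x) (\<theta> i)) \<partial>M) = 0"
    by (subst nn_integral_0_iff_AE) auto
  then show ?thesis by simp
next
  case nz: False
  show ?thesis
  proof (cases "\<exists>i\<in>I. (\<integral>\<^sup>+x. f i x \<partial>M) = top")
    case True
    then have "(\<Prod>i\<in>I. epow (\<integral>\<^sup>+x. f i x \<partial>M) (\<theta> i)) = top"
      using nz fin by (auto simp: ennreal_prod_eq_top)
    then show ?thesis by simp
  next
    case nt: False
    define A where "A i = enn2real (\<integral>\<^sup>+x. f i x \<partial>M)" for i
    have A: "(\<integral>\<^sup>+x. f i x \<partial>M) = ennreal (A i)" "0 < A i" if "i \<in> I" for i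
      using nz nt that unfolding A_def
      by (auto simp: less_top enn2real_positive_iff zero_less_iff_neq_zero)
    have le: "(\<Prod>i\<in>I. epow (f i x) (\<theta> i)) \<le>
        ennreal (\<Prod>i\<in>I. A i powr \<theta> i) * (\<Sum>i\<in>I. ennreal (\<theta> i / A i) * f i x)" for x
    proof (cases "\<exists>i\<in>I. f i x = top")
      case True
      then obtain i where i: "i \<in> I" "f i x = top" by auto
      have "ennreal (\<theta> i / A i) * f i x = top"
        using i(2) pos[OF i(1)] A(2)[OF i(1)] by (simp add: ennreal_mult_top ennreal_eq_0_iff not_le)
      then have "(\<Sum>i\<in>I. ennreal (\<theta> i / A i) * f i x) = top"
        using member_le_sum[OF i(1), of "\<lambda>i. ennreal (\<theta> i / A i) * f i x"] fin by (simp add: top_unique)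
      moreover have "0 < (\<Prod>i\<in>I. A i powr \<theta> i)"
        using A by (intro prod_pos) force
      ultimately show ?thesis
        by (auto simp: ennreal_mult_top ennreal_eq_0_iff)
    next
      case False
      define g where "g i = enn2real (f i x)" for i
      have g: "f i x = ennreal (g i)" "0 \<le> g i" if "i \<in> I" for i
        using False that by (auto simp: g_def less_top)
      have "(\<Prod>i\<in>I. g i powr \<theta> i) = (\<Prod>i\<in>I. A i powr \<theta> i) * (\<Prod>i\<in>I. (g i / A i) powr \<theta> i)"
        unfolding prod.distrib[symmetric]
      proof (rule prod.cong[OF refl])
        fix i assume i: "i \<in> I"
        have "g i = A i * (g i / A i)" using A(2)[OF i] by simp
        then show "g i powr \<theta> i = A i powr \<theta> i * (g i / A i) powr \<theta> i"
          using A(2)[OF i] g(2)[OF i] by (metis divide_nonneg_pos less_imp_le powr_mult)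
      qed
      also have "\<dots> \<le> (\<Prod>i\<in>I. A i powr \<theta> i) * (\<Sum>i\<in>I. \<theta> i * (g i / A i))"
        using fin pos one g A
        by (intro mult_left_mono weighted_am_gm) (auto intro!: prod_nonneg simp: less_imp_le)
      finally have "ennreal (\<Prod>i\<in>I. g i powr \<theta> i) \<le>
          ennreal ((\<Prod>i\<in>I. A i powr \<theta> i) * (\<Sum>i\<in>I. \<theta> i * (g i / A i)))"
        by (rule ennreal_leI)
      also have "\<dots> = ennreal (\<Prod>i\<in>I. A i powr \<theta> i) * ennreal (\<Sum>i\<in>I. \<theta> i * (g i / A i))"
        by (intro ennreal_mult) (auto intro!: prod_nonneg sum_nonneg simp: pos less_imp_le A g)
      also have "ennreal (\<Sum>i\<in>I. \<theta> i * (g i / A i)) = (\<Sum>i\<in>I. ennreal (\<theta> i / A i) * f i x)"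
        using pos A g by (subst sum_ennreal[symmetric])
          (auto intro!: sum.cong simp: ennreal_mult[symmetric] less_imp_le)
      also have "ennreal (\<Prod>i\<in>I. g i powr \<theta> i) = (\<Prod>i\<in>I. epow (f i x) (\<theta> i))"
        using g by (subst prod_ennreal[symmetric]) auto
      finally show ?thesis .
    qed
    have "(\<integral>\<^sup>+x. (\<Prod>i\<in>I. epow (f i x) (\<theta> i)) \<partial>M) \<le>
        (\<integral>\<^sup>+x. ennreal (\<Prod>i\<in>I. A i powr \<theta> i) * (\<Sum>i\<in>I. ennreal (\<theta> i / A i) * f i x) \<partial>M)"
      by (intro nn_integral_mono le)
    also have "\<dots> = ennreal (\<Prod>i\<in>I. A i powr \<theta> i) * (\<Sum>i\<in>I. ennreal (\<theta> i / A i) * (\<integral>\<^sup>+x. f i x \<partial>M))"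
      by (simp add: nn_integral_cmult nn_integral_sum)
    also have "(\<Sum>i\<in>I. ennreal (\<theta> i / A i) * (\<integral>\<^sup>+x. f i x \<partial>M)) = (\<Sum>i\<in>I. ennreal (\<theta> i))"
    proof (rule sum.cong[OF refl])
      fix i assume i: "i \<in> I"
      show "ennreal (\<theta> i / A i) * (\<integral>\<^sup>+x. f i x \<partial>M) = ennreal (\<theta> i)"
        using A[OF i] pos[OF i] by (simp add: ennreal_mult[symmetric])
    qed
    also have "\<dots> = 1"
      using pos one by (subst sum_ennreal) (auto simp: less_imp_le)
    also have "ennreal (\<Prod>i\<in>I. A i powr \<theta> i) = (\<Prod>i\<in>I. epow (\<integral>\<^sup>+x. f i x \<partial>M) (\<theta> i))"
      using A by (subst prod_ennreal[symmetric]) (auto simp: less_imp_le)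
    finally show ?thesis by simp
  qed
qed

lemma Holder_nn_integral2:
  assumes "0 < a" "0 < b" "a + b = 1" and [measurable]: "f \<in> borel_measurable M" "g \<in> borel_measurable M"
  shows "(\<integral>\<^sup>+x. epow (f x) a * epow (g x) b \<partial>M) \<le> epow (\<integral>\<^sup>+x. f x \<partial>M) a * epow (\<integral>\<^sup>+x. g x \<partial>M) b"
  using Holder_nn_integral[of "UNIV :: bool set" "\<lambda>c. if c then a else b" "\<lambda>c. if c then f else g" M] assms
  by (simp add: UNIV_bool mult.commute add.commute)

section \<open>Maximal functions of doubling measures\<close>

text \<open>The elementary integral behind the layer-cake formula, with an extended real upper limit
  so that infinite values of a maximal function fit in. It also integrates the small scales in the
  Hedberg bound.\<close>

lemma nn_integral_powr_below:
  assumes "0 < a"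
  shows "(\<integral>\<^sup>+l. ennreal (l powr (a - 1)) * indicator {l. 0 < l \<and> ennreal l < X} l \<partial>lborel)
    = ennreal (1 / a) * epow X a"
proof -
  have fin: "(\<integral>\<^sup>+l. ennreal (l powr (a - 1)) * indicator {0..x} l \<partial>lborel) = ennreal (x powr a / a)"
    if "0 \<le> x" for x
    using nn_integral_has_integral_lebesgue'[OF _ has_integral_powr_from_0[of "a - 1" x]] assms that
    by simp
  show ?thesis
  proof (cases X)
    case (real x)
    have "(\<integral>\<^sup>+l. ennreal (l powr (a - 1)) * indicator {l. 0 < l \<and> ennreal l < X} l \<partial>lborel)
        = (\<integral>\<^sup>+l. ennreal (l powr (a - 1)) * indicator {0..x} l \<partial>lborel)"
    proof (rule nn_integral_cong_AE)
      have "AE l in lborel. l \<noteq> x" "AE l::real in lborel. l \<noteq> 0"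
        by (rule AE_lborel_singleton)+
      then show "AE l in lborel. ennreal (l powr (a - 1)) * indicator {l. 0 < l \<and> ennreal l < X} l
          = ennreal (l powr (a - 1)) * indicator {0..x} l"
        by eventually_elim (auto simp: indicator_def real ennreal_less_iff)
    qed
    also have "\<dots> = ennreal (1 / a) * epow X a"
      using real assms by (simp add: fin ennreal_mult[symmetric])
    finally show ?thesis .
  next
    case top
    have "ennreal (real n powr a / a) \<le>
        (\<integral>\<^sup>+l. ennreal (l powr (a - 1)) * indicator {l. 0 < l \<and> ennreal l < X} l \<partial>lborel)" for n :: nat
    proof -
      have "ennreal (real n powr a / a) = (\<integral>\<^sup>+l. ennreal (l powr (a - 1)) * indicator {0..real n} l \<partial>lborel)"
        by (simp add: fin)
      also have "\<dots> \<le> (\<integral>\<^sup>+l. ennreal (l powr (a - 1)) * indicator {l. 0 < l \<and> ennreal l < X} l \<partial>lborel)"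
      proof (rule nn_integral_mono)
        fix l :: real
        show "ennreal (l powr (a - 1)) * indicator {0..real n} l
            \<le> ennreal (l powr (a - 1)) * indicator {l. 0 < l \<and> ennreal l < X} l"
          by (cases "0 < l") (auto simp: top indicator_def)
      qed
      finally show ?thesis .
    qed
    moreover have "(SUP n::nat. ennreal (real n powr a / a)) = top"
    proof (rule ccontr)
      assume "(SUP n::nat. ennreal (real n powr a / a)) \<noteq> top"
      then obtain c where c: "0 \<le> c" "(SUP n::nat. ennreal (real n powr a / a)) = ennreal c"
        by (cases "SUP n::nat. ennreal (real n powr a / a)") auto
      have le: "real n powr a / a \<le> c" for n :: nat
        using SUP_upper[of n UNIV "\<lambda>n. ennreal (real n powr a / a)"] c by simp
      obtain n :: nat where n: "(a * c + 1) powr (1 / a) < real n"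
        using reals_Archimedean2 by blast
      have "a * c + 1 = ((a * c + 1) powr (1 / a)) powr a"
        using assms c by (simp add: powr_powr add_nonneg_pos)
      also have "\<dots> \<le> real n powr a"
        using n assms by (intro powr_mono2) auto
      also have "\<dots> \<le> a * c"
        using le[of n] assms by (simp add: field_simps)
      finally show False by simp
    qed
    ultimately have "(\<integral>\<^sup>+l. ennreal (l powr (a - 1)) * indicator {l. 0 < l \<and> ennreal l < X} l \<partial>lborel) = top"
      by (metis (no_types, lifting) SUP_least top_unique)
    then show ?thesis
      using top assms by (simp add: ennreal_mult_top ennreal_eq_0_iff)
  qed
qed

lemma nn_integral_count_space_swap:
  assumes "countable I" "sigma_finite_measure M"
    and "\<And>i. i \<in> I \<Longrightarrow> f i \<in> borel_measurable M"
  shows "(\<integral>\<^sup>+x. (\<integral>\<^sup>+i. f i x \<partial>count_space I) \<partial>M) = (\<integral>\<^sup>+i. (\<integral>\<^sup>+x. f i x \<partial>M) \<partial>count_space I)"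
proof -
  interpret pair_sigma_finite "count_space I" M
    using assms by (intro pair_sigma_finite.intro sigma_finite_measure_count_space_countable)
  show ?thesis
    using assms by (intro Fubini' measurable_pair_measure_countable1) auto
qed

text \<open>The factor 5 is the enlargement produced by the Vitali covering lemma, and it is also
  enough to pass between balls around neighbouring centres.\<close>

locale doubling_measure =
  fixes \<mu> :: "'a::euclidean_space measure" and D :: real
  assumes sets_eq [measurable_cong]: "sets \<mu> = sets borel"
    and ball_pos: "0 < r \<Longrightarrow> 0 < emeasure \<mu> (ball x r)"
    and ball_finite: "emeasure \<mu> (ball x r) < top"
    and doubling: "0 < r \<Longrightarrow> emeasure \<mu> (ball x (5 * r)) \<le> ennreal D * emeasure \<mu> (ball x r)"
begin

lemma space_eq [simp]: "space \<mu> = UNIV"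
  using sets_eq_imp_space_eq[OF sets_eq] by simp

sublocale sigma_finite_measure \<mu>
proof
  show "\<exists>A. countable A \<and> A \<subseteq> sets \<mu> \<and> \<Union> A = space \<mu> \<and> (\<forall>a\<in>A. emeasure \<mu> a \<noteq> \<infinity>)"
  proof (intro exI[of _ "range (\<lambda>n::nat. ball 0 (real n))"] conjI ballI)
    show "\<Union> (range (\<lambda>n::nat. ball (0::'a) (real n))) = space \<mu>"
      by (auto intro: reals_Archimedean2)
  qed (use ball_finite in \<open>auto simp: sets_eq less_top\<close>)
qed

text \<open>The control \<open>\<Phi>\<close> is an arbitrary function of a ball with bounded sums
  over disjoint balls. The multilinear estimate needs this freedom: there \<open>\<Phi>\<close> is a
  product of powers of integrals, whose sums are bounded by Holder instead of additivity. The radius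
  bound \<open>R\<close> is required by the covering lemma.\<close>

lemma vitali_bounded:
  assumes S: "S \<in> sets borel"
    and cov: "\<And>x. x \<in> S \<Longrightarrow> \<exists>t. 0 < t \<and> t \<le> R \<and> emeasure \<mu> (ball x t) \<le> \<Phi> x t"
    and A: "\<And>C r. countable C \<Longrightarrow> (\<And>x. x \<in> C \<Longrightarrow> 0 < r x) \<Longrightarrow>
        disjoint_family_on (\<lambda>x. ball x (r x)) C \<Longrightarrow> (\<integral>\<^sup>+x. \<Phi> x (r x) \<partial>count_space C) \<le> A"
  shows "emeasure \<mu> S \<le> ennreal D * A"
proof -
  obtain r where r: "\<And>x. x \<in> S \<Longrightarrow> 0 < r x \<and> r x \<le> R \<and> emeasure \<mu> (ball x (r x)) \<le> \<Phi> x (r x)"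
    using cov by metis
  obtain C where C: "countable C" "C \<subseteq> S"
    "pairwise (\<lambda>i j. disjnt (cball i (r i)) (cball j (r j))) C"
    and sub: "\<And>i. i \<in> S \<Longrightarrow> \<exists>j. j \<in> C \<and> \<not> disjnt (cball i (r i)) (cball j (r j)) \<and>
        cball i (r i) \<subseteq> ball j (5 * r j)"
    by (rule Vitali_covering_lemma_cballs_balls[of S r R "\<lambda>x. x"]) (use r in \<open>blast intro: that\<close>)+
  have "emeasure \<mu> S \<le> emeasure \<mu> (\<Union>x\<in>C. ball x (5 * r x))"
  proof (rule emeasure_mono)
    show "S \<subseteq> (\<Union>x\<in>C. ball x (5 * r x))"
    proof
      fix x assume x: "x \<in> S"
      then obtain j where "j \<in> C" "cball x (r x) \<subseteq> ball j (5 * r j)"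
        using sub by blast
      moreover have "x \<in> cball x (r x)"
        using r[OF x] by simp
      ultimately show "x \<in> (\<Union>x\<in>C. ball x (5 * r x))" by blast
    qed
    show "(\<Union>x\<in>C. ball x (5 * r x)) \<in> sets \<mu>"
      by (simp add: sets_eq open_UN)
  qed
  also have "\<dots> = (\<integral>\<^sup>+y. indicator (\<Union>x\<in>C. ball x (5 * r x)) y \<partial>\<mu>)"
    by (simp add: sets_eq open_UN)
  \<comment> \<open>Countable subadditivity, written with a sum of indicators over the centres so
    that sum and integral can be exchanged.\<close>
  also have "\<dots> \<le> (\<integral>\<^sup>+y. (\<integral>\<^sup>+x. indicator (ball x (5 * r x)) y \<partial>count_space C) \<partial>\<mu>)"
  proof (rule nn_integral_mono)
    fix y
    show "indicator (\<Union>x\<in>C. ball x (5 * r x)) y \<le> (\<integral>\<^sup>+x. indicator (ball x (5 * r x)) y \<partial>count_space C :: ennreal)"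
    proof (cases "y \<in> (\<Union>x\<in>C. ball x (5 * r x))")
      case True
      then obtain x where "x \<in> C" "y \<in> ball x (5 * r x)" by auto
      then show ?thesis
        using nn_integral_ge_point[of x C "\<lambda>x. indicator (ball x (5 * r x)) y"]
        by (auto simp: indicator_def)
    qed auto
  qed
  also have "\<dots> = (\<integral>\<^sup>+x. (\<integral>\<^sup>+y. indicator (ball x (5 * r x)) y \<partial>\<mu>) \<partial>count_space C)"
    by (rule nn_integral_count_space_swap[OF C(1) sigma_finite_measure_axioms])
      (auto simp: sets_eq intro!: borel_measurable_indicator)
  also have "\<dots> \<le> (\<integral>\<^sup>+x. ennreal D * \<Phi> x (r x) \<partial>count_space C)"
  proof (rule nn_integral_mono)
    fix x assume "x \<in> space (count_space C)"
    then have x: "x \<in> S" using C by auto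
    have "(\<integral>\<^sup>+y. indicator (ball x (5 * r x)) y \<partial>\<mu>) = emeasure \<mu> (ball x (5 * r x))"
      by (simp add: sets_eq)
    also have "\<dots> \<le> ennreal D * emeasure \<mu> (ball x (r x))"
      using r[OF x] by (intro doubling) auto
    also have "\<dots> \<le> ennreal D * \<Phi> x (r x)"
      using r[OF x] by (intro mult_left_mono) auto
    finally show "(\<integral>\<^sup>+y. indicator (ball x (5 * r x)) y \<partial>\<mu>) \<le> ennreal D * \<Phi> x (r x)" .
  qed
  also have "\<dots> = ennreal D * (\<integral>\<^sup>+x. \<Phi> x (r x) \<partial>count_space C)"
    by (rule nn_integral_cmult) simp
  also have "(\<integral>\<^sup>+x. \<Phi> x (r x) \<partial>count_space C) \<le> A"
  proof (rule A[OF C(1)])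
    show "0 < r x" if "x \<in> C" for x using r C that by blast
    show "disjoint_family_on (\<lambda>x. ball x (r x)) C"
      unfolding disjoint_family_on_def
    proof (intro ballI impI)
      fix i j assume "i \<in> C" "j \<in> C" "i \<noteq> j"
      then have "disjnt (cball i (r i)) (cball j (r j))"
        using C(3) by (auto simp: pairwise_def)
      then show "ball i (r i) \<inter> ball j (r j) = {}"
        unfolding disjnt_def using ball_subset_cball by blast
    qed
  qed
  finally show ?thesis
    by (simp add: mult_left_mono)
qed

text \<open>Rational radii keep suprema and unions over radii countable, hence measurable; doubling
  replaces any other radius by a nearby rational one.\<close>

definition Qpos :: "real set" where "Qpos = \<rat> \<inter> {0<..}"

lemma countable_Qpos: "countable Qpos"
  unfolding Qpos_def by (simp add: countable_rat)

text \<open>The estimate for bounded radii does not depend on the bound, so the sets with radii at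
  most \<open>n\<close> increase to the whole union under one common estimate.\<close>

lemma vitali_union:
  assumes meas: "\<And>t. 0 < t \<Longrightarrow> {x. emeasure \<mu> (ball x t) < \<Phi> x t} \<in> sets borel"
    and A: "\<And>C r. countable C \<Longrightarrow> (\<And>x. x \<in> C \<Longrightarrow> 0 < r x) \<Longrightarrow>
        disjoint_family_on (\<lambda>x. ball x (r x)) C \<Longrightarrow> (\<integral>\<^sup>+x. \<Phi> x (r x) \<partial>count_space C) \<le> A"
  shows "emeasure \<mu> (\<Union>t\<in>Qpos. {x. emeasure \<mu> (ball x t) < \<Phi> x t}) \<le> ennreal D * A"
proof -
  define U where "U n = (\<Union>t\<in>Qpos \<inter> {..real n}. {x. emeasure \<mu> (ball x t) < \<Phi> x t})" for n :: nat
  have U: "U n \<in> sets borel" for n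
    unfolding U_def using countable_Qpos
    by (intro sets.countable_UN') (auto simp: Qpos_def intro!: meas)
  have "(\<Union>t\<in>Qpos. {x. emeasure \<mu> (ball x t) < \<Phi> x t}) = (\<Union>n. U n)"
    unfolding U_def using real_arch_simple by blast
  moreover have "(SUP n. emeasure \<mu> (U n)) = emeasure \<mu> (\<Union>n. U n)"
  proof (rule SUP_emeasure_incseq)
    have "U m \<subseteq> U n" if "m \<le> n" for m n
    proof -
      have "Qpos \<inter> {..real m} \<subseteq> Qpos \<inter> {..real n}" using that by auto
      then show ?thesis unfolding U_def by (rule UN_mono) simp
    qed
    then show "incseq U" by (simp add: incseq_def)
  qed (use U sets_eq in auto)
  moreover have "emeasure \<mu> (U n) \<le> ennreal D * A" for n
  proof (rule vitali_bounded[OF U _ A])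
    show "\<exists>t. 0 < t \<and> t \<le> real n \<and> emeasure \<mu> (ball x t) \<le> \<Phi> x t" if "x \<in> U n" for x
      using that unfolding U_def Qpos_def by force
  qed auto
  ultimately show ?thesis
    by (simp add: SUP_least flip: \<open>(SUP n. emeasure \<mu> (U n)) = emeasure \<mu> (\<Union>n. U n)\<close>)
qed

text \<open>Pairs at distance less than \<open>t\<close> form an open set, which gives joint
  measurability in centre and point; the point is then integrated out by sigma-finiteness.\<close>

lemma measurable_ball_integral [measurable]:
  assumes [measurable]: "h \<in> borel_measurable borel"
  shows "(\<lambda>x. \<integral>\<^sup>+y. h y * indicator (ball x t) y \<partial>\<mu>) \<in> borel_measurable borel"
proof -
  have "open {p::'a \<times> 'a. dist (fst p) (snd p) < t}"
    by (intro open_Collect_less continuous_intros)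
  then have "{p::'a \<times> 'a. dist (fst p) (snd p) < t} \<in> sets (borel \<Otimes>\<^sub>M borel)"
    unfolding borel_prod by simp
  then have [measurable]: "Measurable.pred (borel \<Otimes>\<^sub>M borel) (\<lambda>p::'a \<times> 'a. dist (fst p) (snd p) < t)"
    by measurable
  have "(\<lambda>x. \<integral>\<^sup>+y. h y * (if dist x y < t then 1 else 0) \<partial>\<mu>) \<in> borel_measurable borel"
    by measurable
  then show ?thesis
    by (simp add: indicator_def)
qed

lemma measurable_emeasure_ball [measurable]:
  "(\<lambda>x. emeasure \<mu> (ball x t)) \<in> borel_measurable borel"
  using measurable_ball_integral[of "\<lambda>_. 1" t] by (simp add: sets_eq)

section \<open>The centred maximal function and its weak and strong type bounds\<close>

definition maxf :: "('a \<Rightarrow> ennreal) \<Rightarrow> 'a \<Rightarrow> ennreal" where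
  "maxf h x = (SUP t\<in>Qpos. (\<integral>\<^sup>+y. h y * indicator (ball x t) y \<partial>\<mu>) / emeasure \<mu> (ball x t))"

lemma measurable_maxf [measurable]:
  assumes [measurable]: "h \<in> borel_measurable borel"
  shows "maxf h \<in> borel_measurable borel"
  unfolding maxf_def[abs_def] using countable_Qpos
  by (intro borel_measurable_SUP borel_measurable_divide_ennreal) measurable

text \<open>One doubling constant is the price for evaluating the centred maximal function at any
  point of the ball instead of its centre.\<close>

lemma ball_integral_le_maxf:
  assumes "0 < t" "dist x y < t"
  shows "(\<integral>\<^sup>+z. h z * indicator (ball x t) z \<partial>\<mu>) \<le> ennreal D * emeasure \<mu> (ball x t) * maxf h y"
proof -
  \<comment> \<open>With \<open>u\<close> between \<open>2 * t\<close> and \<open>4 * t\<close>, the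
    ball of radius \<open>u\<close> about \<open>y\<close> contains the given ball and lies in its
    five-fold dilation.\<close>
  obtain u where u: "u \<in> \<rat>" "2 * t < u" "u < 4 * t"
    using Rats_dense_in_real[of "2 * t" "4 * t"] assms by auto
  have sub: "ball x t \<subseteq> ball y u" "ball y u \<subseteq> ball x (5 * t)"
  proof -
    show "ball x t \<subseteq> ball y u"
      using assms u by (auto simp: subset_iff) (smt (verit) dist_commute dist_triangle)
    show "ball y u \<subseteq> ball x (5 * t)"
      using assms u by (auto simp: subset_iff) (smt (verit) dist_commute dist_triangle)
  qed
  have uQ: "u \<in> Qpos" and u0: "0 < u" using u assms by (auto simp: Qpos_def)
  have "(\<integral>\<^sup>+z. h z * indicator (ball x t) z \<partial>\<mu>) \<le> (\<integral>\<^sup>+z. h z * indicator (ball y u) z \<partial>\<mu>)"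
    using sub by (intro nn_integral_mono mult_left_mono) (auto simp: indicator_def)
  also have "\<dots> = (\<integral>\<^sup>+z. h z * indicator (ball y u) z \<partial>\<mu>) / emeasure \<mu> (ball y u) * emeasure \<mu> (ball y u)"
    using ball_pos[OF u0, of y] ball_finite[of y u]
    by (simp add: ennreal_divide_times)
  also have "\<dots> \<le> maxf h y * emeasure \<mu> (ball y u)"
    unfolding maxf_def by (intro mult_right_mono SUP_upper uQ) auto
  also have "\<dots> \<le> maxf h y * (ennreal D * emeasure \<mu> (ball x t))"
  proof (intro mult_left_mono)
    have "emeasure \<mu> (ball y u) \<le> emeasure \<mu> (ball x (5 * t))"
      using sub by (intro emeasure_mono) (auto simp: sets_eq)
    also have "\<dots> \<le> ennreal D * emeasure \<mu> (ball x t)"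
      using assms by (intro doubling)
    finally show "emeasure \<mu> (ball y u) \<le> ennreal D * emeasure \<mu> (ball x t)" .
  qed auto
  finally show ?thesis by (simp add: mult_ac)
qed

lemma disjoint_ball_integral_le:
  assumes [measurable]: "h \<in> borel_measurable borel" and "countable C"
    "disjoint_family_on (\<lambda>x. ball x (r x)) C"
  shows "(\<integral>\<^sup>+x. (\<integral>\<^sup>+y. h y * indicator (ball x (r x)) y \<partial>\<mu>) \<partial>count_space C) \<le> (\<integral>\<^sup>+y. h y \<partial>\<mu>)"
proof -
  have e: "emeasure (density \<mu> h) A = (\<integral>\<^sup>+y. h y * indicator A y \<partial>\<mu>)" if "A \<in> sets borel" for A
    using that by (subst emeasure_density) (auto simp: sets_eq)
  have "(\<integral>\<^sup>+x. (\<integral>\<^sup>+y. h y * indicator (ball x (r x)) y \<partial>\<mu>) \<partial>count_space C)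
      = (\<integral>\<^sup>+x. emeasure (density \<mu> h) (ball x (r x)) \<partial>count_space C)"
    by (simp add: e)
  also have "\<dots> = emeasure (density \<mu> h) (\<Union>x\<in>C. ball x (r x))"
    using assms by (intro emeasure_UN_countable[symmetric]) (auto simp: sets_eq)
  also have "\<dots> \<le> emeasure (density \<mu> h) (space \<mu>)"
    by (metis emeasure_space space_density)
  also have "\<dots> = (\<integral>\<^sup>+y. h y \<partial>\<mu>)"
    by (simp add: e)
  finally show ?thesis .
qed

lemma maxf_weak_type:
  assumes [measurable]: "h \<in> borel_measurable borel" and l: "0 < l"
  shows "emeasure \<mu> {x. ennreal l < maxf h x} \<le> ennreal D * (ennreal (1 / l) * (\<integral>\<^sup>+y. h y \<partial>\<mu>))"
proof -
  define \<Phi> where "\<Phi> x t = ennreal (1 / l) * (\<integral>\<^sup>+y. h y * indicator (ball x t) y \<partial>\<mu>)" for x t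
  have [measurable]: "(\<lambda>x. \<Phi> x t) \<in> borel_measurable borel" for t
    unfolding \<Phi>_def by measurable
  have sub: "{x. ennreal l < maxf h x} \<subseteq> (\<Union>t\<in>Qpos. {x. emeasure \<mu> (ball x t) < \<Phi> x t})"
  proof
    fix x assume "x \<in> {x. ennreal l < maxf h x}"
    then obtain t where t: "t \<in> Qpos"
      "ennreal l < (\<integral>\<^sup>+y. h y * indicator (ball x t) y \<partial>\<mu>) / emeasure \<mu> (ball x t)" (is "_ < ?I / ?m")
      unfolding maxf_def by (auto simp: less_SUP_iff)
    have "0 < t" using t by (auto simp: Qpos_def)
    have "?m < \<Phi> x t"
    proof (rule ccontr)
      assume "\<not> ?m < \<Phi> x t"
      then have "\<Phi> x t \<le> ?m" by simp
      then have "ennreal l * \<Phi> x t \<le> ennreal l * ?m" by (rule mult_left_mono) simp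
      moreover have "ennreal l * \<Phi> x t = ?I"
        using l unfolding \<Phi>_def by (simp add: mult.assoc[symmetric] ennreal_mult[symmetric])
      ultimately have "?I / ?m \<le> ennreal l"
        using ball_pos[OF \<open>0 < t\<close>, of x] by (intro divide_le_posI_ennreal) (auto simp: mult.commute)
      then show False using t(2) by simp
    qed
    then show "x \<in> (\<Union>t\<in>Qpos. {x. emeasure \<mu> (ball x t) < \<Phi> x t})"
      using t(1) by auto
  qed
  have meas: "{x. emeasure \<mu> (ball x t) < \<Phi> x t} \<in> sets borel" for t
    by measurable
  have "emeasure \<mu> {x. ennreal l < maxf h x} \<le> emeasure \<mu> (\<Union>t\<in>Qpos. {x. emeasure \<mu> (ball x t) < \<Phi> x t})"
    using sub countable_Qpos meas by (intro emeasure_mono) (auto simp: sets_eq intro!: sets.countable_UN')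
  also have "\<dots> \<le> ennreal D * (ennreal (1 / l) * (\<integral>\<^sup>+y. h y \<partial>\<mu>))"
  proof (rule vitali_union[OF meas])
    fix C :: "'a set" and r :: "'a \<Rightarrow> real"
    assume "countable C" "disjoint_family_on (\<lambda>x. ball x (r x)) C"
    then have "(\<integral>\<^sup>+x. (\<integral>\<^sup>+y. h y * indicator (ball x (r x)) y \<partial>\<mu>) \<partial>count_space C) \<le> (\<integral>\<^sup>+y. h y \<partial>\<mu>)"
      by (intro disjoint_ball_integral_le) auto
    then show "(\<integral>\<^sup>+x. \<Phi> x (r x) \<partial>count_space C) \<le> ennreal (1 / l) * (\<integral>\<^sup>+y. h y \<partial>\<mu>)"
      unfolding \<Phi>_def by (subst nn_integral_cmult) (auto intro: mult_left_mono)
  qed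
  finally show ?thesis .
qed

text \<open>Values of \<open>h\<close> up to \<open>l\<close> contribute at most \<open>l\<close> to
  every average, so only the part above \<open>l\<close> has to go through the weak type
  bound.\<close>

lemma maxf_le_truncated:
  assumes [measurable]: "h \<in> borel_measurable borel" and l: "0 \<le> l"
  shows "maxf h x \<le> maxf (\<lambda>y. h y * indicator {y. ennreal l < h y} y) x + ennreal l"
  unfolding maxf_def
proof (rule SUP_least)
  let ?h = "\<lambda>y. h y * indicator {y. ennreal l < h y} y"
  fix t assume t: "t \<in> Qpos"
  then have "0 < t" by (auto simp: Qpos_def)
  have [measurable]: "ball x t \<in> sets borel" by simp
  have "(\<integral>\<^sup>+y. h y * indicator (ball x t) y \<partial>\<mu>)
      \<le> (\<integral>\<^sup>+y. ?h y * indicator (ball x t) y + ennreal l * indicator (ball x t) y \<partial>\<mu>)"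
    by (intro nn_integral_mono) (auto simp: indicator_def)
  also have "\<dots> = (\<integral>\<^sup>+y. ?h y * indicator (ball x t) y \<partial>\<mu>) + ennreal l * emeasure \<mu> (ball x t)"
    by (subst nn_integral_add) (simp_all add: nn_integral_cmult_indicator sets_eq)
  finally have "(\<integral>\<^sup>+y. h y * indicator (ball x t) y \<partial>\<mu>) / emeasure \<mu> (ball x t)
     \<le> ((\<integral>\<^sup>+y. ?h y * indicator (ball x t) y \<partial>\<mu>) + ennreal l * emeasure \<mu> (ball x t)) / emeasure \<mu> (ball x t)"
    by (rule divide_right_mono_ennreal)
  also have "\<dots> = (\<integral>\<^sup>+y. ?h y * indicator (ball x t) y \<partial>\<mu>) / emeasure \<mu> (ball x t) + ennreal l"
    using ball_pos[OF \<open>0 < t\<close>, of x] ball_finite[of x t]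
    by (simp add: add_divide_distrib_ennreal ennreal_times_divide[symmetric])
  also have "\<dots> \<le> (SUP t\<in>Qpos. (\<integral>\<^sup>+y. ?h y * indicator (ball x t) y \<partial>\<mu>) / emeasure \<mu> (ball x t)) + ennreal l"
    by (intro add_right_mono SUP_upper t)
  finally show "(\<integral>\<^sup>+y. h y * indicator (ball x t) y \<partial>\<mu>) / emeasure \<mu> (ball x t)
    \<le> (SUP t\<in>Qpos. (\<integral>\<^sup>+y. ?h y * indicator (ball x t) y \<partial>\<mu>) / emeasure \<mu> (ball x t)) + ennreal l" .
qed

text \<open>Marcinkiewicz interpolation between the weak type bound and the trivial bound for
  bounded functions, done directly: at level \<open>l\<close> the function is truncated at
  \<open>l / 2\<close>, and exchanging the integrals leaves \<open>l powr (s - 2)\<close> to be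
  integrated up to \<open>2 * h x\<close>, which converges at zero because
  \<open>s > 1\<close>.\<close>

lemma maxf_strong_type:
  assumes s: "1 < s"
  obtains K :: real where "0 < K" and "\<And>h. h \<in> borel_measurable borel \<Longrightarrow>
    (\<integral>\<^sup>+x. epow (maxf h x) s \<partial>\<mu>) \<le> ennreal K * (\<integral>\<^sup>+x. epow (h x) s \<partial>\<mu>)"
proof -
  define D' where "D' = max D 1"
  \<comment> \<open>The factor \<open>s\<close> comes from the layer-cake formula,
    \<open>2 * D'\<close> from the weak bound at level \<open>l / 2\<close>, and the rest from
    integrating \<open>l powr (s - 2)\<close> up to \<open>2 * h x\<close>.\<close>
  define K where "K = s * (2 * D') / (s - 1) * 2 powr (s - 1)"
  have D': "1 \<le> D'" by (simp add: D'_def)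
  have K: "0 < K" using s D' by (simp add: K_def)
  interpret P: pair_sigma_finite lborel \<mu> ..
  have "(\<integral>\<^sup>+x. epow (maxf h x) s \<partial>\<mu>) \<le> ennreal K * (\<integral>\<^sup>+x. epow (h x) s \<partial>\<mu>)"
    if h [measurable]: "h \<in> borel_measurable borel" for h
  proof -
    have lay: "epow X s = (\<integral>\<^sup>+l. ennreal (s * l powr (s - 1)) * indicator {l. 0 < l \<and> ennreal l < X} l \<partial>lborel)"
      for X
    proof -
      have "(\<integral>\<^sup>+l. ennreal (s * l powr (s - 1)) * indicator {l. 0 < l \<and> ennreal l < X} l \<partial>lborel)
        = (\<integral>\<^sup>+l. ennreal s * (ennreal (l powr (s - 1)) * indicator {l. 0 < l \<and> ennreal l < X} l) \<partial>lborel)"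
        using s by (simp add: ennreal_mult mult.assoc)
      also have "\<dots> = ennreal s * (ennreal (1 / s) * epow X s)"
        using s by (subst nn_integral_cmult) (auto simp: nn_integral_powr_below)
      also have "\<dots> = epow X s"
        using s by (simp add: mult.assoc[symmetric] ennreal_mult[symmetric])
      finally show ?thesis by simp
    qed
    have "(\<integral>\<^sup>+x. epow (maxf h x) s \<partial>\<mu>) =
       (\<integral>\<^sup>+x. (\<integral>\<^sup>+l. ennreal (s * l powr (s - 1)) * indicator {l. 0 < l \<and> ennreal l < maxf h x} l \<partial>lborel) \<partial>\<mu>)"
      unfolding lay ..
    also have "\<dots> = (\<integral>\<^sup>+l. (\<integral>\<^sup>+x. ennreal (s * l powr (s - 1)) * indicator {l. 0 < l \<and> ennreal l < maxf h x} l \<partial>\<mu>) \<partial>lborel)"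
      by (intro P.Fubini') measurable
    also have "\<dots> \<le> (\<integral>\<^sup>+l. (\<integral>\<^sup>+x. ennreal (s * (2 * D') * l powr (s - 2)) * (h x * indicator {l. 0 < l \<and> ennreal l < 2 * h x} l) \<partial>\<mu>) \<partial>lborel)"
    proof (rule nn_integral_mono)
      fix l :: real
      show "(\<integral>\<^sup>+x. ennreal (s * l powr (s - 1)) * indicator {l. 0 < l \<and> ennreal l < maxf h x} l \<partial>\<mu>)
        \<le> (\<integral>\<^sup>+x. ennreal (s * (2 * D') * l powr (s - 2)) * (h x * indicator {l. 0 < l \<and> ennreal l < 2 * h x} l) \<partial>\<mu>)"
      proof (cases "0 < l")
        case True
        let ?h = "\<lambda>y. h y * indicator {y. ennreal (l/2) < h y} y"
        have sub: "ennreal (l/2) < maxf ?h x" if "ennreal l < maxf h x" for x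
        proof (rule ccontr)
          assume "\<not> ennreal (l/2) < maxf ?h x"
          then have "maxf ?h x + ennreal (l/2) \<le> ennreal (l/2) + ennreal (l/2)"
            by (intro add_right_mono) simp
          also have "\<dots> = ennreal l" using True by (simp flip: ennreal_plus)
          finally show False
            using maxf_le_truncated[of h "l/2" x] that True by (simp add: less_le_trans)
        qed
        have "(\<integral>\<^sup>+x. ennreal (s * l powr (s - 1)) * indicator {l. 0 < l \<and> ennreal l < maxf h x} l \<partial>\<mu>)
          = ennreal (s * l powr (s - 1)) * (\<integral>\<^sup>+x. indicator {x. ennreal l < maxf h x} x \<partial>\<mu>)"
          using True by (subst nn_integral_cmult[symmetric]) (auto intro!: nn_integral_cong simp: indicator_def)
        also have "(\<integral>\<^sup>+x. indicator {x. ennreal l < maxf h x} x \<partial>\<mu>) \<le> emeasure \<mu> {x. ennreal (l/2) < maxf ?h x}"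
        proof -
          have "(\<integral>\<^sup>+x. indicator {x. ennreal l < maxf h x} x \<partial>\<mu>) = emeasure \<mu> {x. ennreal l < maxf h x}"
            by (simp add: sets_eq)
          also have "\<dots> \<le> emeasure \<mu> {x. ennreal (l/2) < maxf ?h x}"
            using sub by (intro emeasure_mono) (auto simp: sets_eq)
          finally show ?thesis .
        qed
        also have "\<dots> \<le> ennreal D * (ennreal (1 / (l/2)) * (\<integral>\<^sup>+y. ?h y \<partial>\<mu>))"
          using True by (intro maxf_weak_type) auto
        also have "\<dots> \<le> ennreal D' * (ennreal (1 / (l/2)) * (\<integral>\<^sup>+y. ?h y \<partial>\<mu>))"
          by (intro mult_right_mono ennreal_leI) (auto simp: D'_def)
        also have "(\<integral>\<^sup>+y. ?h y \<partial>\<mu>) = (\<integral>\<^sup>+x. h x * indicator {l. 0 < l \<and> ennreal l < 2 * h x} l \<partial>\<mu>)"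
        proof (rule nn_integral_cong)
          fix x
          have "ennreal (l/2) < h x \<longleftrightarrow> ennreal l < 2 * h x"
          proof (cases "h x")
            case (real y)
            then show ?thesis using True
              by (simp add: ennreal_less_iff ennreal_mult''[symmetric] flip: ennreal_numeral) (auto simp: field_simps)
          qed (auto simp: ennreal_mult_top)
          then show "?h x = h x * indicator {l. 0 < l \<and> ennreal l < 2 * h x} l"
            using True by (simp add: indicator_def)
        qed
        also have "ennreal (s * l powr (s - 1)) * (ennreal D' * (ennreal (1 / (l/2)) * (\<integral>\<^sup>+x. h x * indicator {l. 0 < l \<and> ennreal l < 2 * h x} l \<partial>\<mu>)))
          = ennreal (s * (2 * D') * l powr (s - 2)) * (\<integral>\<^sup>+x. h x * indicator {l. 0 < l \<and> ennreal l < 2 * h x} l \<partial>\<mu>)"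
        proof -
          have "l powr (s - 1) = l powr (s - 2) * l"
            using True powr_add[of l "s - 2" 1] by simp
          then have "s * l powr (s - 1) * (D' * (1 / (l/2))) = s * (2 * D') * l powr (s - 2)"
            using True by simp
          then show ?thesis
            using s True D' by (simp add: mult.assoc[symmetric] ennreal_mult[symmetric])
        qed
        also have "\<dots> = (\<integral>\<^sup>+x. ennreal (s * (2 * D') * l powr (s - 2)) * (h x * indicator {l. 0 < l \<and> ennreal l < 2 * h x} l) \<partial>\<mu>)"
          by (subst nn_integral_cmult) auto
        finally show ?thesis
          by (simp add: mult_left_mono)
      qed auto
    qed
    also have "\<dots> = (\<integral>\<^sup>+x. (\<integral>\<^sup>+l. ennreal (s * (2 * D') * l powr (s - 2)) * (h x * indicator {l. 0 < l \<and> ennreal l < 2 * h x} l) \<partial>lborel) \<partial>\<mu>)"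
      by (intro P.Fubini'[symmetric]) measurable
    also have "\<dots> = (\<integral>\<^sup>+x. ennreal K * epow (h x) s \<partial>\<mu>)"
    proof (rule nn_integral_cong)
      fix x
      have "(\<integral>\<^sup>+l. ennreal (s * (2 * D') * l powr (s - 2)) * (h x * indicator {l. 0 < l \<and> ennreal l < 2 * h x} l) \<partial>lborel)
         = (\<integral>\<^sup>+l. (ennreal (s * (2 * D')) * h x) * (ennreal (l powr ((s - 1) - 1)) * indicator {l. 0 < l \<and> ennreal l < 2 * h x} l) \<partial>lborel)"
        using s D' by (intro nn_integral_cong) (simp add: ennreal_mult mult_ac)
      also have "\<dots> = (ennreal (s * (2 * D')) * h x) * (ennreal (1 / (s - 1)) * epow (2 * h x) (s - 1))"
        using s nn_integral_powr_below[of "s - 1" "2 * h x"] by (subst nn_integral_cmult) auto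
      also have "epow (2 * h x) (s - 1) = ennreal (2 powr (s - 1)) * epow (h x) (s - 1)"
        using s epow_ennreal[of 2 "s - 1"] by (simp add: epow_mult)
      also have "(ennreal (s * (2 * D')) * h x) * (ennreal (1 / (s - 1)) * (ennreal (2 powr (s - 1)) * epow (h x) (s - 1)))
        = (ennreal (s * (2 * D')) * (ennreal (1 / (s - 1)) * ennreal (2 powr (s - 1)))) * (epow (h x) 1 * epow (h x) (s - 1))"
        by (simp add: mult_ac)
      also have "epow (h x) 1 * epow (h x) (s - 1) = epow (h x) s"
        using s by (subst epow_add[symmetric]) auto
      also have "ennreal (s * (2 * D')) * (ennreal (1 / (s - 1)) * ennreal (2 powr (s - 1))) = ennreal K"
        using s D' by (simp add: K_def ennreal_mult[symmetric])
      finally show "(\<integral>\<^sup>+l. ennreal (s * (2 * D') * l powr (s - 2)) * (h x * indicator {l. 0 < l \<and> ennreal l < 2 * h x} l) \<partial>lborel)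
         = ennreal K * epow (h x) s" .
    qed
    also have "\<dots> = ennreal K * (\<integral>\<^sup>+x. epow (h x) s \<partial>\<mu>)"
      by (rule nn_integral_cmult) measurable
    finally show ?thesis .
  qed
  with K show ?thesis by (rule that)
qed

end

section \<open>Hedberg balancing and the kernel\<close>

lemma nn_integral_powr_above:
  assumes "0 < a" "0 < R"
  shows "(\<integral>\<^sup>+t. ennreal (t powr (- a - 1)) * indicator {R..} t \<partial>lborel) = ennreal (R powr (- a) / a)"
  using nn_integral_has_integral_lebesgue'[OF _ has_integral_powr_to_inf[of "- a - 1" R]] assms by simp

text \<open>Weights proportional to the opposite exponents make the powers of \<open>g\<close>
  cancel in the geometric mean of the two bounds. The result is free of \<open>g\<close>, hence
  uniform over all scales.\<close>

lemma min_interpolate: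
  fixes A K g a b T :: real
  assumes "0 < A" "0 < K" "0 < g" "0 < a" "0 < b" "T \<le> A * g powr (- a)" "T \<le> K * g powr b"
  shows "T \<le> A powr (b / (a + b)) * K powr (a / (a + b))"
proof (cases "T \<le> 0")
  case True
  then show ?thesis
    using assms by (meson mult_nonneg_nonneg order_trans powr_ge_zero)
next
  case False
  then have T: "0 < T" by simp
  have "T = T powr (b / (a + b)) * T powr (a / (a + b))"
    using T assms by (simp add: powr_add[symmetric] add_divide_distrib[symmetric] add.commute)
  also have "\<dots> \<le> (A * g powr (- a)) powr (b / (a + b)) * (K * g powr b) powr (a / (a + b))"
    using T assms by (intro mult_mono powr_mono2) auto
  also have "\<dots> = A powr (b / (a + b)) * K powr (a / (a + b)) * (g powr (- a * (b / (a + b))) * g powr (b * (a / (a + b))))"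
    using assms by (simp add: powr_mult powr_powr mult_ac)
  also have "g powr (- a * (b / (a + b))) * g powr (b * (a / (a + b))) = 1"
    using assms by (simp add: powr_add[symmetric])
  finally show ?thesis by simp
qed

text \<open>\<open>\<theta>\<close> is the value of the scale variable at which the decreasing bound
  \<open>A * g powr (- a)\<close> meets the increasing bound \<open>K * g powr b\<close>; the common
  value is the same geometric mean as in \<open>min_interpolate\<close>.\<close>

lemma balance_point:
  fixes A K a b :: real
  assumes "0 < A" "0 < K" "0 < a" "0 < b"
  defines "\<theta> \<equiv> (A / K) powr (1 / (a + b))"
  shows "K * \<theta> powr b = A powr (b / (a + b)) * K powr (a / (a + b))"
    and "A * \<theta> powr (- a) = A powr (b / (a + b)) * K powr (a / (a + b))"
proof -
  have ab: "1 = a / (a + b) + b / (a + b)"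
    using assms by (simp add: add_divide_distrib[symmetric])
  have "K * \<theta> powr b = K powr 1 * (A powr (b / (a + b)) / K powr (b / (a + b)))"
    using assms by (simp add: powr_powr powr_divide)
  also have "K powr 1 = K powr (a / (a + b)) * K powr (b / (a + b))"
    using assms by (subst ab) (rule powr_add)
  finally show "K * \<theta> powr b = A powr (b / (a + b)) * K powr (a / (a + b))"
    using assms by simp
  have "A * \<theta> powr (- a) = A powr 1 * (K powr (a / (a + b)) / A powr (a / (a + b)))"
    using assms by (simp add: powr_powr powr_divide powr_minus field_simps)
  also have "A powr 1 = A powr (a / (a + b)) * A powr (b / (a + b))"
    using assms by (subst ab) (rule powr_add)
  finally show "A * \<theta> powr (- a) = A powr (b / (a + b)) * K powr (a / (a + b))"
    using assms by simp
qed

text \<open>Hedberg's argument with the radius replaced by a quantity \<open>G\<close> known only to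
  grow at least like a power. The integral is cut where \<open>G\<close> passes the balance value.
  Below the cut the bound \<open>T2\<close>, above it the bound \<open>T1\<close>, decays like a
  power of the radius, so both pieces converge and have the balanced size.\<close>

lemma hedberg_integral:
  fixes G :: "real \<Rightarrow> real" and T :: "real \<Rightarrow> ennreal"
  assumes pos: "\<And>t. 0 < t \<Longrightarrow> 0 < G t"
    and growth: "\<And>t R. 0 < t \<Longrightarrow> t \<le> R \<Longrightarrow> G t \<le> c * (t / R) powr d * G R"
    and c: "0 < c" and d: "0 < d" and ab: "0 < a" "0 < b" and AK: "0 < A" "0 < K"
    and T1: "\<And>t. 0 < t \<Longrightarrow> T t \<le> ennreal (A * G t powr (- a))"
    and T2: "\<And>t. 0 < t \<Longrightarrow> T t \<le> ennreal (K * G t powr b)"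
  shows "(\<integral>\<^sup>+t. T t * ennreal (1 / t) * indicator {0<..} t \<partial>lborel)
     \<le> ennreal (((c * 2 powr d) powr b / (d * b) + (c * 2 powr d) powr a / (d * a))
          * (A powr (b / (a + b)) * K powr (a / (a + b))))"
proof -
  define \<theta> where "\<theta> = (A / K) powr (1 / (a + b))"
  have \<theta>: "0 < \<theta>" using AK by (simp add: \<theta>_def)
  define c' where "c' = c * 2 powr d"
  have c': "0 < c'" using c by (simp add: c'_def)
  \<comment> \<open>Only power growth of \<open>G\<close> is assumed, so the cut is a supremum.
    Comparing with the value at radius one shows that \<open>S\<close> is nonempty and
    bounded.\<close>
  define S where "S = {t. 0 < t \<and> G t \<le> \<theta>}"
  define R where "R = Sup S"
  have G1: "0 < G 1" using pos by simp
  have "\<exists>t. t \<in> S"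
  proof -
    define t where "t = min 1 ((\<theta> / (c * G 1)) powr (1 / d))"
    have t: "0 < t" "t \<le> 1" using \<theta> c G1 by (auto simp: t_def)
    have "t powr d \<le> ((\<theta> / (c * G 1)) powr (1 / d)) powr d"
      using t d by (intro powr_mono2) (auto simp: t_def)
    also have "\<dots> = \<theta> / (c * G 1)" using d \<theta> c G1 by (simp add: powr_powr)
    finally have "c * t powr d * G 1 \<le> \<theta>" using c G1 by (simp add: field_simps)
    moreover have "G t \<le> c * t powr d * G 1" using growth[OF t] by simp
    ultimately show ?thesis using t by (auto simp: S_def)
  qed
  then obtain t0 where t0: "t0 \<in> S" by auto
  have bdd: "bdd_above S"
  proof (rule bdd_aboveI)
    fix t assume t: "t \<in> S"
    show "t \<le> max 1 ((c * \<theta> / G 1) powr (1 / d))"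
    proof (cases "t \<le> 1")
      case False
      have "G 1 \<le> c * (1 / t) powr d * G t" using growth[of 1 t] False by simp
      also have "\<dots> \<le> c * (1 / t) powr d * \<theta>" using t c by (intro mult_left_mono) (auto simp: S_def)
      also have "\<dots> = c * \<theta> / t powr d" using False by (simp add: powr_divide)
      finally have "t powr d \<le> c * \<theta> / G 1" using False G1 by (simp add: field_simps)
      then have "(t powr d) powr (1 / d) \<le> (c * \<theta> / G 1) powr (1 / d)"
        using d by (intro powr_mono2) auto
      then show ?thesis using d False by (simp add: powr_powr)
    qed auto
  qed
  have R: "0 < R"
    using t0 cSup_upper[OF t0 bdd] by (auto simp: R_def S_def)
  \<comment> \<open>The supremum need not be attained, so \<open>G t\<close> is compared with
    \<open>G u\<close> for some \<open>u\<close> in \<open>S\<close> above \<open>R / 2\<close>;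
    this costs the factor \<open>2 powr d\<close> inside \<open>c'\<close>.\<close>
  have below: "G t \<le> c' * (t / R) powr d * \<theta>" if t: "0 < t" "t < R" for t
  proof -
    have "max t (R / 2) < Sup S" using t R by (simp add: R_def[symmetric])
    then obtain u where u: "u \<in> S" "max t (R / 2) < u"
      using less_cSup_iff[OF _ bdd] t0 by blast
    have u0: "0 < u" using u by (auto simp: S_def)
    have "G t \<le> c * (t / u) powr d * G u" using growth[of t u] t u by auto
    also have "\<dots> \<le> c * (2 * (t / R)) powr d * \<theta>"
    proof (intro mult_mono powr_mono2)
      show "t / u \<le> 2 * (t / R)" using t u R u0 by (simp add: field_simps)
    qed (use u c d t u0 pos[OF u0] in \<open>auto simp: S_def\<close>)
    also have "\<dots> = c' * (t / R) powr d * \<theta>"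
      using powr_mult[of 2 "t / R" d] t R by (simp add: c'_def)
    finally show ?thesis .
  qed
  \<comment> \<open>Symmetrically, some \<open>u\<close> between \<open>R\<close> and
    \<open>2 * R\<close> and below \<open>t\<close> lies outside \<open>S\<close>, so
    \<open>G u\<close> exceeds \<open>\<theta>\<close> and growth carries this over to
    \<open>t\<close>.\<close>
  have above: "(t / R) powr d * \<theta> \<le> c' * G t" if t: "R < t" for t
  proof -
    have "R < min t (2 * R)" using t R by auto
    then obtain u where u: "R < u" "u < min t (2 * R)" using dense by blast
    have u0: "0 < u" using u R by simp
    have "u \<notin> S" using u(1) cSup_upper[OF _ bdd, of u] by (force simp: R_def[symmetric])
    then have "\<theta> < G u" using u0 by (auto simp: S_def)
    then have "\<theta> \<le> c * (u / t) powr d * G t" using growth[of u t] u u0 by auto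
    also have "\<dots> \<le> c * (2 * (R / t)) powr d * G t"
    proof (intro mult_right_mono mult_left_mono powr_mono2)
      show "u / t \<le> 2 * (R / t)" using t u R by (simp add: field_simps)
      show "0 \<le> G t" using pos[of t] t R by simp
    qed (use c d u0 t R in auto)
    also have "\<dots> = c' * (R / t) powr d * G t" using powr_mult[of 2 "R / t" d] t R by (simp add: c'_def)
    finally have "(t / R) powr d * \<theta> \<le> (t / R) powr d * (c' * (R / t) powr d * G t)"
      by (intro mult_left_mono) auto
    also have "\<dots> = c' * G t * ((t / R) powr d * (R / t) powr d)" by simp
    also have "(t / R) powr d * (R / t) powr d = 1"
      using t R by (simp add: powr_mult[symmetric])
    finally show ?thesis by simp
  qed
  define X where "X = A powr (b / (a + b)) * K powr (a / (a + b))"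
  have X: "0 < X" using AK by (simp add: X_def)
  have bal: "K * \<theta> powr b = X" "A * \<theta> powr (- a) = X"
    unfolding X_def \<theta>_def using balance_point[OF AK ab] by auto
  have low: "T t * ennreal (1 / t) \<le> ennreal (c' powr b * X * R powr (- (d * b)) ) * ennreal (t powr (d * b - 1))"
    if t: "0 < t" "t < R" for t
  proof -
    have "T t \<le> ennreal (K * G t powr b)" by (rule T2) fact
    also have "\<dots> \<le> ennreal (K * (c' * (t / R) powr d * \<theta>) powr b)"
      using below[OF t] pos[OF t(1)] AK ab by (intro ennreal_leI mult_left_mono powr_mono2) auto
    also have "K * (c' * (t / R) powr d * \<theta>) powr b = c' powr b * (K * \<theta> powr b) * (t / R) powr (d * b)"
      using t R c' \<theta> by (simp add: powr_mult powr_powr mult_ac)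
    also have "\<dots> = c' powr b * X * R powr (- (d * b)) * t powr (d * b)"
      using t R by (simp add: bal powr_divide powr_minus field_simps)
    finally have "T t * ennreal (1 / t) \<le> ennreal (c' powr b * X * R powr (- (d * b)) * t powr (d * b)) * ennreal (1 / t)"
      by (intro mult_right_mono) auto
    also have "\<dots> = ennreal (c' powr b * X * R powr (- (d * b))) * ennreal (t powr (d * b - 1))"
      using t X by (simp add: ennreal_mult[symmetric] powr_diff)
    finally show ?thesis .
  qed
  have high: "T t * ennreal (1 / t) \<le> ennreal (c' powr a * X * R powr (d * a)) * ennreal (t powr (- (d * a) - 1))"
    if t: "R < t" for t
  proof -
    have t0: "0 < t" using t R by simp
    have "T t \<le> ennreal (A * G t powr (- a))" by (rule T1) fact
    also have "\<dots> \<le> ennreal (A * ((t / R) powr d * \<theta> / c') powr (- a))"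
      using above[OF t] c' t R \<theta> AK ab
      by (intro ennreal_leI mult_left_mono powr_mono2') (auto simp: field_simps)
    also have "A * ((t / R) powr d * \<theta> / c') powr (- a) = c' powr a * (A * \<theta> powr (- a)) * (t / R) powr (- (d * a))"
      using t R c' \<theta> by (simp add: powr_mult powr_divide powr_powr powr_minus field_simps)
    also have "\<dots> = c' powr a * X * R powr (d * a) * t powr (- (d * a))"
      unfolding bal(2) using t t0 R by (simp add: powr_divide powr_minus field_simps)
    finally have "T t * ennreal (1 / t) \<le> ennreal (c' powr a * X * R powr (d * a) * t powr (- (d * a))) * ennreal (1 / t)"
      by (intro mult_right_mono) auto
    also have "\<dots> = ennreal (c' powr a * X * R powr (d * a)) * ennreal (t powr (- (d * a) - 1))"
      using t t0 X by (simp add: ennreal_mult[symmetric] powr_diff)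
    finally show ?thesis .
  qed
  have "(\<integral>\<^sup>+t. T t * ennreal (1 / t) * indicator {0<..} t \<partial>lborel) \<le>
     (\<integral>\<^sup>+t. ennreal (c' powr b * X * R powr (- (d * b))) * (ennreal (t powr (d * b - 1)) * indicator {t. 0 < t \<and> ennreal t < ennreal R} t)
       + ennreal (c' powr a * X * R powr (d * a)) * (ennreal (t powr (- (d * a) - 1)) * indicator {R..} t) \<partial>lborel)"
  proof (rule nn_integral_mono_AE)
    have "AE t in lborel. t \<noteq> R" by (rule AE_lborel_singleton)
    then show "AE t in lborel. T t * ennreal (1 / t) * indicator {0<..} t \<le>
      ennreal (c' powr b * X * R powr (- (d * b))) * (ennreal (t powr (d * b - 1)) * indicator {t. 0 < t \<and> ennreal t < ennreal R} t)
       + ennreal (c' powr a * X * R powr (d * a)) * (ennreal (t powr (- (d * a) - 1)) * indicator {R..} t)"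
    proof eventually_elim
      case (elim t)
      consider "t \<le> 0" | "0 < t" "t < R" | "R < t" using elim by linarith
      then show ?case
      proof cases
        case 2
        then show ?thesis using low[of t] by (simp add: ennreal_less_iff indicator_def)
      next
        case 3
        then show ?thesis using high[of t] R by (simp add: ennreal_less_iff indicator_def)
      qed auto
    qed
  qed
  also have "\<dots> = ennreal (c' powr b * X * R powr (- (d * b))) * (ennreal (1 / (d * b)) * epow (ennreal R) (d * b))
     + ennreal (c' powr a * X * R powr (d * a)) * ennreal (R powr (- (d * a)) / (d * a))"
    using d ab R by (simp add: nn_integral_add nn_integral_cmult nn_integral_powr_below nn_integral_powr_above)
  also have "\<dots> = ennreal (c' powr b * X * R powr (- (d * b)) * ((1 / (d * b)) * R powr (d * b))
      + c' powr a * X * R powr (d * a) * (R powr (- (d * a)) / (d * a)))"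
    using d ab R X by (simp add: ennreal_mult[symmetric] ennreal_plus[symmetric] del: ennreal_plus)
  also have "c' powr b * X * R powr (- (d * b)) * ((1 / (d * b)) * R powr (d * b))
      + c' powr a * X * R powr (d * a) * (R powr (- (d * a)) / (d * a))
      = (c' powr b / (d * b) + c' powr a / (d * a)) * X"
    using R d ab by (simp add: powr_minus field_simps)
  finally show ?thesis unfolding X_def c'_def .
qed

section \<open>The kernel as an integral over scales\<close>

definition mpot :: "nat \<Rightarrow> real \<Rightarrow> (nat \<Rightarrow> 'a::euclidean_space \<Rightarrow> real) \<Rightarrow> 'a \<Rightarrow> ennreal" where
  "mpot m s f x = (\<integral>\<^sup>+t. ennreal (t powr (- s - 1)) * (\<Prod>i<m. \<integral>\<^sup>+y. ennreal \<bar>f i y\<bar> * indicator (ball x t) y \<partial>lborel)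
      * indicator {0<..} t \<partial>lborel)"

text \<open>With \<open>d\<close> the sum of the distances and \<open>s\<close> the homogeneity,
  \<open>d powr (- s)\<close> is \<open>s\<close> times the integral of
  \<open>t powr (- s - 1)\<close> over \<open>t > d\<close>. For such \<open>t\<close> each single
  distance is below \<open>t\<close>, so a product of indicators separates the variables, and
  Tonelli yields a product of one-variable ball integrals.\<close>

lemma mfrac_kernel_le_mpot:
  fixes f :: "nat \<Rightarrow> 'a::euclidean_space \<Rightarrow> real"
  assumes [measurable]: "\<And>i. i < m \<Longrightarrow> f i \<in> borel_measurable borel"
    and s: "0 < real m * real DIM('a) - \<alpha>"
  shows "(\<integral>\<^sup>+y. ennreal \<bar>mfrac_kernel m \<alpha> f x y\<bar> \<partial>(\<Pi>\<^sub>M i\<in>{..<m}. (lborel :: 'a measure)))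
     \<le> ennreal (real m * real DIM('a) - \<alpha>) * mpot m (real m * real DIM('a) - \<alpha>) f x"
proof -
  define s where "s = real m * real DIM('a) - \<alpha>"
  have s0: "0 < s" using s by (simp add: s_def)
  define PM where "PM = (\<Pi>\<^sub>M i\<in>{..<m}. (lborel :: 'a measure))"
  interpret PS: product_sigma_finite "\<lambda>i::nat. (lborel :: 'a measure)" ..
  have sfm: "sigma_finite_measure PM"
    unfolding PM_def by (rule PS.sigma_finite) simp
  interpret pair_sigma_finite lborel PM
    by (intro pair_sigma_finite.intro sfm) (rule sigma_finite_lborel)
  have [measurable]: "(\<lambda>y. y i) \<in> measurable PM borel" if "i < m" for i
    unfolding PM_def using that measurable_component_singleton[of i "{..<m}" "\<lambda>_. lborel :: 'a measure"] by simp
  define g where "g t y = (ennreal (s * t powr (- s - 1)) * indicator {0<..} t) *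
     (\<Prod>i<m. ennreal \<bar>f i (y i)\<bar> * indicator (ball x t) (y i))" for t and y :: "nat \<Rightarrow> 'a"
  have pt: "ennreal \<bar>mfrac_kernel m \<alpha> f x y\<bar> \<le> (\<integral>\<^sup>+t. g t y \<partial>lborel)" for y
  proof -
    define d where "d = (\<Sum>i<m. dist x (y i))"
    have d: "0 \<le> d" by (simp add: d_def sum_nonneg)
    show ?thesis
    proof (cases "d = 0")
      \<comment> \<open>On the diagonal the kernel is zero by the conventions
        \<open>0 powr s = 0\<close> and \<open>a / 0 = 0\<close>.\<close>
      case True
      then show ?thesis using s by (simp add: mfrac_kernel_def d_def)
    next
      case False
      then have d0: "0 < d" using d by simp
      have "ennreal \<bar>mfrac_kernel m \<alpha> f x y\<bar> = ennreal (\<Prod>i<m. \<bar>f i (y i)\<bar>) * ennreal (s * (d powr (- s) / s))"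
        using s0 d0 unfolding mfrac_kernel_def d_def[symmetric] s_def[symmetric]
        by (simp add: abs_mult abs_prod powr_minus divide_inverse ennreal_mult[symmetric] prod_nonneg)
      also have "ennreal (s * (d powr (- s) / s)) = ennreal s * (\<integral>\<^sup>+t. ennreal (t powr (- s - 1)) * indicator {d..} t \<partial>lborel)"
        using nn_integral_powr_above[OF s0 d0] s0 by (simp add: ennreal_mult[symmetric])
      also have "ennreal (\<Prod>i<m. \<bar>f i (y i)\<bar>) * \<dots> = (\<integral>\<^sup>+t. ennreal (\<Prod>i<m. \<bar>f i (y i)\<bar>) * (ennreal s * (ennreal (t powr (- s - 1)) * indicator {d..} t)) \<partial>lborel)"
        by (simp add: nn_integral_cmult)
      also have "\<dots> \<le> (\<integral>\<^sup>+t. g t y \<partial>lborel)"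
      proof (rule nn_integral_mono_AE)
        have "AE t in lborel. t \<noteq> d" by (rule AE_lborel_singleton)
        then show "AE t in lborel. ennreal (\<Prod>i<m. \<bar>f i (y i)\<bar>) * (ennreal s * (ennreal (t powr (- s - 1)) * indicator {d..} t)) \<le> g t y"
        proof eventually_elim
          case (elim t)
          show ?case
          proof (cases "d < t")
            case True
            have "dist x (y i) < t" if "i < m" for i
            proof -
              have "dist x (y i) \<le> d" unfolding d_def using that by (intro member_le_sum) auto
              then show ?thesis using True by simp
            qed
            then have "(\<Prod>i<m. ennreal \<bar>f i (y i)\<bar> * indicator (ball x t) (y i)) = (\<Prod>i<m. ennreal \<bar>f i (y i)\<bar>)"
              by (intro prod.cong) auto
            also have "\<dots> = ennreal (\<Prod>i<m. \<bar>f i (y i)\<bar>)" by (rule prod_ennreal) auto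
            finally show ?thesis using True d0 s0
              by (simp add: g_def ennreal_mult mult_ac)
          qed (use elim in auto)
        qed
      qed
      finally show ?thesis .
    qed
  qed
  \<comment> \<open>The radius of the ball varies here; writing its indicator as a condition on the
    distance exposes measurability in the pair of scale and points.\<close>
  have [measurable]: "case_prod g \<in> borel_measurable (lborel \<Otimes>\<^sub>M PM)"
  proof -
    have "case_prod g = (\<lambda>z. (ennreal (s * fst z powr (- s - 1)) * indicator {0<..} (fst z)) *
       (\<Prod>i<m. ennreal \<bar>f i (snd z i)\<bar> * (if dist x (snd z i) < fst z then 1 else 0)))"
      by (auto simp: fun_eq_iff g_def indicator_def of_bool_def)
    then show ?thesis by simp
  qed
  have "(\<integral>\<^sup>+y. ennreal \<bar>mfrac_kernel m \<alpha> f x y\<bar> \<partial>PM) \<le> (\<integral>\<^sup>+y. (\<integral>\<^sup>+t. g t y \<partial>lborel) \<partial>PM)"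
    by (intro nn_integral_mono pt)
  also have "\<dots> = (\<integral>\<^sup>+t. (\<integral>\<^sup>+y. g t y \<partial>PM) \<partial>lborel)"
    by (rule Fubini') measurable
  also have "\<dots> = (\<integral>\<^sup>+t. ennreal s * (ennreal (t powr (- s - 1)) * (\<Prod>i<m. \<integral>\<^sup>+y. ennreal \<bar>f i y\<bar> * indicator (ball x t) y \<partial>lborel)
      * indicator {0<..} t) \<partial>lborel)"
  proof (rule nn_integral_cong)
    fix t :: real
    have b [measurable]: "ball x t \<in> sets borel" by simp
    have "(\<integral>\<^sup>+y. g t y \<partial>PM) = (ennreal (s * t powr (- s - 1)) * indicator {0<..} t) *
       (\<integral>\<^sup>+y. (\<Prod>i<m. ennreal \<bar>f i (y i)\<bar> * indicator (ball x t) (y i)) \<partial>PM)"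
      unfolding g_def by (rule nn_integral_cmult) measurable
    also have "(\<integral>\<^sup>+y. (\<Prod>i<m. ennreal \<bar>f i (y i)\<bar> * indicator (ball x t) (y i)) \<partial>PM)
        = (\<Prod>i<m. \<integral>\<^sup>+y. ennreal \<bar>f i y\<bar> * indicator (ball x t) y \<partial>lborel)"
      unfolding PM_def by (rule PS.product_nn_integral_prod) auto
    finally show "(\<integral>\<^sup>+y. g t y \<partial>PM) = ennreal s * (ennreal (t powr (- s - 1)) * (\<Prod>i<m. \<integral>\<^sup>+y. ennreal \<bar>f i y\<bar> * indicator (ball x t) y \<partial>lborel)
      * indicator {0<..} t)"
      using s0 by (simp add: ennreal_mult mult_ac)
  qed
  also have "\<dots> \<le> ennreal s * mpot m s f x"
  proof -
    have "(\<lambda>t. \<integral>\<^sup>+y. ennreal \<bar>f i y\<bar> * (if dist x y < t then 1 else 0) \<partial>lborel) \<in> borel_measurable lborel" if "i < m" for i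
      using that by measurable
    then have [measurable]: "(\<lambda>t. \<integral>\<^sup>+y. ennreal \<bar>f i y\<bar> * indicator (ball x t) y \<partial>lborel) \<in> borel_measurable borel" if "i < m" for i
      using that by (simp add: indicator_def)
    show ?thesis
      unfolding mpot_def by (subst nn_integral_cmult) (simp_all, measurable)
  qed
  finally show ?thesis unfolding PM_def s_def .
qed

section \<open>Off-diagonal weights in one variable\<close>

lemma sets_ball [measurable]: "ball x r \<in> sets borel"
  by simp

lemma nn_integral_ball_eq_wball:
  assumes "set_integrable lborel (ball x r) g" "\<And>y. 0 \<le> g y"
  shows "(\<integral>\<^sup>+y. ennreal (g y) * indicator (ball x r) y \<partial>lborel) = ennreal (wball g x r)"
proof -
  have "(\<integral>\<^sup>+y. ennreal (g y) * indicator (ball x r) y \<partial>lborel) = (\<integral>\<^sup>+y. ennreal (indicator (ball x r) y *\<^sub>R g y) \<partial>lborel)"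
    by (intro nn_integral_cong) (auto simp: indicator_def)
  also have "\<dots> = ennreal (wball g x r)"
    unfolding wball_def set_lebesgue_integral_def using assms
    by (intro nn_integral_eq_integral) (auto simp: set_integrable_def)
  finally show ?thesis .
qed

lemma wball_nonneg: "(\<And>y. 0 \<le> g y) \<Longrightarrow> 0 \<le> wball g x r"
  unfolding wball_def set_lebesgue_integral_def by (intro Bochner_Integration.integral_nonneg) (auto simp: indicator_def)

lemma wball_pos:
  fixes g :: "'a::euclidean_space \<Rightarrow> real"
  assumes "set_integrable lborel (ball x r) g" "\<And>y. 0 \<le> g y" "AE y in lborel. 0 < g y" "0 < r"
    and [measurable]: "g \<in> borel_measurable borel"
  shows "0 < wball g x r"
proof (rule ccontr)
  assume "\<not> 0 < wball g x r"
  then have "wball g x r = 0" using wball_nonneg[of g x r] assms by auto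
  then have "(\<integral>\<^sup>+y. ennreal (g y) * indicator (ball x r) y \<partial>lborel) = 0"
    using nn_integral_ball_eq_wball[OF assms(1,2)] by simp
  then have "AE y in lborel. ennreal (g y) * indicator (ball x r) y = 0"
    by (subst (asm) nn_integral_0_iff_AE) auto
  then have "AE y in lborel. y \<notin> ball x r"
    using assms(3) by eventually_elim (auto simp: indicator_def ennreal_eq_0_iff split: if_splits)
  then have "emeasure lborel (ball x r) = 0"
    by (simp add: AE_iff_measurable[OF _ refl] ball_def)
  then show False
    using \<open>0 < r\<close> content_ball_pos[of r x] by (simp add: measure_def)
qed

definition bvol :: "'a::euclidean_space itself \<Rightarrow> real" where
  "bvol _ = unit_ball_vol (real DIM('a))"

lemma bvol_pos: "0 < bvol TYPE('a::euclidean_space)"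
  by (simp add: bvol_def)

lemma emeasure_ball_powr:
  "0 < t \<Longrightarrow> emeasure lborel (ball (x::'a::euclidean_space) t) = ennreal (bvol TYPE('a) * t powr real DIM('a))"
  by (simp add: emeasure_ball bvol_def powr_realpow)

lemma content_ball_powr:
  "0 < t \<Longrightarrow> measure lborel (ball (x::'a::euclidean_space) t) = bvol TYPE('a) * t powr real DIM('a)"
  by (simp add: measure_def emeasure_ball_powr less_imp_le[OF bvol_pos])

text \<open>\<open>w_Holder\<close> is the one-variable off-diagonal condition after Holder has been
  applied, so the dual norm of the weight no longer appears. In this form the case
  \<open>p = 1\<close>, where the dual norm is an essential infimum, and the case
  \<open>p > 1\<close> are treated alike. The exponent of \<open>t\<close> is the dimension minus
  the order of the one-variable fractional integral.\<close>

locale apq_weight =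
  fixes p q H :: real and w :: "'a::euclidean_space \<Rightarrow> real"
  assumes p_ge: "1 \<le> p" and p_less: "p < q" and H_pos: "0 < H"
    and w_meas [measurable]: "w \<in> borel_measurable borel"
    and w_nonneg: "0 \<le> w x"
    and w_pos: "AE x in lborel. 0 < w x"
    and w_int: "set_integrable lborel (ball x r) (\<lambda>y. w y powr q)"
    and w_Holder: "h \<in> borel_measurable borel \<Longrightarrow> 0 < t \<Longrightarrow>
      (\<integral>\<^sup>+y. h y * indicator (ball x t) y \<partial>lborel)
        \<le> ennreal (H * t powr (real DIM('a) * (1 - 1/p + 1/q)) * wball (\<lambda>y. w y powr q) x t powr (- 1/q))
          * epow (\<integral>\<^sup>+y. epow (h y) p * ennreal (w y powr p) * indicator (ball x t) y \<partial>lborel) (1/p)"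
begin

definition V :: "'a \<Rightarrow> real \<Rightarrow> real" where "V x t = wball (\<lambda>y. w y powr q) x t"

lemma q_pos: "0 < p" "0 < q" "1 < q"
  using p_ge p_less by auto

lemma V_eq: "(\<integral>\<^sup>+y. ennreal (w y powr q) * indicator (ball x t) y \<partial>lborel) = ennreal (V x t)"
  unfolding V_def by (intro nn_integral_ball_eq_wball w_int) auto

lemma V_nonneg: "0 \<le> V x t"
  unfolding V_def by (intro wball_nonneg) auto

lemma V_pos: "0 < t \<Longrightarrow> 0 < V x t"
  unfolding V_def using w_pos by (intro wball_pos w_int) (auto elim!: eventually_mono)

lemma V_mono:
  assumes "ball x t \<subseteq> ball y r"
  shows "V x t \<le> V y r"
proof -
  have "ennreal (V x t) \<le> ennreal (V y r)"
    unfolding V_eq[symmetric] using assms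
    by (intro nn_integral_mono mult_left_mono) (auto simp: indicator_def)
  then show ?thesis using V_nonneg by (simp add: ennreal_le_iff)
qed

text \<open>The condition is tested on the indicator of \<open>E\<close>, and the
  \<open>w powr p\<close> mass of \<open>E\<close> is estimated by its \<open>w powr q\<close> mass
  through Holder. Doubling and reverse doubling both follow from this quantitative comparison with
  Lebesgue measure.\<close>

lemma measure_ratio:
  assumes E [measurable]: "E \<in> sets borel" and sub: "E \<subseteq> ball x t" and t: "0 < t"
  shows "emeasure lborel E \<le> ennreal (H * bvol TYPE('a) powr (1/p - 1/q) * t powr real DIM('a) * V x t powr (- 1/q))
     * epow (\<integral>\<^sup>+y. ennreal (w y powr q) * indicator E y \<partial>lborel) (1/q)"
proof -
  let ?VE = "\<integral>\<^sup>+y. ennreal (w y powr q) * indicator E y \<partial>lborel"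
  have pq: "0 < 1/p - 1/q" "0 < p/q" "0 < 1 - p/q" using q_pos p_less by (auto simp: field_simps)
  have [measurable]: "ball x t \<in> sets borel" by simp
  have "(\<integral>\<^sup>+y. indicator E y * indicator (ball x t) y \<partial>lborel)
     \<le> ennreal (H * t powr (real DIM('a) * (1 - 1/p + 1/q)) * V x t powr (- 1/q))
        * epow (\<integral>\<^sup>+y. epow (indicator E y) p * ennreal (w y powr p) * indicator (ball x t) y \<partial>lborel) (1/p)"
    unfolding V_def by (rule w_Holder) (use t in auto)
  also have "(\<integral>\<^sup>+y. epow (indicator E y) p * ennreal (w y powr p) * indicator (ball x t) y \<partial>lborel)
      \<le> (\<integral>\<^sup>+y. epow (ennreal (w y powr q) * indicator E y) (p/q) * epow (indicator E y) (1 - p/q) \<partial>lborel)"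
    using q_pos w_nonneg by (intro nn_integral_mono) (auto simp: indicator_def powr_powr)
  also have "\<dots> \<le> epow ?VE (p/q) * epow (\<integral>\<^sup>+y. indicator E y \<partial>lborel) (1 - p/q)"
    by (intro Holder_nn_integral2) (use pq in auto)
  also have "(\<integral>\<^sup>+y. indicator E y \<partial>lborel) = emeasure lborel E" by simp
  also have "emeasure lborel E \<le> ennreal (bvol TYPE('a) * t powr real DIM('a))"
    using sub emeasure_ball_powr[OF t, of x] by (metis E borel_open emeasure_mono open_ball sets_lborel)
  also have "epow (ennreal (bvol TYPE('a) * t powr real DIM('a))) (1 - p/q)
     = ennreal (bvol TYPE('a) powr (1 - p/q) * t powr (real DIM('a) * (1 - p/q)))"
    using bvol_pos[where 'a='a] by (simp add: powr_mult powr_powr)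
  also have "epow (epow ?VE (p/q) * ennreal (bvol TYPE('a) powr (1 - p/q) * t powr (real DIM('a) * (1 - p/q)))) (1/p)
     = epow ?VE (1/q) * ennreal (bvol TYPE('a) powr (1/p - 1/q) * t powr (real DIM('a) * (1/p - 1/q)))"
  proof -
    have "(1 - p/q) / p = 1/p - 1/q" "real DIM('a) * (1 - p/q) / p = real DIM('a) * (1/p - 1/q)"
      using q_pos by (auto simp: field_simps)
    then show ?thesis
      using q_pos pq by (simp add: epow_mult epow_epow powr_mult powr_powr)
  qed
  also have "ennreal (H * t powr (real DIM('a) * (1 - 1/p + 1/q)) * V x t powr (- 1/q)) *
     (epow ?VE (1/q) * ennreal (bvol TYPE('a) powr (1/p - 1/q) * t powr (real DIM('a) * (1/p - 1/q))))
    = ennreal ((H * t powr (real DIM('a) * (1 - 1/p + 1/q)) * V x t powr (- 1/q)) *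
       (bvol TYPE('a) powr (1/p - 1/q) * t powr (real DIM('a) * (1/p - 1/q)))) * epow ?VE (1/q)"
    using H_pos by (subst ennreal_mult) (auto simp: mult_ac)
  also have "(H * t powr (real DIM('a) * (1 - 1/p + 1/q)) * V x t powr (- 1/q)) *
       (bvol TYPE('a) powr (1/p - 1/q) * t powr (real DIM('a) * (1/p - 1/q)))
    = H * bvol TYPE('a) powr (1/p - 1/q) * (t powr (real DIM('a) * (1 - 1/p + 1/q)) * t powr (real DIM('a) * (1/p - 1/q))) * V x t powr (- 1/q)"
    by simp
  also have "t powr (real DIM('a) * (1 - 1/p + 1/q)) * t powr (real DIM('a) * (1/p - 1/q)) = t powr real DIM('a)"
    by (simp add: powr_add[symmetric] algebra_simps)
  also have "(\<integral>\<^sup>+y. indicator E y * indicator (ball x t) y \<partial>lborel) = emeasure lborel E"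
  proof -
    have "(\<integral>\<^sup>+y. indicator E y * indicator (ball x t) y \<partial>lborel) = (\<integral>\<^sup>+y. indicator E y \<partial>lborel)"
      using sub by (intro nn_integral_cong) (auto simp: indicator_def)
    then show ?thesis by simp
  qed
  finally show ?thesis
    using pq q_pos by (simp add: epow_mono mult_left_mono)
qed

definition C1 :: real where "C1 = (H * bvol TYPE('a) powr (1/p - 1/q) / bvol TYPE('a)) powr q"

lemma C1_pos: "0 < C1"
  using H_pos bvol_pos[where 'a='a] by (simp add: C1_def)

text \<open>Here \<open>e\<close> is a lower bound for the fraction of the volume filled by
  \<open>E\<close>; what results is a lower bound for the fraction of weighted mass.\<close>

lemma measure_ratio_powr:
  assumes E: "E \<in> sets borel" "E \<subseteq> ball x t" "0 < t" "0 \<le> e"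
    and le: "ennreal (e * bvol TYPE('a) * t powr real DIM('a)) \<le> emeasure lborel E"
    and VE: "(\<integral>\<^sup>+y. ennreal (w y powr q) * indicator E y \<partial>lborel) = ennreal v" "0 \<le> v"
  shows "e powr q * V x t \<le> C1 * v"
proof -
  let ?b = "bvol TYPE('a)" and ?n = "real DIM('a)"
  have b: "0 < ?b" by (rule bvol_pos)
  have Vp: "0 < V x t" by (rule V_pos) fact
  have "ennreal (e * ?b * t powr ?n) \<le> ennreal (H * ?b powr (1/p - 1/q) * t powr ?n * V x t powr (- 1/q)) * ennreal (v powr (1/q))"
    using order_trans[OF le measure_ratio[OF E(1,2,3)]] VE by simp
  also have "\<dots> = ennreal (H * ?b powr (1/p - 1/q) * t powr ?n * V x t powr (- 1/q) * v powr (1/q))"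
    using H_pos by (simp add: ennreal_mult[symmetric])
  finally have "e * ?b * t powr ?n \<le> H * ?b powr (1/p - 1/q) * t powr ?n * V x t powr (- 1/q) * v powr (1/q)"
    using H_pos by (subst (asm) ennreal_le_iff) (auto intro!: mult_nonneg_nonneg)
  then have "e * ?b \<le> H * ?b powr (1/p - 1/q) * V x t powr (- 1/q) * v powr (1/q)"
    using E(3) by (simp add: field_simps)
  then have "e * V x t powr (1/q) \<le> (H * ?b powr (1/p - 1/q) / ?b) * v powr (1/q)"
    using b Vp by (simp add: powr_minus field_simps)
  then have "(e * V x t powr (1/q)) powr q \<le> ((H * ?b powr (1/p - 1/q) / ?b) * v powr (1/q)) powr q"
    using E(4) q_pos by (intro powr_mono2) auto
  also have "\<dots> = C1 * v"
    using b H_pos VE(2) q_pos by (subst powr_mult) (auto simp: C1_def powr_powr)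
  also have "(e * V x t powr (1/q)) powr q = e powr q * V x t"
    using E(4) Vp q_pos by (simp add: powr_mult powr_powr)
  finally show ?thesis .
qed

section \<open>Doubling and reverse doubling of the weighted measure\<close>

lemma V_compare:
  assumes "ball x t \<subseteq> ball y r" "0 < t" "0 < r"
  shows "V y r \<le> C1 * (r / t) powr (real DIM('a) * q) * V x t"
proof -
  let ?n = "real DIM('a)"
  have "((t / r) powr ?n) powr q * V y r \<le> C1 * V x t"
  proof (rule measure_ratio_powr[OF _ assms(1,3) _ _ V_eq V_nonneg])
    show "ennreal ((t / r) powr ?n * bvol TYPE('a) * r powr ?n) \<le> emeasure lborel (ball x t)"
      using assms by (simp add: emeasure_ball_powr powr_divide mult.commute)
  qed auto
  then have "(r / t) powr (?n * q) * ((t / r) powr (?n * q) * V y r) \<le> (r / t) powr (?n * q) * (C1 * V x t)"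
    by (intro mult_left_mono) (auto simp: powr_powr)
  moreover have "(r / t) powr (?n * q) * (t / r) powr (?n * q) = 1"
    using assms by (simp add: powr_mult[symmetric])
  ultimately have "1 * V y r \<le> (r / t) powr (?n * q) * (C1 * V x t)"
    by (metis mult.assoc)
  then show ?thesis by (simp add: mult_ac)
qed

text \<open>The shell outside the half ball fills at least half of the volume, as the dimension is
  at least one, so it carries a fixed fraction \<open>\<kappa>\<close> of the mass and the half ball
  keeps at most \<open>1 - \<kappa>\<close>.\<close>

lemma V_half: obtains \<gamma> where "0 < \<gamma>" "\<gamma> < 1" "\<And>x r. 0 < r \<Longrightarrow> V x (r / 2) \<le> \<gamma> * V x r"
proof -
  let ?n = "real DIM('a)"
  define \<kappa> where "\<kappa> = (1 / 2) powr q / C1"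
  have \<kappa>: "0 < \<kappa>" using C1_pos by (simp add: \<kappa>_def)
  have le: "V x (r / 2) \<le> (1 - \<kappa>) * V x r" if r: "0 < r" for x r
  proof -
    define E where "E = ball x r - ball x (r / 2)"
    have [measurable]: "E \<in> sets borel" "ball x (r/2) \<in> sets borel" by (auto simp: E_def)
    have sub: "ball x (r/2) \<subseteq> ball x r" using r by (simp add: subset_ball)
    have "ennreal (V x r) = (\<integral>\<^sup>+y. ennreal (w y powr q) * indicator E y + ennreal (w y powr q) * indicator (ball x (r/2)) y \<partial>lborel)"
      unfolding V_eq[symmetric] using sub
      by (intro nn_integral_cong) (auto simp: E_def indicator_def)
    also have "\<dots> = (\<integral>\<^sup>+y. ennreal (w y powr q) * indicator E y \<partial>lborel) + ennreal (V x (r/2))"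
      unfolding V_eq[symmetric] by (intro nn_integral_add) auto
    finally have eq: "ennreal (V x r) = (\<integral>\<^sup>+y. ennreal (w y powr q) * indicator E y \<partial>lborel) + ennreal (V x (r/2))" .
    then have v: "(\<integral>\<^sup>+y. ennreal (w y powr q) * indicator E y \<partial>lborel) = ennreal (V x r - V x (r/2))"
    proof (cases "\<integral>\<^sup>+y. ennreal (w y powr q) * indicator E y \<partial>lborel")
      case (real a)
      then have "ennreal (V x r) = ennreal (a + V x (r/2))"
        using eq V_nonneg by (simp add: ennreal_plus)
      then have "V x r = a + V x (r/2)"
        using V_nonneg[of x r] V_nonneg[of x "r/2"] real(1) by (subst (asm) ennreal_inj) auto
      then show ?thesis using real by simp
    qed (use eq in auto)
    have "(1/2) powr q * V x r \<le> C1 * (V x r - V x (r/2))"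
    proof (rule measure_ratio_powr[OF _ _ r _ _ v])
      have "emeasure lborel E = emeasure lborel (ball x r) - emeasure lborel (ball x (r/2))"
        unfolding E_def using sub r by (intro emeasure_Diff) (auto simp: emeasure_ball_powr)
      also have "\<dots> = ennreal (bvol TYPE('a) * r powr ?n - bvol TYPE('a) * (r/2) powr ?n)"
        using r bvol_pos[where 'a='a] by (simp add: emeasure_ball_powr ennreal_minus)
      finally have E: "emeasure lborel E = ennreal (bvol TYPE('a) * r powr ?n - bvol TYPE('a) * (r/2) powr ?n)" .
      have "(1/2::real) powr ?n \<le> (1/2) powr 1"
        by (intro powr_mono') (auto simp: DIM_positive Suc_leI)
      then have "(r/2) powr ?n \<le> r powr ?n / 2"
        using r powr_mult[of r "1/2" ?n] mult_left_mono[of "(1/2::real) powr ?n" "1/2" "r powr ?n"] by simp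
      then have "bvol TYPE('a) * (r/2) powr ?n \<le> bvol TYPE('a) * (r powr ?n / 2)"
        using bvol_pos[where 'a='a] by (intro mult_left_mono) auto
      then show "ennreal (1 / 2 * bvol TYPE('a) * r powr ?n) \<le> emeasure lborel E"
        unfolding E by (intro ennreal_leI) simp
      show "0 \<le> V x r - V x (r/2)" using V_mono[OF sub] by simp
    qed (auto simp: E_def)
    then have "\<kappa> * V x r \<le> V x r - V x (r/2)"
      using C1_pos by (simp add: \<kappa>_def field_simps)
    then show ?thesis by (simp add: algebra_simps)
  qed
  \<comment> \<open>\<open>\<kappa> < 1\<close> is read off from one concrete ball, whose half still
    has positive mass.\<close>
  have "0 < (1 - \<kappa>) * V 0 1"
    using le[of 1 0] V_pos[of "1/2" 0] by simp
  then have "0 < 1 - \<kappa>" using V_pos[of 1 0] by (simp add: zero_less_mult_iff)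
  then show ?thesis using le \<kappa> by (intro that[of "1 - \<kappa>"]) auto
qed

text \<open>Iterated halving. The number of steps is the integer part of
  \<open>log 2 (r / t)\<close>, and rounding loses at most one step, which costs the factor
  \<open>1 / \<gamma>\<close>.\<close>

lemma V_growth:
  obtains c d where "0 < c" "0 < d" "\<And>x t r. 0 < t \<Longrightarrow> t \<le> r \<Longrightarrow> V x t \<le> c * (t / r) powr d * V x r"
proof -
  obtain \<gamma> where \<gamma>: "0 < \<gamma>" "\<gamma> < 1" "\<And>x r. 0 < r \<Longrightarrow> V x (r / 2) \<le> \<gamma> * V x r"
    using V_half by blast
  define d where "d = - log 2 \<gamma>"
  have d: "0 < d" using \<gamma> by (simp add: d_def)
  have iter: "V x t \<le> \<gamma> ^ k * V x (2 ^ k * t)" if "0 < t" for x t and k :: nat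
  proof (induction k)
    case (Suc k)
    have "V x (2 ^ k * t) \<le> \<gamma> * V x (2 ^ Suc k * t)"
      using \<gamma>(3)[of "2 ^ Suc k * t" x] that by simp
    then have "\<gamma> ^ k * V x (2 ^ k * t) \<le> \<gamma> ^ k * (\<gamma> * V x (2 ^ Suc k * t))"
      using \<gamma> by (intro mult_left_mono) auto
    with Suc show ?case by (simp add: mult_ac)
  qed simp
  have "V x t \<le> (1 / \<gamma>) * (t / r) powr d * V x r" if t: "0 < t" "t \<le> r" for x t r
  proof -
    define k where "k = nat \<lfloor>log 2 (r / t)\<rfloor>"
    have l0: "0 \<le> log 2 (r / t)" using t by (simp add: zero_le_log_cancel_iff)
    have k: "real k \<le> log 2 (r / t)" "log 2 (r / t) < real k + 1"
      using l0 by (auto simp: k_def)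
    have "(2::real) powr real k \<le> 2 powr log 2 (r / t)" using k by (intro powr_mono) auto
    then have "2 ^ k \<le> r / t" using t by (simp add: powr_realpow)
    then have le: "2 ^ k * t \<le> r" using t by (simp add: field_simps)
    have "V x t \<le> \<gamma> ^ k * V x (2 ^ k * t)" by (rule iter) fact
    also have "\<dots> \<le> \<gamma> ^ k * V x r"
      using le \<gamma> by (intro mult_left_mono V_mono subset_ball) auto
    also have "\<dots> \<le> ((1 / \<gamma>) * (t / r) powr d) * V x r"
    proof (rule mult_right_mono[OF _ V_nonneg])
      have "\<gamma> ^ k = \<gamma> powr real k" using \<gamma> by (simp add: powr_realpow)
      also have "\<dots> \<le> \<gamma> powr (log 2 (r / t) - 1)"
        using \<gamma> k by (intro powr_mono') auto
      also have "\<dots> = (1 / \<gamma>) * \<gamma> powr (log 2 (r / t))"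
        using \<gamma> by (simp add: powr_diff)
      also have "\<gamma> powr (log 2 (r / t)) = (t / r) powr d"
        using \<gamma> t by (simp add: powr_def d_def log_def ln_div field_simps)
      finally show "\<gamma> ^ k \<le> 1 / \<gamma> * (t / r) powr d" .
    qed
    finally show ?thesis .
  qed
  with \<gamma> d show ?thesis by (intro that[of "1 / \<gamma>" d]) auto
qed

end

text \<open>Pointwise, one is the product of powers of \<open>w powr q\<close>, of the dual weight
  and of the constant one, with exponents \<open>1/q\<close>, \<open>(p - 1)/p\<close> and
  \<open>1/p - 1/q\<close>; Holder does the rest. The inequality says that the normalised weight
  constant is at least one, and it also bounds the dual measure from below.\<close>

lemma Holder_weight_lower:
  fixes w :: "'a::euclidean_space \<Rightarrow> real"
  assumes p: "1 < p" "p < q" and t: "0 < t"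
    and [measurable]: "w \<in> borel_measurable borel" and w0: "\<And>y. 0 \<le> w y" and wpos: "AE y in lborel. 0 < w y"
    and i1: "set_integrable lborel (ball x t) (\<lambda>y. w y powr q)"
    and i2: "set_integrable lborel (ball x t) (\<lambda>y. w y powr (- (p / (p - 1))))"
  shows "(bvol TYPE('a) * t powr real DIM('a)) powr ((p - 1) / p + 1/q)
     \<le> wball (\<lambda>y. w y powr q) x t powr (1/q) * wball (\<lambda>y. w y powr (- (p / (p - 1)))) x t powr ((p - 1) / p)"
proof -
  let ?b = "bvol TYPE('a) * t powr real DIM('a)"
  have b: "0 < ?b" using bvol_pos[where 'a='a] t by simp
  define th where "th i = (if i = (0::nat) then 1/q else if i = 1 then (p - 1) / p else 1/p - 1/q)" for i
  define F where "F i y = (if i = (0::nat) then ennreal (w y powr q) * indicator (ball x t) y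
     else if i = 1 then ennreal (w y powr (- (p / (p - 1)))) * indicator (ball x t) y
     else indicator (ball x t) y)" for i y
  have th: "0 < th i" for i using p by (auto simp: th_def field_simps)
  have sum: "(\<Sum>i<3. th i) = 1" using p by (simp add: th_def eval_nat_numeral field_simps)
  have "(\<integral>\<^sup>+y. (\<Prod>i<3. epow (F i y) (th i)) \<partial>lborel) \<le> (\<Prod>i<3. epow (\<integral>\<^sup>+y. F i y \<partial>lborel) (th i))"
    by (rule Holder_nn_integral) (auto simp: th sum, auto simp: F_def)
  also have "(\<Prod>i<3. epow (\<integral>\<^sup>+y. F i y \<partial>lborel) (th i))
     = ennreal (wball (\<lambda>y. w y powr q) x t powr (1/q)) * (ennreal (wball (\<lambda>y. w y powr (- (p / (p - 1)))) x t powr ((p - 1) / p))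
        * ennreal (?b powr (1/p - 1/q)))"
  proof -
    have "(\<integral>\<^sup>+y. F 0 y \<partial>lborel) = ennreal (wball (\<lambda>y. w y powr q) x t)"
      unfolding F_def using i1 by (simp add: nn_integral_ball_eq_wball)
    moreover have "(\<integral>\<^sup>+y. F 1 y \<partial>lborel) = ennreal (wball (\<lambda>y. w y powr (- (p / (p - 1)))) x t)"
      unfolding F_def using i2 by (simp add: nn_integral_ball_eq_wball)
    moreover have "(\<integral>\<^sup>+y. F 2 y \<partial>lborel) = ennreal ?b"
      unfolding F_def using t by (simp add: emeasure_ball_powr)
    ultimately show ?thesis
      using b by (simp add: eval_nat_numeral th_def wball_nonneg mult.assoc)
  qed
  also have "(\<integral>\<^sup>+y. (\<Prod>i<3. epow (F i y) (th i)) \<partial>lborel) = (\<integral>\<^sup>+y. indicator (ball x t) y \<partial>lborel)"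
  proof (rule nn_integral_cong_AE)
    show "AE y in lborel. (\<Prod>i<3. epow (F i y) (th i)) = indicator (ball x t) y"
      using wpos
    proof eventually_elim
      case (elim y)
      have "(w y powr q) powr (1/q) * ((w y powr (- (p / (p - 1)))) powr ((p - 1) / p)) = 1"
      proof -
        have "q * (1/q) = 1" "- (p / (p - 1)) * ((p - 1) / p) = - 1" using p by auto
        then show ?thesis using elim by (simp only: powr_powr) (simp add: powr_minus)
      qed
      then have "ennreal ((w y powr q) powr (1/q)) * ennreal ((w y powr (- (p / (p - 1)))) powr ((p - 1) / p)) = 1"
        by (simp add: ennreal_mult[symmetric])
      then show ?case
        by (cases "y \<in> ball x t") (auto simp: eval_nat_numeral F_def th_def simp flip: mult.assoc)
    qed
  qed
  also have "\<dots> = ennreal ?b" using t by (simp add: emeasure_ball_powr)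
  finally have "ennreal ?b \<le> ennreal (wball (\<lambda>y. w y powr q) x t powr (1/q) * (wball (\<lambda>y. w y powr (- (p / (p - 1)))) x t powr ((p - 1) / p)
        * ?b powr (1/p - 1/q)))"
    by (simp add: ennreal_mult[symmetric])
  then have "?b \<le> (wball (\<lambda>y. w y powr q) x t powr (1/q) * wball (\<lambda>y. w y powr (- (p / (p - 1)))) x t powr ((p - 1) / p))
        * ?b powr (1/p - 1/q)"
    by (subst (asm) ennreal_le_iff) (auto simp: mult_ac)
  moreover have "?b = ?b powr ((p - 1) / p + 1/q) * ?b powr (1/p - 1/q)"
  proof -
    have "(p - 1) / p + 1/q + (1/p - 1/q) = 1" using p by (simp add: field_simps)
    then show ?thesis using b by (simp only: powr_add[symmetric]) simp
  qed
  ultimately have "?b powr ((p - 1) / p + 1/q) * ?b powr (1/p - 1/q) \<le> (wball (\<lambda>y. w y powr q) x t powr (1/q) * wball (\<lambda>y. w y powr (- (p / (p - 1)))) x t powr ((p - 1) / p))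
        * ?b powr (1/p - 1/q)"
    by simp
  then show ?thesis
    by (rule mult_right_le_imp_le) (use bvol_pos[where 'a='a] t in simp)
qed

section \<open>The dual weight for an exponent above one, and the maximal majorant\<close>

locale apq_weight_strong = apq_weight +
  fixes H2 :: real
  assumes p_gt: "1 < p" and H2_pos: "0 < H2"
    and sig_int: "set_integrable lborel (ball x r) (\<lambda>y. w y powr (- (p / (p - 1))))"
    and sig_bound: "0 < t \<Longrightarrow> wball (\<lambda>y. w y powr (- (p / (p - 1)))) x t
      \<le> H2 * t powr (real DIM('a) * (1 + p / (p - 1) / q)) * V x t powr (- (p / (p - 1) / q))"
begin

text \<open>The conjugate exponent of \<open>p\<close>, so that \<open>w powr (- pc)\<close> is the
  dual weight.\<close>

definition pc :: real where "pc = p / (p - 1)"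

lemma pc_pos: "0 < pc" and pc_eq: "pc * (p - 1) = p" "pc * p - pc = p" "pc * (1 - 1/p) = 1"
proof -
  show "0 < pc" using p_gt by (simp add: pc_def)
  show 1: "pc * (p - 1) = p" using p_gt by (simp add: pc_def)
  then show "pc * p - pc = p" by (simp add: algebra_simps)
  have "pc * (1 - 1/p) = (pc * (p - 1)) / p" using p_gt by (simp add: field_simps)
  then show "pc * (1 - 1/p) = 1" using p_gt unfolding 1 by simp
qed

definition Sg :: "'a \<Rightarrow> real \<Rightarrow> real" where "Sg x t = wball (\<lambda>y. w y powr (- pc)) x t"

lemma Sg_eq: "(\<integral>\<^sup>+y. ennreal (w y powr (- pc)) * indicator (ball x t) y \<partial>lborel) = ennreal (Sg x t)"
  unfolding Sg_def by (intro nn_integral_ball_eq_wball) (use sig_int in \<open>auto simp: pc_def\<close>)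

lemma Sg_nonneg: "0 \<le> Sg x t"
  unfolding Sg_def by (intro wball_nonneg) auto

lemma Sg_pos: "0 < t \<Longrightarrow> 0 < Sg x t"
  unfolding Sg_def using w_pos sig_int by (intro wball_pos) (auto elim!: eventually_mono simp: pc_def)

lemma Sg_upper: "0 < t \<Longrightarrow> Sg x t \<le> H2 * t powr (real DIM('a) * (1 + pc / q)) * V x t powr (- (pc / q))"
  using sig_bound unfolding Sg_def pc_def by simp

text \<open>Together with \<open>Sg_upper\<close> this makes the dual measure of a ball comparable
  to an explicit expression in the radius and \<open>V\<close>, from which it inherits
  doubling.\<close>

lemma Sg_lower:
  assumes t: "0 < t"
  shows "bvol TYPE('a) powr (1 + pc / q) * t powr (real DIM('a) * (1 + pc / q)) * V x t powr (- (pc / q)) \<le> Sg x t"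
proof -
  let ?b = "bvol TYPE('a) * t powr real DIM('a)"
  have e: "(p - 1) / p * pc = 1" "(p - 1) / p = 1 / pc" using p_gt by (auto simp: pc_def)
  have "?b powr ((p - 1) / p + 1/q) \<le> V x t powr (1/q) * Sg x t powr ((p - 1) / p)"
    using Holder_weight_lower[OF p_gt p_less t w_meas w_nonneg w_pos w_int sig_int]
    unfolding V_def Sg_def pc_def by simp
  then have "(?b powr ((p - 1) / p + 1/q)) powr pc \<le> (V x t powr (1/q) * Sg x t powr ((p - 1) / p)) powr pc"
    using pc_pos by (intro powr_mono2) auto
  also have "\<dots> = V x t powr (pc / q) * Sg x t"
    using e V_nonneg Sg_nonneg by (simp add: powr_mult powr_powr)
  also have "(?b powr ((p - 1) / p + 1/q)) powr pc = ?b powr (1 + pc / q)"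
    using e by (simp add: powr_powr algebra_simps)
  also have "\<dots> = bvol TYPE('a) powr (1 + pc / q) * t powr (real DIM('a) * (1 + pc / q))"
    using bvol_pos[where 'a='a] by (simp add: powr_mult powr_powr)
  finally show ?thesis
    using V_pos[OF t, of x] by (simp add: powr_minus field_simps)
qed

definition mV :: "'a measure" where "mV = density lborel (\<lambda>y. ennreal (w y powr q))"
definition mS :: "'a measure" where "mS = density lborel (\<lambda>y. ennreal (w y powr (- pc)))"
definition DV :: real where "DV = C1 * 5 powr (real DIM('a) * q)"
definition DS :: real where "DS = H2 * 5 powr (real DIM('a) * (1 + pc / q)) / bvol TYPE('a) powr (1 + pc / q)"

lemma emeasure_mV_ball: "emeasure mV (ball x t) = ennreal (V x t)"
  unfolding mV_def by (subst emeasure_density) (auto simp: V_eq)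

lemma emeasure_mS_ball: "emeasure mS (ball x t) = ennreal (Sg x t)"
  unfolding mS_def by (subst emeasure_density) (auto simp: Sg_eq)

lemma nn_integral_mV: "f \<in> borel_measurable borel \<Longrightarrow> (\<integral>\<^sup>+x. f x \<partial>mV) = (\<integral>\<^sup>+x. ennreal (w x powr q) * f x \<partial>lborel)"
  unfolding mV_def by (subst nn_integral_density) auto

lemma nn_integral_mS: "f \<in> borel_measurable borel \<Longrightarrow> (\<integral>\<^sup>+x. f x \<partial>mS) = (\<integral>\<^sup>+x. ennreal (w x powr (- pc)) * f x \<partial>lborel)"
  unfolding mS_def by (subst nn_integral_density) auto

lemma DV_pos: "0 < DV" using C1_pos by (simp add: DV_def)
lemma DS_pos: "0 < DS" using H2_pos bvol_pos[where 'a='a] by (simp add: DS_def)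

sublocale mV: doubling_measure mV DV
proof
  show "sets mV = sets borel" by (simp add: mV_def)
  show "0 < emeasure mV (ball x r)" if "0 < r" for x r
    using V_pos[OF that] by (simp add: emeasure_mV_ball)
  show "emeasure mV (ball x r) < top" for x r by (simp add: emeasure_mV_ball)
  show "emeasure mV (ball x (5 * r)) \<le> ennreal DV * emeasure mV (ball x r)" if "0 < r" for x r
    using V_compare[of x r x "5 * r"] that V_nonneg DV_pos
    by (simp add: emeasure_mV_ball DV_def ennreal_mult[symmetric] subset_ball)
qed

sublocale mS: doubling_measure mS DS
proof
  show "sets mS = sets borel" by (simp add: mS_def)
  show "0 < emeasure mS (ball x r)" if "0 < r" for x r
    using Sg_pos[OF that] by (simp add: emeasure_mS_ball)
  show "emeasure mS (ball x r) < top" for x r by (simp add: emeasure_mS_ball)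
  show "emeasure mS (ball x (5 * r)) \<le> ennreal DS * emeasure mS (ball x r)" if r: "0 < r" for x r
  proof -
    let ?e = "real DIM('a) * (1 + pc / q)" and ?b = "bvol TYPE('a) powr (1 + pc / q)"
    have b: "0 < ?b" using bvol_pos[where 'a='a] by simp
    have "Sg x (5 * r) \<le> H2 * (5 * r) powr ?e * V x (5 * r) powr (- (pc / q))"
      using Sg_upper[of "5 * r" x] r by simp
    \<comment> \<open>\<open>V\<close> enters with a negative exponent, so passing from the large
      ball to the small one only increases the bound; the dilation constant comes from the power of
      the radius.\<close>
    also have "\<dots> \<le> H2 * (5 * r) powr ?e * V x r powr (- (pc / q))"
      using r H2_pos V_pos[OF r, of x] V_mono[of x r x "5 * r"] pc_pos q_pos
      by (intro mult_left_mono powr_mono2') (auto simp: subset_ball)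
    also have "\<dots> = DS * (?b * r powr ?e * V x r powr (- (pc / q)))"
      using r b by (simp add: DS_def powr_mult)
    also have "\<dots> \<le> DS * Sg x r"
      using DS_pos Sg_lower[OF r, of x] by (intro mult_left_mono) auto
    finally show ?thesis
      using DS_pos Sg_nonneg by (simp add: emeasure_mS_ball ennreal_mult[symmetric])
  qed
qed

text \<open>\<open>\<rho>\<close> is fixed by requiring that
  \<open>w powr q * w powr (- q * (p / \<rho>))\<close> be the dual weight, which lets the two
  maximal operators be chained. The exponent \<open>p / \<rho>\<close> must exceed one for the
  strong type bound, and the last two identities match the powers of the radius and of
  \<open>V\<close>.\<close>

lemma exponents:
  defines "\<rho> \<equiv> p / (1 + pc / q)"
  shows "0 < \<rho>" "p / \<rho> = 1 + pc / q" "1 < p / \<rho>"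
    "real DIM('a) * (1 + pc / q) - real DIM('a) / \<rho> = real DIM('a) * (1 - 1/p + 1/q)"
    "1 / \<rho> - pc / q = 1/p - 1/q"
proof -
  have pq: "0 < 1 + pc / q" using pc_pos q_pos by (simp add: add_pos_pos)
  show r: "0 < \<rho>" using pq q_pos by (simp add: \<rho>_def)
  show pr: "p / \<rho> = 1 + pc / q" using pq q_pos by (simp add: \<rho>_def)
  then show "1 < p / \<rho>" using pc_pos q_pos by simp
  have ir: "1 / \<rho> = (1 + pc / q) / p" by (simp add: \<rho>_def)
  have pcp: "pc / p = pc - 1" using pc_eq(3) p_gt by (simp add: field_simps)
  have ir2: "1 / \<rho> = 1/p + (pc - 1) / q"
  proof -
    have "(1 + pc / q) / p = 1/p + (pc / p) / q" by (simp add: add_divide_distrib mult.commute)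
    then show ?thesis unfolding ir pcp .
  qed
  show "1 / \<rho> - pc / q = 1/p - 1/q"
    unfolding ir2 by (simp add: diff_divide_distrib)
  have "real DIM('a) * (1 + pc / q) - real DIM('a) / \<rho> = real DIM('a) * (1 + pc / q - 1 / \<rho>)"
    by (simp add: right_diff_distrib)
  then show "real DIM('a) * (1 + pc / q) - real DIM('a) / \<rho> = real DIM('a) * (1 - 1/p + 1/q)"
    unfolding ir2 by (simp add: diff_divide_distrib)
qed

text \<open>The majorant is \<open>(M\<^sub>V (w powr (-q) * (M\<^sub>S (F / \<sigma>)) powr \<rho>)) powr (1/\<rho>)\<close> with \<open>\<sigma> = w powr (- pc)\<close>. Using two
  maximal operators, each bounded on its own doubling measure, avoids the openness of the weight class.\<close>

lemma maximal_majorant: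
  obtains K :: real where "0 < K"
    and "\<And>F. F \<in> borel_measurable borel \<Longrightarrow> \<exists>N. N \<in> borel_measurable borel \<and>
      (\<integral>\<^sup>+x. epow (N x) p * ennreal (w x powr q) \<partial>lborel)
         \<le> ennreal K * (\<integral>\<^sup>+x. epow (F x) p * ennreal (w x powr p) \<partial>lborel) \<and>
      (\<forall>x t. 0 < t \<longrightarrow> (\<integral>\<^sup>+y. F y * indicator (ball x t) y \<partial>lborel)
         \<le> ennreal (K * t powr (real DIM('a) * (1 - 1/p + 1/q)) * V x t powr (1/p - 1/q)) * N x)"
proof -
  define \<rho> where "\<rho> = p / (1 + pc / q)"
  note ex = exponents[folded \<rho>_def]
  obtain K1 where K1: "0 < K1" "\<And>h. h \<in> borel_measurable borel \<Longrightarrow>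
    (\<integral>\<^sup>+x. epow (mV.maxf h x) (p / \<rho>) \<partial>mV) \<le> ennreal K1 * (\<integral>\<^sup>+x. epow (h x) (p / \<rho>) \<partial>mV)"
    using mV.maxf_strong_type[OF ex(3)] by blast
  obtain K2 where K2: "0 < K2" "\<And>h. h \<in> borel_measurable borel \<Longrightarrow>
    (\<integral>\<^sup>+x. epow (mS.maxf h x) p \<partial>mS) \<le> ennreal K2 * (\<integral>\<^sup>+x. epow (h x) p \<partial>mS)"
    using mS.maxf_strong_type[OF p_gt] by blast
  \<comment> \<open>The pointwise constants: one doubling constant per maximal function, the upper
    bound for the dual measure, and the volume from averaging over the ball.\<close>
  define K3 where "K3 = DS * H2 * (DV / bvol TYPE('a)) powr (1 / \<rho>)"
  define K where "K = max (K1 * K2) K3"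
  have K3: "0 < K3" using DS_pos H2_pos DV_pos bvol_pos[where 'a='a] by (simp add: K3_def)
  have K: "0 < K" using K3 by (simp add: K_def)
  have "\<exists>N. N \<in> borel_measurable borel \<and>
      (\<integral>\<^sup>+x. epow (N x) p * ennreal (w x powr q) \<partial>lborel)
         \<le> ennreal K * (\<integral>\<^sup>+x. epow (F x) p * ennreal (w x powr p) \<partial>lborel) \<and>
      (\<forall>x t. 0 < t \<longrightarrow> (\<integral>\<^sup>+y. F y * indicator (ball x t) y \<partial>lborel)
         \<le> ennreal (K * t powr (real DIM('a) * (1 - 1/p + 1/q)) * V x t powr (1/p - 1/q)) * N x)"
    if [measurable]: "F \<in> borel_measurable borel" for F
  proof -
    \<comment> \<open>\<open>h\<close> is \<open>F\<close> divided by the dual weight, so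
      integrating \<open>h\<close> in the dual measure gives back integrals of \<open>F\<close>;
      \<open>k\<close> is \<open>g\<close> divided by \<open>w powr q\<close> for the same reason
      with respect to \<open>V\<close>.\<close>
    define h where "h y = F y * ennreal (w y powr pc)" for y
    define g where "g y = epow (mS.maxf h y) \<rho>" for y
    define k where "k y = g y * ennreal (w y powr (- q))" for y
    define N where "N x = epow (mV.maxf k x) (1 / \<rho>)" for x
    have [measurable]: "h \<in> borel_measurable borel" unfolding h_def by measurable
    have [measurable]: "g \<in> borel_measurable borel" unfolding g_def by measurable
    have [measurable]: "k \<in> borel_measurable borel" unfolding k_def by measurable
    have N [measurable]: "N \<in> borel_measurable borel" unfolding N_def by measurable
    have inv: "ennreal (a powr e) * ennreal (a powr (- e)) = 1" if "0 < a" for a e :: real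
      using that by (simp add: ennreal_mult[symmetric] powr_add[symmetric])
    have "(\<integral>\<^sup>+x. epow (N x) p * ennreal (w x powr q) \<partial>lborel) = (\<integral>\<^sup>+x. epow (mV.maxf k x) (p / \<rho>) \<partial>mV)"
      using ex(1) by (subst nn_integral_mV) (auto simp: N_def epow_epow mult.commute)
    also have "\<dots> \<le> ennreal K1 * (\<integral>\<^sup>+x. epow (k x) (p / \<rho>) \<partial>mV)"
      by (rule K1) measurable
    also have "(\<integral>\<^sup>+x. epow (k x) (p / \<rho>) \<partial>mV) = (\<integral>\<^sup>+x. ennreal (w x powr q) * epow (k x) (p / \<rho>) \<partial>lborel)"
      by (subst nn_integral_mV) auto
    also have "\<dots> = (\<integral>\<^sup>+x. ennreal (w x powr (- pc)) * epow (mS.maxf h x) p \<partial>lborel)"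
    proof (rule nn_integral_cong_AE)
      show "AE x in lborel. ennreal (w x powr q) * epow (k x) (p / \<rho>) = ennreal (w x powr (- pc)) * epow (mS.maxf h x) p"
        using w_pos
      proof eventually_elim
        case (elim x)
        have "epow (k x) (p / \<rho>) = epow (mS.maxf h x) p * ennreal (w x powr (- q * (p / \<rho>)))"
          using ex(1) q_pos by (simp add: k_def g_def epow_mult epow_epow powr_powr)
        moreover have "w x powr q * w x powr (- q * (p / \<rho>)) = w x powr (- pc)"
        proof -
          have "q + - q * (p / \<rho>) = - pc" unfolding ex(2) using q_pos by (simp add: field_simps)
          then show ?thesis by (simp only: powr_add[symmetric])
        qed
        ultimately show ?case
          by (simp add: ennreal_mult[symmetric] mult.commute[of "epow _ _"] mult.assoc[symmetric])
      qed
    qed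
    also have "\<dots> = (\<integral>\<^sup>+x. epow (mS.maxf h x) p \<partial>mS)"
      by (subst nn_integral_mS) auto
    also have "\<dots> \<le> ennreal K2 * (\<integral>\<^sup>+x. epow (h x) p \<partial>mS)"
      by (rule K2) measurable
    also have "(\<integral>\<^sup>+x. epow (h x) p \<partial>mS) = (\<integral>\<^sup>+x. ennreal (w x powr (- pc)) * epow (h x) p \<partial>lborel)"
      by (subst nn_integral_mS) auto
    also have "\<dots> = (\<integral>\<^sup>+x. epow (F x) p * ennreal (w x powr p) \<partial>lborel)"
    proof (rule nn_integral_cong)
      fix x
      have "w x powr (- pc) * w x powr (pc * p) = w x powr p"
        using pc_eq(2) by (simp add: powr_add[symmetric])
      then show "ennreal (w x powr (- pc)) * epow (h x) p = epow (F x) p * ennreal (w x powr p)"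
        using q_pos by (simp add: h_def epow_mult powr_powr ennreal_mult[symmetric] mult.left_commute[of "ennreal _"])
    qed
    also have "ennreal K1 * (ennreal K2 * (\<integral>\<^sup>+x. epow (F x) p * ennreal (w x powr p) \<partial>lborel))
       = ennreal (K1 * K2) * (\<integral>\<^sup>+x. epow (F x) p * ennreal (w x powr p) \<partial>lborel)"
      using K1 K2 by (simp add: ennreal_mult mult.assoc)
    also have "\<dots> \<le> ennreal K * (\<integral>\<^sup>+x. epow (F x) p * ennreal (w x powr p) \<partial>lborel)"
      by (intro mult_right_mono ennreal_leI) (auto simp: K_def)
    finally have 1: "(\<integral>\<^sup>+x. epow (N x) p * ennreal (w x powr q) \<partial>lborel)
         \<le> ennreal K * (\<integral>\<^sup>+x. epow (F x) p * ennreal (w x powr p) \<partial>lborel)"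
      by (simp add: mult_left_mono)
    have 2: "(\<integral>\<^sup>+y. F y * indicator (ball x t) y \<partial>lborel)
         \<le> ennreal (K * t powr (real DIM('a) * (1 - 1/p + 1/q)) * V x t powr (1/p - 1/q)) * N x"
      if t: "0 < t" for x t
    proof -
      define I where "I = (\<integral>\<^sup>+y. F y * indicator (ball x t) y \<partial>lborel)"
      let ?b = "bvol TYPE('a) * t powr real DIM('a)"
      have b: "0 < ?b" using bvol_pos[where 'a='a] t by simp
      have Vt: "0 < V x t" and St: "0 < Sg x t" using V_pos Sg_pos t by auto
      have I: "I = (\<integral>\<^sup>+y. h y * indicator (ball x t) y \<partial>mS)"
      proof -
        have "(\<integral>\<^sup>+y. h y * indicator (ball x t) y \<partial>mS) = (\<integral>\<^sup>+y. ennreal (w y powr (- pc)) * (h y * indicator (ball x t) y) \<partial>lborel)"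
          by (subst nn_integral_mS) auto
        also have "\<dots> = I"
          unfolding I_def
        proof (rule nn_integral_cong_AE)
          show "AE y in lborel. ennreal (w y powr (- pc)) * (h y * indicator (ball x t) y) = F y * indicator (ball x t) y"
            using w_pos
          proof eventually_elim
            case (elim y)
            have "ennreal (w y powr (- pc)) * (h y * indicator (ball x t) y)
              = (ennreal (w y powr pc) * ennreal (w y powr (- pc))) * (F y * indicator (ball x t) y)"
              by (simp add: h_def mult_ac)
            then show ?case using inv[OF elim] by simp
          qed
        qed
        finally show ?thesis by simp
      qed
      have gk: "(\<integral>\<^sup>+y. g y * indicator (ball x t) y \<partial>lborel) = (\<integral>\<^sup>+y. k y * indicator (ball x t) y \<partial>mV)"
      proof -
        have "(\<integral>\<^sup>+y. k y * indicator (ball x t) y \<partial>mV) = (\<integral>\<^sup>+y. ennreal (w y powr q) * (k y * indicator (ball x t) y) \<partial>lborel)"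
          by (subst nn_integral_mV) auto
        also have "\<dots> = (\<integral>\<^sup>+y. g y * indicator (ball x t) y \<partial>lborel)"
        proof (rule nn_integral_cong_AE)
          show "AE y in lborel. ennreal (w y powr q) * (k y * indicator (ball x t) y) = g y * indicator (ball x t) y"
            using w_pos
          proof eventually_elim
            case (elim y)
            have "ennreal (w y powr q) * (k y * indicator (ball x t) y)
              = (ennreal (w y powr q) * ennreal (w y powr (- q))) * (g y * indicator (ball x t) y)"
              by (simp add: k_def mult_ac)
            then show ?case using inv[OF elim] by simp
          qed
        qed
        finally show ?thesis by simp
      qed
      \<comment> \<open>The bound of \<open>I\<close> by the first maximal function holds at every
        point \<open>y\<close> of the ball, so its power may be averaged over \<open>y\<close>; the
        integral of \<open>g\<close> is then controlled by the second maximal function at the centre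
        \<open>x\<close>.\<close>
      have "epow I \<rho> * ennreal ?b = (\<integral>\<^sup>+y. epow I \<rho> * indicator (ball x t) y \<partial>lborel)"
        using t by (simp add: nn_integral_cmult_indicator emeasure_ball_powr)
      also have "\<dots> \<le> (\<integral>\<^sup>+y. ennreal ((DS * Sg x t) powr \<rho>) * (g y * indicator (ball x t) y) \<partial>lborel)"
      proof (rule nn_integral_mono)
        fix y
        show "epow I \<rho> * indicator (ball x t) y \<le> ennreal ((DS * Sg x t) powr \<rho>) * (g y * indicator (ball x t) y)"
        proof (cases "y \<in> ball x t")
          case True
          then have "I \<le> ennreal DS * emeasure mS (ball x t) * mS.maxf h y"
            unfolding I by (intro mS.ball_integral_le_maxf t) auto
          also have "\<dots> = ennreal (DS * Sg x t) * mS.maxf h y"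
            using DS_pos Sg_nonneg by (simp add: emeasure_mS_ball ennreal_mult)
          finally have "epow I \<rho> \<le> epow (ennreal (DS * Sg x t) * mS.maxf h y) \<rho>"
            using ex(1) by (intro epow_mono) auto
          then show ?thesis using True ex(1) DS_pos Sg_nonneg[of x t]
            by (simp add: epow_mult g_def)
        qed auto
      qed
      also have "\<dots> = ennreal ((DS * Sg x t) powr \<rho>) * (\<integral>\<^sup>+y. k y * indicator (ball x t) y \<partial>mV)"
        unfolding gk[symmetric] by (rule nn_integral_cmult) auto
      also have "(\<integral>\<^sup>+y. k y * indicator (ball x t) y \<partial>mV) \<le> ennreal DV * emeasure mV (ball x t) * mV.maxf k x"
        using t by (intro mV.ball_integral_le_maxf) auto
      also have "ennreal DV * emeasure mV (ball x t) * mV.maxf k x = ennreal (DV * V x t) * mV.maxf k x"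
        using DV_pos V_nonneg by (simp add: emeasure_mV_ball ennreal_mult)
      finally have "epow I \<rho> * ennreal ?b \<le> ennreal ((DS * Sg x t) powr \<rho>) * (ennreal (DV * V x t) * mV.maxf k x)"
        by (simp add: mult_left_mono)
      then have "epow (epow I \<rho> * ennreal ?b) (1/\<rho>) \<le> epow (ennreal ((DS * Sg x t) powr \<rho>) * (ennreal (DV * V x t) * mV.maxf k x)) (1/\<rho>)"
        using ex(1) by (intro epow_mono) auto
      then have le: "I * ennreal (?b powr (1/\<rho>)) \<le> ennreal (DS * Sg x t) * (ennreal ((DV * V x t) powr (1/\<rho>)) * N x)"
        using ex(1) b DS_pos DV_pos Sg_nonneg[of x t] V_nonneg[of x t]
        by (simp add: epow_mult epow_epow powr_powr N_def)
      have "I = I * ennreal (?b powr (1/\<rho>)) * ennreal (?b powr (- (1/\<rho>)))"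
        using inv[OF b, of "1/\<rho>"] by (simp add: mult.assoc)
      also have "\<dots> \<le> ennreal (DS * Sg x t) * (ennreal ((DV * V x t) powr (1/\<rho>)) * N x) * ennreal (?b powr (- (1/\<rho>)))"
        by (intro mult_right_mono le) auto
      also have "\<dots> = ennreal (DS * Sg x t * (DV * V x t) powr (1/\<rho>) * ?b powr (- (1/\<rho>))) * N x"
        using DS_pos Sg_nonneg[of x t] by (simp add: ennreal_mult mult_ac)
      also have "\<dots> \<le> ennreal (K * t powr (real DIM('a) * (1 - 1/p + 1/q)) * V x t powr (1/p - 1/q)) * N x"
      proof (intro mult_right_mono ennreal_leI)
        have "DS * Sg x t * (DV * V x t) powr (1/\<rho>) * ?b powr (- (1/\<rho>))
          \<le> DS * (H2 * t powr (real DIM('a) * (1 + pc / q)) * V x t powr (- (pc / q))) * (DV * V x t) powr (1/\<rho>) * ?b powr (- (1/\<rho>))"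
          using DS_pos by (intro mult_right_mono mult_left_mono Sg_upper t) auto
        also have "\<dots> = K3 * (t powr (real DIM('a) * (1 + pc / q)) * t powr (- (real DIM('a) / \<rho>))) * (V x t powr (1/\<rho>) * V x t powr (- (pc / q)))"
          using DV_pos V_nonneg[of x t] bvol_pos[where 'a='a]
          by (simp add: K3_def powr_mult powr_divide powr_powr powr_minus field_simps)
        also have "V x t powr (1/\<rho>) * V x t powr (- (pc / q)) = V x t powr (1/p - 1/q)"
          using ex(5) by (simp add: powr_add[symmetric])
        also have "t powr (real DIM('a) * (1 + pc / q)) * t powr (- (real DIM('a) / \<rho>)) = t powr (real DIM('a) * (1 - 1/p + 1/q))"
          using ex(4) by (simp add: powr_add[symmetric])
        also have "K3 * t powr (real DIM('a) * (1 - 1/p + 1/q)) * V x t powr (1/p - 1/q) \<le> K * t powr (real DIM('a) * (1 - 1/p + 1/q)) * V x t powr (1/p - 1/q)"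
          by (intro mult_right_mono) (auto simp: K_def)
        finally show "DS * Sg x t * (DV * V x t) powr (1/\<rho>) * ?b powr (- (1/\<rho>)) \<le> K * t powr (real DIM('a) * (1 - 1/p + 1/q)) * V x t powr (1/p - 1/q)" .
      qed auto
      finally show ?thesis unfolding I_def .
    qed
    show ?thesis using N 1 2 by blast
  qed
  with K show ?thesis by (rule that)
qed

end

section \<open>Products of weights\<close>

text \<open>Lebesgue measure as an instance supplies measurability of ball integrals and the bound
  for their sums over disjoint balls.\<close>

global_interpretation lborel_doubling: doubling_measure "lborel :: 'a::euclidean_space measure" "5 powr real DIM('a)"
proof
  fix x :: 'a and r :: real
  show "0 < emeasure lborel (ball x r)" if "0 < r"
    using that bvol_pos[where 'a='a] by (simp add: emeasure_ball_powr)
  show "emeasure lborel (ball x r) < top" using emeasure_lborel_ball_finite by simp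
  show "emeasure lborel (ball x (5 * r)) \<le> ennreal (5 powr real DIM('a)) * emeasure lborel (ball x r)" if "0 < r"
    using that bvol_pos[where 'a='a] by (simp add: emeasure_ball_powr powr_mult ennreal_mult[symmetric])
qed simp

lemma measurable_mpot [measurable]:
  fixes f :: "nat \<Rightarrow> 'a::euclidean_space \<Rightarrow> real"
  assumes [measurable]: "\<And>i. i < m \<Longrightarrow> f i \<in> borel_measurable borel"
  shows "mpot m s f \<in> borel_measurable borel"
proof -
  have "(\<lambda>x. \<integral>\<^sup>+t. ennreal (t powr (- s - 1)) * (\<Prod>i<m. \<integral>\<^sup>+y. ennreal \<bar>f i y\<bar> * (if dist x y < t then 1 else 0) \<partial>lborel)
      * indicator {0<..} t \<partial>lborel) \<in> borel_measurable borel"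
    by measurable
  then show ?thesis
    unfolding mpot_def[abs_def] by (simp add: indicator_def of_bool_def)
qed

text \<open>This collects what the multilinear argument consumes: the one-variable conditions and
  the reverse product inequality \<open>prod_V\<close>, both derived later from the joint condition.
  With the ordinary Holder inequality, \<open>prod_V\<close> makes \<open>W\<close> and
  \<open>G\<close> comparable.\<close>

locale multi_weight =
  fixes m :: nat and p q H :: "nat \<Rightarrow> real" and \<omega> :: "nat \<Rightarrow> 'a::euclidean_space \<Rightarrow> real" and Q CQ :: real
  assumes m_pos: "0 < m"
    and comp: "i < m \<Longrightarrow> apq_weight (p i) (q i) (H i) (\<omega> i)"
    and Q_eq: "1 / Q = (\<Sum>i<m. 1 / q i)"
    and CQ_pos: "0 < CQ"
    and prod_V: "0 < t \<Longrightarrow> (\<Prod>i<m. wball (\<lambda>y. \<omega> i y powr q i) x t powr (1 / q i))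
        \<le> CQ * wball (\<lambda>y. (\<Prod>i<m. \<omega> i y) powr Q) x t powr (1 / Q)"
    and u_int: "set_integrable lborel (ball x r) (\<lambda>y. (\<Prod>i<m. \<omega> i y) powr Q)"
begin

definition Vi :: "nat \<Rightarrow> 'a \<Rightarrow> real \<Rightarrow> real" where "Vi i x t = wball (\<lambda>y. \<omega> i y powr q i) x t"
definition W :: "'a \<Rightarrow> real \<Rightarrow> real" where "W x t = wball (\<lambda>y. (\<Prod>i<m. \<omega> i y) powr Q) x t"
definition P :: real where "P = 1 / (\<Sum>i<m. 1 / p i)"
text \<open>The dimension minus the order of the one-variable fractional integral with exponents
  \<open>p i\<close> and \<open>q i\<close>; the sum \<open>sM\<close> is the homogeneity of the
  multilinear kernel.\<close>

definition nu :: "nat \<Rightarrow> real" where "nu i = real DIM('a) * (1 - 1 / p i + 1 / q i)"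
definition sM :: real where "sM = (\<Sum>i<m. nu i)"
text \<open>The geometric mean of the \<open>Vi\<close> with exponents \<open>Q / q i\<close>, which
  add up to one. Scales are balanced in this variable: doubling and growth pass to it factor by
  factor, and \<open>G powr (- 1 / Q)\<close> is exactly the product of the
  \<open>Vi powr (- 1 / q i)\<close>.\<close>

definition G :: "'a \<Rightarrow> real \<Rightarrow> real" where "G x t = (\<Prod>i<m. Vi i x t powr (Q / q i))"
definition mW :: "'a measure" where "mW = density lborel (\<lambda>y. ennreal ((\<Prod>i<m. \<omega> i y) powr Q))"

lemma Vi_V: "i < m \<Longrightarrow> apq_weight.V (q i) (\<omega> i) = Vi i"
  using apq_weight.V_def[OF comp] unfolding Vi_def by (intro ext) auto

lemma pq_facts: "i < m \<Longrightarrow> 1 \<le> p i" "i < m \<Longrightarrow> p i < q i" "i < m \<Longrightarrow> 0 < p i" "i < m \<Longrightarrow> 0 < q i" "i < m \<Longrightarrow> 0 < H i"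
  using apq_weight.p_ge[OF comp] apq_weight.p_less[OF comp] apq_weight.q_pos[OF comp] apq_weight.H_pos[OF comp] by auto

lemma omega_meas [measurable]: "i < m \<Longrightarrow> \<omega> i \<in> borel_measurable borel"
  using apq_weight.w_meas[OF comp] .

lemma omega_nonneg: "i < m \<Longrightarrow> 0 \<le> \<omega> i y"
  using apq_weight.w_nonneg[OF comp] .

lemma omega_pos: "AE y in lborel. \<forall>i\<in>{..<m}. 0 < \<omega> i y"
  using apq_weight.w_pos[OF comp] by (subst AE_finite_all) auto

lemma sum_p_pos: "0 < (\<Sum>i<m. 1 / p i)" and sum_q_pos: "0 < (\<Sum>i<m. 1 / q i)"
  using m_pos pq_facts by (intro sum_pos; force)+

lemma Q_pos: "0 < Q" and P_pos: "0 < P" and P_eq: "1 / P = (\<Sum>i<m. 1 / p i)"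
proof -
  show "0 < Q" using sum_q_pos Q_eq by (metis zero_less_divide_1_iff)
  show "0 < P" using sum_p_pos by (simp add: P_def)
  show "1 / P = (\<Sum>i<m. 1 / p i)" by (simp add: P_def)
qed

lemma PQ_less: "1 / Q < 1 / P"
  unfolding Q_eq P_eq using m_pos pq_facts
  by (intro sum_strict_mono) (auto simp: frac_less2)

lemma sum_Q: "(\<Sum>i<m. Q / q i) = 1"
proof -
  have "(\<Sum>i<m. Q / q i) = Q * (\<Sum>i<m. 1 / q i)" by (simp add: sum_distrib_left)
  then show ?thesis using Q_eq[symmetric] Q_pos by simp
qed

lemma sum_P: "(\<Sum>i<m. P / p i) = 1"
proof -
  have "(\<Sum>i<m. P / p i) = P * (\<Sum>i<m. 1 / p i)" by (simp add: sum_distrib_left)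
  then show ?thesis using P_eq[symmetric] P_pos by simp
qed

lemma Vi_pos: "i < m \<Longrightarrow> 0 < t \<Longrightarrow> 0 < Vi i x t"
  using apq_weight.V_pos[OF comp] Vi_V by metis

lemma Vi_nonneg: "0 \<le> Vi i x t"
  unfolding Vi_def by (intro wball_nonneg) auto

lemma Vi_eq: "i < m \<Longrightarrow> (\<integral>\<^sup>+y. ennreal (\<omega> i y powr q i) * indicator (ball x t) y \<partial>lborel) = ennreal (Vi i x t)"
  using apq_weight.V_eq[OF comp] Vi_V by metis

lemma G_pos: "0 < t \<Longrightarrow> 0 < G x t"
  unfolding G_def using less_imp_neq[OF Vi_pos[of _ t x]] by (intro prod_pos) auto

lemma G_powr: "G x t powr e = (\<Prod>i<m. Vi i x t powr (Q / q i * e))"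
  unfolding G_def by (subst prod_powr_distrib) (auto simp: powr_powr)

lemma u_eq: "(\<Prod>i<m. \<omega> i y) powr Q = (\<Prod>i<m. (\<omega> i y powr q i) powr (Q / q i))"
proof -
  have "(\<Prod>i<m. \<omega> i y) powr Q = (\<Prod>i<m. \<omega> i y powr Q)"
    using omega_nonneg by (subst prod_powr_distrib) auto
  also have "\<dots> = (\<Prod>i<m. (\<omega> i y powr q i) powr (Q / q i))"
  proof (rule prod.cong[OF refl])
    fix i assume "i \<in> {..<m}"
    then have "q i * (Q / q i) = Q" using pq_facts(4)[of i] by auto
    then show "\<omega> i y powr Q = (\<omega> i y powr q i) powr (Q / q i)" by (simp only: powr_powr)
  qed
  finally show ?thesis .
qed

lemma W_eq: "(\<integral>\<^sup>+y. ennreal ((\<Prod>i<m. \<omega> i y) powr Q) * indicator (ball x t) y \<partial>lborel) = ennreal (W x t)"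
  unfolding W_def by (intro nn_integral_ball_eq_wball u_int) auto

lemma W_nonneg: "0 \<le> W x t"
  unfolding W_def by (intro wball_nonneg) auto

lemma W_pos: "0 < t \<Longrightarrow> 0 < W x t"
  unfolding W_def
proof (intro wball_pos u_int)
  show "AE y in lborel. 0 < (\<Prod>i<m. \<omega> i y) powr Q"
    using omega_pos
  proof eventually_elim
    case (elim y)
    then have "0 < (\<Prod>i<m. \<omega> i y)" by (intro prod_pos) auto
    then show ?case by (metis less_irrefl powr_gt_zero)
  qed
qed auto

lemma W_le_G: "W x t \<le> G x t"
proof -
  have "ennreal (W x t) = (\<integral>\<^sup>+y. (\<Prod>i<m. epow (ennreal (\<omega> i y powr q i) * indicator (ball x t) y) (Q / q i)) \<partial>lborel)"
    unfolding W_eq[symmetric]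
  proof (rule nn_integral_cong)
    fix y
    show "ennreal ((\<Prod>i<m. \<omega> i y) powr Q) * indicator (ball x t) y = (\<Prod>i<m. epow (ennreal (\<omega> i y powr q i) * indicator (ball x t) y) (Q / q i))"
    proof (cases "y \<in> ball x t")
      case True
      then show ?thesis by (simp add: u_eq prod_ennreal)
    next
      case False
      then show ?thesis using m_pos by (auto simp: prod_zero_iff)
    qed
  qed
  also have "\<dots> \<le> (\<Prod>i<m. epow (\<integral>\<^sup>+y. ennreal (\<omega> i y powr q i) * indicator (ball x t) y \<partial>lborel) (Q / q i))"
    using sum_Q Q_pos pq_facts by (intro Holder_nn_integral) auto
  also have "\<dots> = ennreal (G x t)"
    unfolding G_def by (simp add: Vi_eq Vi_nonneg prod_ennreal)
  finally show ?thesis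
    by (subst (asm) ennreal_le_iff) (auto simp: G_def intro!: prod_nonneg)
qed

lemma G_le_W:
  assumes "0 < t"
  shows "G x t \<le> CQ powr Q * W x t"
proof -
  have "G x t powr (1 / Q) \<le> CQ * W x t powr (1 / Q)"
    using prod_V[OF assms, of x] Q_pos unfolding G_powr by (simp add: W_def Vi_def)
  then have "(G x t powr (1 / Q)) powr Q \<le> (CQ * W x t powr (1 / Q)) powr Q"
    using Q_pos by (intro powr_mono2) auto
  then show ?thesis
    using CQ_pos W_nonneg G_pos[OF assms, of x] Q_pos by (simp add: powr_mult powr_powr)
qed

section \<open>Doubling and growth of the geometric mean and of the product measure\<close>

lemma G_mono:
  assumes "ball x t \<subseteq> ball y r"
  shows "G x t \<le> G y r"
  unfolding G_def
proof (intro prod_mono conjI)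
  fix i assume i: "i \<in> {..<m}"
  have "Vi i x t \<le> Vi i y r"
    using apq_weight.V_mono[OF comp, of i x t y r] assms i Vi_V[of i] by auto
  then show "Vi i x t powr (Q / q i) \<le> Vi i y r powr (Q / q i)"
    using i Q_pos pq_facts(4)[of i] Vi_nonneg by (intro powr_mono2) (auto simp: less_imp_le)
qed auto

lemma Vi_doubling: "\<exists>K>0. \<forall>i<m. \<forall>x t y r. 0 < t \<longrightarrow> r \<le> 5 * t \<longrightarrow> ball x t \<subseteq> ball y r \<longrightarrow> Vi i y r \<le> K * Vi i x t"
proof -
  define k where "k i = apq_weight.C1 TYPE('a) (p i) (q i) (H i) * 5 powr (real DIM('a) * q i)" for i
  have k: "0 < k i" if "i < m" for i
    unfolding k_def using apq_weight.C1_pos[OF comp[OF that]] by simp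
  have le: "Vi i y r \<le> k i * Vi i x t" if "i < m" "0 < t" "r \<le> 5 * t" "ball x t \<subseteq> ball y r" for i x t y r
  proof -
    have r: "0 < r" using that(2,4) by (metis ball_eq_empty not_le subset_empty)
    have "Vi i y r \<le> apq_weight.C1 TYPE('a) (p i) (q i) (H i) * (r / t) powr (real DIM('a) * q i) * Vi i x t"
      using apq_weight.V_compare[OF comp[OF that(1)] that(4,2) r] Vi_V[OF that(1)] by simp
    also have "\<dots> \<le> k i * Vi i x t"
      unfolding k_def using that r pq_facts(4)[OF that(1)] apq_weight.C1_pos[OF comp[OF that(1)]] Vi_nonneg
      by (intro mult_right_mono mult_left_mono powr_mono2) (auto simp: field_simps)
    finally show ?thesis .
  qed
  define K where "K = (\<Sum>i<m. k i)"
  have "k i \<le> K" if "i < m" for i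
    unfolding K_def using that k by (intro member_le_sum) (auto simp: less_imp_le)
  moreover have "0 < K"
    unfolding K_def using k m_pos by (intro sum_pos) auto
  ultimately show ?thesis
    using le Vi_nonneg by (intro exI[of _ K]) (meson mult_right_mono order_trans)
qed

lemma G_doubling: "\<exists>K>0. \<forall>x t y r. 0 < t \<longrightarrow> r \<le> 5 * t \<longrightarrow> ball x t \<subseteq> ball y r \<longrightarrow> G y r \<le> K * G x t"
proof -
  obtain K where K: "K > 0" "\<And>i x t y r. i < m \<Longrightarrow> 0 < t \<Longrightarrow> r \<le> 5 * t \<Longrightarrow> ball x t \<subseteq> ball y r \<Longrightarrow> Vi i y r \<le> K * Vi i x t"
    using Vi_doubling by blast
  have "G y r \<le> K * G x t" if "0 < t" "r \<le> 5 * t" "ball x t \<subseteq> ball y r" for x t y r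
  proof -
    have "G y r \<le> (\<Prod>i<m. K powr (Q / q i) * Vi i x t powr (Q / q i))"
      unfolding G_def
    proof (intro prod_mono conjI)
      fix i assume i: "i \<in> {..<m}"
      have "Vi i y r powr (Q / q i) \<le> (K * Vi i x t) powr (Q / q i)"
        using K(2)[of i t r x y] that i Q_pos pq_facts(4)[of i] Vi_nonneg by (intro powr_mono2) (auto simp: less_imp_le)
      then show "Vi i y r powr (Q / q i) \<le> K powr (Q / q i) * Vi i x t powr (Q / q i)"
        using K(1) Vi_nonneg by (simp add: powr_mult)
    qed auto
    also have "\<dots> = (\<Prod>i<m. K powr (Q / q i)) * G x t"
      by (simp add: prod.distrib G_def)
    \<comment> \<open>The exponents add up to one, so the common doubling constant of the factors
      survives unchanged.\<close>
    also have "(\<Prod>i<m. K powr (Q / q i)) = K"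
      using K(1) sum_Q by (simp add: powr_sum[symmetric])
    finally show ?thesis .
  qed
  then show ?thesis using K(1) by blast
qed

lemma G_growth: "\<exists>c d. 0 < c \<and> 0 < d \<and> (\<forall>x t r. 0 < t \<longrightarrow> t \<le> r \<longrightarrow> G x t \<le> c * (t / r) powr d * G x r)"
proof -
  have "\<forall>i\<in>{..<m}. \<exists>cd. 0 < fst cd \<and> 0 < snd cd \<and> (\<forall>x t r. 0 < t \<longrightarrow> t \<le> r \<longrightarrow> Vi i x t \<le> fst cd * (t / r) powr snd cd * Vi i x r)"
  proof
    fix i assume i: "i \<in> {..<m}"
    show "\<exists>cd. 0 < fst cd \<and> 0 < snd cd \<and> (\<forall>x t r. 0 < t \<longrightarrow> t \<le> r \<longrightarrow> Vi i x t \<le> fst cd * (t / r) powr snd cd * Vi i x r)"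
      using apq_weight.V_growth[OF comp, of i] Vi_V[of i] i by (metis fst_conv lessThan_iff snd_conv)
  qed
  from bchoice[OF this] obtain cd where cd: "\<And>i. i < m \<Longrightarrow> 0 < fst (cd i)" "\<And>i. i < m \<Longrightarrow> 0 < snd (cd i)"
    "\<And>i x t r. i < m \<Longrightarrow> 0 < t \<Longrightarrow> t \<le> r \<Longrightarrow> Vi i x t \<le> fst (cd i) * (t / r) powr snd (cd i) * Vi i x r"
    by blast
  define c where "c = (\<Prod>i<m. fst (cd i) powr (Q / q i))"
  define d where "d = (\<Sum>i<m. snd (cd i) * (Q / q i))"
  have c: "0 < c" unfolding c_def using cd(1) by (intro prod_pos) force
  have d: "0 < d" unfolding d_def using cd(2) Q_pos pq_facts(4) m_pos by (intro sum_pos) auto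
  have "G x t \<le> c * (t / r) powr d * G x r" if t: "0 < t" "t \<le> r" for x t r
  proof -
    have "G x t \<le> (\<Prod>i<m. fst (cd i) powr (Q / q i) * (t / r) powr (snd (cd i) * (Q / q i)) * Vi i x r powr (Q / q i))"
      unfolding G_def
    proof (intro prod_mono conjI)
      fix i assume i: "i \<in> {..<m}"
      have "Vi i x t powr (Q / q i) \<le> (fst (cd i) * (t / r) powr snd (cd i) * Vi i x r) powr (Q / q i)"
        using cd(3)[of i t r x] t i Q_pos pq_facts(4)[of i] Vi_nonneg by (intro powr_mono2) (auto simp: less_imp_le)
      then show "Vi i x t powr (Q / q i) \<le> fst (cd i) powr (Q / q i) * (t / r) powr (snd (cd i) * (Q / q i)) * Vi i x r powr (Q / q i)"
        using cd(1)[of i] i Vi_nonneg by (simp add: powr_mult powr_powr)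
    qed auto
    also have "\<dots> = c * (\<Prod>i<m. (t / r) powr (snd (cd i) * (Q / q i))) * G x r"
      by (simp add: prod.distrib G_def c_def)
    also have "(\<Prod>i<m. (t / r) powr (snd (cd i) * (Q / q i))) = (t / r) powr d"
      using t by (simp add: powr_sum[symmetric] d_def)
    finally show ?thesis .
  qed
  with c d show ?thesis by blast
qed

lemma emeasure_mW_ball: "emeasure mW (ball x t) = ennreal (W x t)"
  unfolding mW_def by (subst emeasure_density) (auto simp: W_eq)

text \<open>\<open>G\<close> is doubling, and the two-sided comparison of \<open>W\<close> with
  \<open>G\<close> transports this to the product measure at the cost of
  \<open>CQ powr Q\<close>.\<close>

lemma mW_doubling: "\<exists>D>0. doubling_measure mW D"
proof -
  obtain K where K: "K > 0" "\<And>x t y r. 0 < t \<Longrightarrow> r \<le> 5 * t \<Longrightarrow> ball x t \<subseteq> ball y r \<Longrightarrow> G y r \<le> K * G x t"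
    using G_doubling by blast
  define D where "D = K * CQ powr Q"
  have D: "0 < D" using K CQ_pos by (simp add: D_def)
  have "doubling_measure mW D"
  proof
    fix x r
    show "sets mW = sets borel" by (simp add: mW_def)
    show "emeasure mW (ball x r) < top" by (simp add: emeasure_mW_ball)
    show "0 < emeasure mW (ball x r)" if "0 < r" using W_pos[OF that] by (simp add: emeasure_mW_ball)
    show "emeasure mW (ball x (5 * r)) \<le> ennreal D * emeasure mW (ball x r)" if r: "0 < r"
    proof -
      have "W x (5 * r) \<le> G x (5 * r)" by (rule W_le_G)
      also have "\<dots> \<le> K * G x r" using r by (intro K) (auto simp: subset_ball)
      also have "\<dots> \<le> K * (CQ powr Q * W x r)" using G_le_W[OF r] K(1) by (intro mult_left_mono) auto
      also have "\<dots> = D * W x r" by (simp add: D_def)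
      finally show ?thesis using D W_nonneg by (simp add: emeasure_mW_ball ennreal_mult[symmetric])
    qed
  qed
  with D show ?thesis by blast
qed

section \<open>Ball integrals, local energies and the bound at a single scale\<close>

definition Fb :: "('a \<Rightarrow> real) \<Rightarrow> 'a \<Rightarrow> real \<Rightarrow> ennreal" where
  "Fb f x t = (\<integral>\<^sup>+y. ennreal \<bar>f y\<bar> * indicator (ball x t) y \<partial>lborel)"
text \<open>The \<open>p i\<close>-th power of the weighted local norm, kept without the root
  because it is additive over disjoint balls; \<open>Et\<close> is the global counterpart.\<close>

definition Eb :: "nat \<Rightarrow> ('a \<Rightarrow> real) \<Rightarrow> 'a \<Rightarrow> real \<Rightarrow> ennreal" where
  "Eb i f x t = (\<integral>\<^sup>+y. ennreal (\<bar>f y\<bar> powr p i * \<omega> i y powr p i) * indicator (ball x t) y \<partial>lborel)"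
definition Et :: "nat \<Rightarrow> ('a \<Rightarrow> real) \<Rightarrow> ennreal" where
  "Et i f = (\<integral>\<^sup>+y. ennreal (\<bar>f y\<bar> powr p i * \<omega> i y powr p i) \<partial>lborel)"

lemma Fb_le:
  assumes "i < m" "f \<in> borel_measurable borel" "0 < t"
  shows "Fb f x t \<le> ennreal (H i * t powr nu i * Vi i x t powr (- 1 / q i)) * epow (Eb i f x t) (1 / p i)"
proof -
  have "(\<lambda>y. ennreal \<bar>f y\<bar>) \<in> borel_measurable borel" using assms(2) by measurable
  from apq_weight.w_Holder[OF comp[OF assms(1)] this assms(3), of x]
  show ?thesis
    unfolding Fb_def Eb_def nu_def Vi_def by (simp add: ennreal_mult)
qed

lemma Eb_le_Et: "Eb i f x t \<le> Et i f"
  unfolding Eb_def Et_def by (intro nn_integral_mono) (auto simp: indicator_def)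

lemma Eb_mono: "ball x t \<subseteq> ball y r \<Longrightarrow> Eb i f x t \<le> Eb i f y r"
  unfolding Eb_def by (intro nn_integral_mono mult_left_mono) (auto simp: indicator_def)

text \<open>The homogeneity is the sum of the \<open>nu i\<close>, so the power of \<open>t\<close>
  can be shared among the factors, leaving the scale-invariant measure
  \<open>dt / t\<close>.\<close>

lemma mpot_eq: "mpot m sM f x = (\<integral>\<^sup>+t. (\<Prod>i<m. ennreal (t powr (- nu i)) * Fb (f i) x t) * ennreal (1 / t) * indicator {0<..} t \<partial>lborel)"
  unfolding mpot_def
proof (rule nn_integral_cong)
  fix t :: real
  have "(\<Prod>i<m. ennreal (t powr (- nu i))) * ennreal (1 / t) = ennreal (t powr (- sM - 1))" if "0 < t"
  proof -
    have "(\<Prod>i<m. t powr (- nu i)) = t powr (- sM)"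
      using that by (simp add: powr_sum[symmetric] sM_def sum_negf)
    then have "(\<Prod>i<m. ennreal (t powr (- nu i))) = ennreal (t powr (- sM))"
      by (simp add: prod_ennreal)
    then show ?thesis using that by (simp add: ennreal_mult[symmetric] powr_diff)
  qed
  then have "ennreal (t powr (- sM - 1)) = (\<Prod>i<m. ennreal (t powr (- nu i))) * ennreal (1 / t)" if "0 < t"
    using that by simp
  then show "ennreal (t powr (- sM - 1)) * (\<Prod>i<m. \<integral>\<^sup>+y. ennreal \<bar>f i y\<bar> * indicator (ball x t) y \<partial>lborel) * indicator {0<..} t
     = (\<Prod>i<m. ennreal (t powr (- nu i)) * Fb (f i) x t) * ennreal (1 / t) * indicator {0<..} t"
    by (cases "0 < t") (auto simp: prod.distrib Fb_def[symmetric] mult_ac)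
qed

lemma Tb_le:
  assumes "i < m" "f \<in> borel_measurable borel" "0 < t"
  shows "ennreal (t powr (- nu i)) * Fb f x t \<le> ennreal (H i * Vi i x t powr (- 1 / q i)) * epow (Eb i f x t) (1 / p i)"
proof -
  have "ennreal (t powr (- nu i)) * Fb f x t
    \<le> ennreal (t powr (- nu i)) * (ennreal (H i * t powr nu i * Vi i x t powr (- 1 / q i)) * epow (Eb i f x t) (1 / p i))"
    by (intro mult_left_mono Fb_le assms) auto
  also have "\<dots> = ennreal (t powr (- nu i) * (H i * t powr nu i * Vi i x t powr (- 1 / q i))) * epow (Eb i f x t) (1 / p i)"
    using pq_facts(5)[OF assms(1)] by (simp add: ennreal_mult mult.assoc)
  also have "t powr (- nu i) * (H i * t powr nu i * Vi i x t powr (- 1 / q i)) = H i * Vi i x t powr (- 1 / q i)"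
    using assms(3) by (simp add: powr_minus)
  finally show ?thesis .
qed

lemma prod_Tb_le:
  assumes "\<And>i. i < m \<Longrightarrow> f i \<in> borel_measurable borel" "0 < t"
  shows "(\<Prod>i<m. ennreal (t powr (- nu i)) * Fb (f i) x t)
     \<le> ennreal ((\<Prod>i<m. H i) * G x t powr (- 1 / Q)) * (\<Prod>i<m. epow (Eb i (f i) x t) (1 / p i))"
proof -
  have "(\<Prod>i<m. ennreal (t powr (- nu i)) * Fb (f i) x t)
     \<le> (\<Prod>i<m. ennreal (H i * Vi i x t powr (- 1 / q i)) * epow (Eb i (f i) x t) (1 / p i))"
    using assms by (intro prod_mono_ennreal Tb_le) auto
  also have "\<dots> = ennreal (\<Prod>i<m. H i * Vi i x t powr (- 1 / q i)) * (\<Prod>i<m. epow (Eb i (f i) x t) (1 / p i))"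
    unfolding prod.distrib[of "\<lambda>i. ennreal (H i * Vi i x t powr (- 1 / q i))"]
    using pq_facts(5) by (subst prod_ennreal) (auto simp: less_imp_le)
  also have "(\<Prod>i<m. H i * Vi i x t powr (- 1 / q i)) = (\<Prod>i<m. H i) * G x t powr (- 1 / Q)"
    using Q_pos by (simp add: prod.distrib G_powr)
  finally show ?thesis .
qed

text \<open>Zero energies are treated apart because the balancing argument requires strictly
  positive bounds.\<close>

lemma mpot_zero:
  assumes "\<And>i. i < m \<Longrightarrow> f i \<in> borel_measurable borel" "j < m" "Et j (f j) = 0"
  shows "mpot m sM f x = 0"
proof -
  have "Fb (f j) x t = 0" if "0 < t" for t
    using Fb_le[OF assms(2) assms(1)[OF assms(2)] that, of x] Eb_le_Et[of j "f j" x t] assms(3) by simp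
  then have "(\<Prod>i<m. ennreal (t powr (- nu i)) * Fb (f i) x t) = 0" if "0 < t" for t
    using assms(2) that by (auto simp: prod_zero_iff)
  then have "(\<Prod>i<m. ennreal (t powr (- nu i)) * Fb (f i) x t) * ennreal (1 / t) * indicator {0<..} t = 0" for t
    by (cases "0 < t") auto
  then show ?thesis unfolding mpot_eq by (simp only: nn_integral_const) simp
qed

end

section \<open>Weak and strong type bounds for the multilinear potential\<close>

context multi_weight
begin

lemma Eb_measurable [measurable]:
  assumes [measurable]: "f \<in> borel_measurable borel" and i: "i < m"
  shows "(\<lambda>x. Eb i f x t) \<in> borel_measurable borel"
proof -
  have [measurable]: "\<omega> i \<in> borel_measurable borel" using i by (rule omega_meas)
  show ?thesis unfolding Eb_def by (rule lborel_doubling.measurable_ball_integral) measurable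
qed

text \<open>The exponents \<open>P / p i\<close> add up to one, so Holder for counting measure on
  the centres separates the factors, and each energy then sums over disjoint balls. This is how
  \<open>P\<close> enters the weak type bound.\<close>

lemma disjoint_prod_Eb_le:
  assumes f: "\<And>i. i < m \<Longrightarrow> f i \<in> borel_measurable borel"
    and C: "countable C" "disjoint_family_on (\<lambda>x. ball x (r x)) C"
  shows "(\<integral>\<^sup>+x. (\<Prod>i<m. epow (Eb i (f i) x (r x)) (P / p i)) \<partial>count_space C) \<le> (\<Prod>i<m. epow (Et i (f i)) (P / p i))"
proof -
  have "(\<integral>\<^sup>+x. (\<Prod>i<m. epow (Eb i (f i) x (r x)) (P / p i)) \<partial>count_space C)
     \<le> (\<Prod>i<m. epow (\<integral>\<^sup>+x. Eb i (f i) x (r x) \<partial>count_space C) (P / p i))"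
    using sum_P P_pos pq_facts(3) by (intro Holder_nn_integral) auto
  also have "\<dots> \<le> (\<Prod>i<m. epow (Et i (f i)) (P / p i))"
  proof (intro prod_mono_ennreal epow_mono)
    fix i assume "i \<in> {..<m}"
    then have i: "i < m" by simp
    have [measurable]: "\<omega> i \<in> borel_measurable borel" "f i \<in> borel_measurable borel" using i f omega_meas by auto
    show "(\<integral>\<^sup>+x. Eb i (f i) x (r x) \<partial>count_space C) \<le> Et i (f i)"
      unfolding Eb_def Et_def by (rule lborel_doubling.disjoint_ball_integral_le[OF _ C]) measurable
    show "0 \<le> P / p i" using P_pos pq_facts(3)[OF i] by simp
  qed
  finally show ?thesis .
qed

text \<open>Off the exceptional set produced by the covering lemma, the integrand of the potential is controlled at
  small radii by the averages and at large radii by the global norms; the two bounds balance as in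
  Hedberg's inequality.\<close>

lemma weak_type:
  obtains C :: real where "0 < C"
    and "\<And>f E l. (\<And>i. i < m \<Longrightarrow> f i \<in> borel_measurable borel) \<Longrightarrow> (\<And>i. i < m \<Longrightarrow> 0 \<le> E i) \<Longrightarrow>
       (\<And>i. i < m \<Longrightarrow> Et i (f i) = ennreal (E i)) \<Longrightarrow> 0 < l \<Longrightarrow>
       ennreal (l powr Q) * emeasure mW {x. ennreal l < mpot m sM f x} \<le> ennreal (C * (\<Prod>i<m. E i powr (Q / p i)))"
proof -
  obtain D where D: "0 < D" "doubling_measure mW D" using mW_doubling by blast
  interpret mW: doubling_measure mW D by (rule D(2))
  obtain c d where cd: "0 < c" "0 < d" "\<And>x t r. 0 < t \<Longrightarrow> t \<le> r \<Longrightarrow> G x t \<le> c * (t / r) powr d * G x r"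
    using G_growth by blast
  obtain D2 where D2: "0 < D2" "\<And>x t y r. 0 < t \<Longrightarrow> r \<le> 5 * t \<Longrightarrow> ball x t \<subseteq> ball y r \<Longrightarrow> G y r \<le> D2 * G x t"
    using G_doubling by blast
  \<comment> \<open>In terms of \<open>G\<close>, the global norms give decay with exponent
    \<open>a\<close>. Off the exceptional set the energies contribute \<open>G powr (1 / P)\<close>,
    which leaves the growing exponent \<open>b\<close>.\<close>
  define a where "a = 1 / Q"
  define b where "b = 1 / P - 1 / Q"
  have ab: "0 < a" "0 < b" using Q_pos PQ_less by (auto simp: a_def b_def)
  have abs: "a / (a + b) = P / Q" "b / (a + b) = 1 - P / Q"
    using P_pos Q_pos by (auto simp: a_def b_def field_simps)
  define C2 where "C2 = (c * 2 powr d) powr b / (d * b) + (c * 2 powr d) powr a / (d * a)"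
  have C2: "0 < C2" unfolding C2_def using cd ab by (intro add_pos_pos) auto
  define HH where "HH = (\<Prod>i<m. H i)"
  have HH: "0 < HH" unfolding HH_def using pq_facts(5) by (intro prod_pos) auto
  define C where "C = D * (D2 * (C2 * HH) powr Q)"
  have C: "0 < C" using D D2 C2 HH by (simp add: C_def)
  have main: "ennreal (l powr Q) * emeasure mW {x. ennreal l < mpot m sM f x} \<le> ennreal (C * (\<Prod>i<m. E i powr (Q / p i)))"
    if f [measurable]: "\<And>i. i < m \<Longrightarrow> f i \<in> borel_measurable borel" and E: "\<And>i. i < m \<Longrightarrow> 0 < E i"
      "\<And>i. i < m \<Longrightarrow> Et i (f i) = ennreal (E i)" and l: "0 < l" for f E and l :: real
  proof -
    define EE where "EE = (\<Prod>i<m. E i powr (1 / p i))"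
    have EE: "0 < EE" unfolding EE_def using E(1) by (intro prod_pos) force
    have EEp: "EE powr e = (\<Prod>i<m. E i powr (e / p i))" for e
      unfolding EE_def using E(1) by (subst prod_powr_distrib) (auto simp: powr_powr)
    \<comment> \<open>\<open>\<kappa>\<close> is solved from the requirement that the balanced bound
      for the potential off the exceptional set be exactly \<open>l\<close>; dividing by
      \<open>D2\<close> anticipates the passage to rational radii.\<close>
    define \<kappa> where "\<kappa> = (l / (C2 * HH * EE powr (1 - P / Q))) powr Q / D2"
    have \<kappa>: "0 < \<kappa>" unfolding \<kappa>_def using l C2 HH EE D2 by simp
    define \<Phi> where "\<Phi> x t = ennreal (1 / \<kappa>) * (\<Prod>i<m. epow (Eb i (f i) x t) (P / p i))" for x t
    have [measurable]: "(\<lambda>x. \<Phi> x t) \<in> borel_measurable borel" for t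
      unfolding \<Phi>_def by measurable
    have meas: "{x. emeasure mW (ball x t) < \<Phi> x t} \<in> sets borel" for t
      by measurable
    define U where "U = (\<Union>t\<in>mW.Qpos. {x. emeasure mW (ball x t) < \<Phi> x t})"
    have U [measurable]: "U \<in> sets borel"
      unfolding U_def using mW.countable_Qpos meas by (intro sets.countable_UN') auto
    have outside: "mpot m sM f x \<le> ennreal l" if x: "x \<notin> U" for x
    proof -
      have Ebf: "Eb i (f i) x t \<le> ennreal (E i)" if "i < m" for i t
        using Eb_le_Et[of i "f i" x t] E(2)[OF that] by simp
      have small: "(\<Prod>i<m. epow (Eb i (f i) x t) (P / p i)) \<le> ennreal (\<kappa> * D2 * G x t)" if t: "0 < t" for t
      proof -
        \<comment> \<open>The exceptional set sees rational radii only, so \<open>t\<close> is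
          replaced by a rational \<open>u\<close> below \<open>2 * t\<close>; the energies increase,
          and \<open>G\<close> grows by at most the factor \<open>D2\<close>.\<close>
        obtain u where u: "u \<in> \<rat>" "t < u" "u < 2 * t"
          using Rats_dense_in_real[of t "2 * t"] t by auto
        have "u \<in> mW.Qpos" using u t by (auto simp: mW.Qpos_def)
        then have "\<Phi> x u \<le> emeasure mW (ball x u)"
          using x unfolding U_def by (auto simp: not_less)
        then have "ennreal \<kappa> * \<Phi> x u \<le> ennreal \<kappa> * ennreal (W x u)"
          unfolding emeasure_mW_ball by (intro mult_left_mono) auto
        then have "(\<Prod>i<m. epow (Eb i (f i) x u) (P / p i)) \<le> ennreal (\<kappa> * W x u)"
          using \<kappa> W_nonneg unfolding \<Phi>_def by (simp add: mult.assoc[symmetric] ennreal_mult[symmetric])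
        also have "\<dots> \<le> ennreal (\<kappa> * (D2 * G x t))"
        proof (intro ennreal_leI mult_left_mono)
          have "W x u \<le> G x u" by (rule W_le_G)
          also have "\<dots> \<le> D2 * G x t" using u t by (intro D2) (auto simp: subset_ball)
          finally show "W x u \<le> D2 * G x t" .
        qed (use \<kappa> in auto)
        finally have "(\<Prod>i<m. epow (Eb i (f i) x u) (P / p i)) \<le> ennreal (\<kappa> * D2 * G x t)"
          by (simp add: mult.assoc)
        moreover have "(\<Prod>i<m. epow (Eb i (f i) x t) (P / p i)) \<le> (\<Prod>i<m. epow (Eb i (f i) x u) (P / p i))"
          using u P_pos pq_facts(3)
          by (intro prod_mono_ennreal epow_mono Eb_mono subset_ball) (auto simp: less_imp_le)
        ultimately show ?thesis by (rule order_trans[rotated])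
      qed
      have eq: "(\<Prod>i<m. epow (Eb i (f i) x t) (1 / p i)) = epow (\<Prod>i<m. epow (Eb i (f i) x t) (P / p i)) (1 / P)" for t
        using P_pos pq_facts(3) by (subst epow_prod) (auto simp: epow_epow intro!: prod.cong)
      have T1: "(\<Prod>i<m. ennreal (t powr (- nu i)) * Fb (f i) x t) \<le> ennreal (HH * EE * G x t powr (- a))" if t: "0 < t" for t
      proof -
        have "(\<Prod>i<m. epow (Eb i (f i) x t) (1 / p i)) \<le> (\<Prod>i<m. epow (ennreal (E i)) (1 / p i))"
          using Ebf pq_facts(3) by (intro prod_mono_ennreal epow_mono) (auto simp: less_imp_le)
        also have "\<dots> = ennreal EE"
          using E(1) by (simp add: EE_def prod_ennreal less_imp_le)
        finally have "(\<Prod>i<m. ennreal (t powr (- nu i)) * Fb (f i) x t) \<le> ennreal (HH * G x t powr (- 1 / Q)) * ennreal EE"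
          using prod_Tb_le[of f t x, OF f t] unfolding HH_def by (meson mult_left_mono order_trans zero_le)
        also have "\<dots> = ennreal (HH * EE * G x t powr (- a))"
          using HH EE by (simp add: ennreal_mult[symmetric] a_def mult_ac)
        finally show ?thesis .
      qed
      have T2: "(\<Prod>i<m. ennreal (t powr (- nu i)) * Fb (f i) x t) \<le> ennreal (HH * (\<kappa> * D2) powr (1 / P) * G x t powr b)" if t: "0 < t" for t
      proof -
        have Gt: "0 < G x t" by (rule G_pos) fact
        have "(\<Prod>i<m. epow (Eb i (f i) x t) (1 / p i)) \<le> epow (ennreal (\<kappa> * D2 * G x t)) (1 / P)"
          unfolding eq using small[OF t] P_pos by (intro epow_mono) auto
        also have "\<dots> = ennreal ((\<kappa> * D2) powr (1 / P) * G x t powr (1 / P))"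
          using \<kappa> D2 Gt by (simp add: powr_mult)
        finally have "(\<Prod>i<m. ennreal (t powr (- nu i)) * Fb (f i) x t)
           \<le> ennreal (HH * G x t powr (- 1 / Q)) * ennreal ((\<kappa> * D2) powr (1 / P) * G x t powr (1 / P))"
          using prod_Tb_le[of f t x, OF f t] unfolding HH_def by (meson mult_left_mono order_trans zero_le)
        also have "\<dots> = ennreal (HH * (\<kappa> * D2) powr (1 / P) * (G x t powr (1 / P) * G x t powr (- 1 / Q)))"
          using HH by (simp add: ennreal_mult[symmetric] mult_ac)
        also have "G x t powr (1 / P) * G x t powr (- 1 / Q) = G x t powr b"
          by (simp add: powr_add[symmetric] b_def)
        finally show ?thesis .
      qed
      have "mpot m sM f x \<le> ennreal (C2 * ((HH * EE) powr (b / (a + b)) * (HH * (\<kappa> * D2) powr (1 / P)) powr (a / (a + b))))"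
        unfolding mpot_eq C2_def
        by (rule hedberg_integral[where G = "G x"]) (use G_pos cd ab HH EE \<kappa> D2 T1 T2 in auto)
      also have "C2 * ((HH * EE) powr (b / (a + b)) * (HH * (\<kappa> * D2) powr (1 / P)) powr (a / (a + b)))
          = C2 * HH * EE powr (1 - P / Q) * (\<kappa> * D2) powr (1 / Q)"
      proof -
        have "HH powr (1 - P / Q) * HH powr (P / Q) = HH"
          using HH by (simp add: powr_add[symmetric])
        then show ?thesis
          unfolding abs using HH EE \<kappa> D2 P_pos by (simp add: powr_mult powr_powr)
      qed
      also have "(\<kappa> * D2) powr (1 / Q) = l / (C2 * HH * EE powr (1 - P / Q))"
        using D2 l C2 HH EE Q_pos by (simp add: \<kappa>_def powr_powr)
      also have "C2 * HH * EE powr (1 - P / Q) * (l / (C2 * HH * EE powr (1 - P / Q))) = l"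
        using C2 HH EE by simp
      finally show ?thesis .
    qed
    have "emeasure mW {x. ennreal l < mpot m sM f x} \<le> emeasure mW U"
      using outside by (intro emeasure_mono) (auto simp: mW.sets_eq not_less[symmetric])
    also have "\<dots> \<le> ennreal D * (ennreal (1 / \<kappa>) * (\<Prod>i<m. epow (Et i (f i)) (P / p i)))"
      unfolding U_def
    proof (rule mW.vitali_union[OF meas])
      fix C :: "'a set" and r :: "'a \<Rightarrow> real"
      assume "countable C" "disjoint_family_on (\<lambda>x. ball x (r x)) C"
      from disjoint_prod_Eb_le[of f, OF f this]
      show "(\<integral>\<^sup>+x. \<Phi> x (r x) \<partial>count_space C) \<le> ennreal (1 / \<kappa>) * (\<Prod>i<m. epow (Et i (f i)) (P / p i))"
        unfolding \<Phi>_def by (subst nn_integral_cmult) (auto intro: mult_left_mono)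
    qed
    also have "(\<Prod>i<m. epow (Et i (f i)) (P / p i)) = ennreal (EE powr P)"
      using E unfolding EEp by (simp add: prod_ennreal less_imp_le)
    finally have "ennreal (l powr Q) * emeasure mW {x. ennreal l < mpot m sM f x} \<le> ennreal (l powr Q) * (ennreal D * (ennreal (1 / \<kappa>) * ennreal (EE powr P)))"
      by (intro mult_left_mono) auto
    also have "\<dots> = ennreal (l powr Q * (D * (1 / \<kappa> * EE powr P)))"
      using D \<kappa> by (simp add: ennreal_mult[symmetric])
    also have "l powr Q * (D * (1 / \<kappa> * EE powr P)) = C * EE powr Q"
    proof -
      have "1 / \<kappa> = D2 * (C2 * HH) powr Q * EE powr (Q - P) / l powr Q"
      proof -
        have "(EE powr (1 - P / Q)) powr Q = EE powr (Q - P)"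
          using Q_pos by (simp add: powr_powr algebra_simps)
        then show ?thesis
          unfolding \<kappa>_def using l C2 HH EE D2 by (simp add: powr_divide powr_mult)
      qed
      \<comment> \<open>The power \<open>EE powr (Q - P)\<close> hidden in
        \<open>1 / \<kappa>\<close> completes the \<open>EE powr P\<close> from the covering to the
        homogeneous \<open>EE powr Q\<close>.\<close>
      then have "l powr Q * (D * (1 / \<kappa> * EE powr P)) = C * (EE powr (Q - P) * EE powr P)"
        using l by (simp add: C_def)
      also have "EE powr (Q - P) * EE powr P = EE powr Q" by (simp add: powr_add[symmetric])
      finally show ?thesis .
    qed
    finally show ?thesis unfolding EEp .
  qed
  show ?thesis
  proof (rule that[OF C])
    fix f :: "nat \<Rightarrow> 'a \<Rightarrow> real" and E l
    assume f: "\<And>i. i < m \<Longrightarrow> f i \<in> borel_measurable borel" and E: "\<And>i. i < m \<Longrightarrow> 0 \<le> E i"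
      "\<And>i. i < m \<Longrightarrow> Et i (f i) = ennreal (E i)" and l: "0 < (l::real)"
    show "ennreal (l powr Q) * emeasure mW {x. ennreal l < mpot m sM f x} \<le> ennreal (C * (\<Prod>i<m. E i powr (Q / p i)))"
    proof (cases "\<exists>j<m. E j = 0")
      case True
      then obtain j where "j < m" "Et j (f j) = 0" using E(2) by auto
      from mpot_zero[of f, OF f this] show ?thesis by simp
    next
      case False
      then have "0 < E i" if "i < m" for i using E(1)[OF that] that by (metis order_le_less)
      with main[OF f _ E(2) l] show ?thesis by blast
    qed
  qed
qed

text \<open>Each factor is bounded by its global norm and by its maximal majorant, and interpolating
  the two gives a bound independent of the scale. All factors but one are frozen at that value, and
  the Hedberg integral is applied to the remaining one. The majorants have \<open>p i\<close>-th
  powers integrable against the different weights \<open>\<omega> i powr q i\<close>; Holder with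
  exponents \<open>Q / q i\<close> combines them into the product weight.\<close>

lemma strong_type:
  assumes strong: "\<And>i. i < m \<Longrightarrow> apq_weight_strong (p i) (q i) (H i) (\<omega> i) (H2 i)"
  obtains C :: real where "0 < C"
    and "\<And>f E. (\<And>i. i < m \<Longrightarrow> f i \<in> borel_measurable borel) \<Longrightarrow> (\<And>i. i < m \<Longrightarrow> 0 \<le> E i) \<Longrightarrow>
       (\<And>i. i < m \<Longrightarrow> Et i (f i) = ennreal (E i)) \<Longrightarrow>
       (\<integral>\<^sup>+x. epow (mpot m sM f x) Q \<partial>mW) \<le> ennreal (C * (\<Prod>i<m. E i powr (Q / p i)))"
proof -
  have "\<forall>i\<in>{..<m}. \<exists>K. 0 < K \<and> (\<forall>F. F \<in> borel_measurable borel \<longrightarrow> (\<exists>N. N \<in> borel_measurable borel \<and>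
      (\<integral>\<^sup>+x. epow (N x) (p i) * ennreal (\<omega> i x powr q i) \<partial>lborel)
         \<le> ennreal K * (\<integral>\<^sup>+x. epow (F x) (p i) * ennreal (\<omega> i x powr p i) \<partial>lborel) \<and>
      (\<forall>x t. 0 < t \<longrightarrow> (\<integral>\<^sup>+y. F y * indicator (ball x t) y \<partial>lborel)
         \<le> ennreal (K * t powr nu i * Vi i x t powr (1 / p i - 1 / q i)) * N x)))"
  proof
    fix i assume "i \<in> {..<m}"
    then have i: "i < m" by simp
    show "\<exists>K. 0 < K \<and> (\<forall>F. F \<in> borel_measurable borel \<longrightarrow> (\<exists>N. N \<in> borel_measurable borel \<and>
      (\<integral>\<^sup>+x. epow (N x) (p i) * ennreal (\<omega> i x powr q i) \<partial>lborel)
         \<le> ennreal K * (\<integral>\<^sup>+x. epow (F x) (p i) * ennreal (\<omega> i x powr p i) \<partial>lborel) \<and>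
      (\<forall>x t. 0 < t \<longrightarrow> (\<integral>\<^sup>+y. F y * indicator (ball x t) y \<partial>lborel)
         \<le> ennreal (K * t powr nu i * Vi i x t powr (1 / p i - 1 / q i)) * N x)))"
    proof (rule apq_weight_strong.maximal_majorant[OF strong[OF i], unfolded Vi_V[OF i], folded nu_def])
      fix K assume a: "0 < K" and b: "\<And>F. F \<in> borel_measurable borel \<Longrightarrow> \<exists>N. N \<in> borel_measurable borel \<and>
      (\<integral>\<^sup>+x. epow (N x) (p i) * ennreal (\<omega> i x powr q i) \<partial>lborel)
         \<le> ennreal K * (\<integral>\<^sup>+x. epow (F x) (p i) * ennreal (\<omega> i x powr p i) \<partial>lborel) \<and>
      (\<forall>x t. 0 < t \<longrightarrow> (\<integral>\<^sup>+y. F y * indicator (ball x t) y \<partial>lborel)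
         \<le> ennreal (K * t powr nu i * Vi i x t powr (1 / p i - 1 / q i)) * N x)"
      show ?thesis by (rule exI[of _ K], rule conjI, rule a, rule allI, rule impI, erule b)
    qed
  qed
  from bchoice[OF this] obtain K where K: "\<And>i. i < m \<Longrightarrow> 0 < K i"
    "\<And>i F. i < m \<Longrightarrow> F \<in> borel_measurable borel \<Longrightarrow> (\<exists>N. N \<in> borel_measurable borel \<and>
      (\<integral>\<^sup>+x. epow (N x) (p i) * ennreal (\<omega> i x powr q i) \<partial>lborel)
         \<le> ennreal (K i) * (\<integral>\<^sup>+x. epow (F x) (p i) * ennreal (\<omega> i x powr p i) \<partial>lborel) \<and>
      (\<forall>x t. 0 < t \<longrightarrow> (\<integral>\<^sup>+y. F y * indicator (ball x t) y \<partial>lborel)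
         \<le> ennreal (K i * t powr nu i * Vi i x t powr (1 / p i - 1 / q i)) * N x))"
    by blast
  \<comment> \<open>The factor with index 0 is the one that carries the integration over scales, so
    its growth is recorded.\<close>
  obtain c d where cd: "0 < c" "0 < d" "\<And>x t r. 0 < t \<Longrightarrow> t \<le> r \<Longrightarrow> Vi 0 x t \<le> c * (t / r) powr d * Vi 0 x r"
    using apq_weight.V_growth[OF comp[OF m_pos]] Vi_V[OF m_pos] by metis
  define a where "a i = 1 / q i" for i
  define b where "b i = 1 / p i - 1 / q i" for i
  have ab: "0 < a i" "0 < b i" if "i < m" for i
    using pq_facts[OF that] by (auto simp: a_def b_def frac_less2)
  have abs: "a i / (a i + b i) = p i / q i" "b i / (a i + b i) = 1 - p i / q i" if "i < m" for i
    using pq_facts[OF that] by (auto simp: a_def b_def field_simps)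
  define C2 where "C2 = (c * 2 powr d) powr b 0 / (d * b 0) + (c * 2 powr d) powr a 0 / (d * a 0)"
  have C2: "0 < C2" unfolding C2_def using cd ab[OF m_pos] by (intro add_pos_pos) auto
  define B where "B = C2 * (\<Prod>i<m. H i powr (1 - p i / q i) * K i powr (p i / q i))"
  have B: "0 < B" unfolding B_def using C2 K(1) pq_facts(5) by (intro mult_pos_pos prod_pos) force+
  define C where "C = B powr Q * (\<Prod>i<m. K i powr (Q / q i))"
  have C: "0 < C" unfolding C_def using B K(1) by (intro mult_pos_pos prod_pos) force+
  have main: "(\<integral>\<^sup>+x. epow (mpot m sM f x) Q \<partial>mW) \<le> ennreal (C * (\<Prod>i<m. E i powr (Q / p i)))"
    if f [measurable]: "\<And>i. i < m \<Longrightarrow> f i \<in> borel_measurable borel" and E: "\<And>i. i < m \<Longrightarrow> 0 < E i"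
      "\<And>i. i < m \<Longrightarrow> Et i (f i) = ennreal (E i)" for f E
  proof -
    have "\<forall>i\<in>{..<m}. \<exists>N. N \<in> borel_measurable borel \<and>
      (\<integral>\<^sup>+x. epow (N x) (p i) * ennreal (\<omega> i x powr q i) \<partial>lborel) \<le> ennreal (K i) * Et i (f i) \<and>
      (\<forall>x t. 0 < t \<longrightarrow> Fb (f i) x t \<le> ennreal (K i * t powr nu i * Vi i x t powr (1 / p i - 1 / q i)) * N x)"
    proof
      fix i assume "i \<in> {..<m}"
      then have i: "i < m" by simp
      have "(\<lambda>y. ennreal \<bar>f i y\<bar>) \<in> borel_measurable borel" using f[OF i] by measurable
      from K(2)[OF i this] show "\<exists>N. N \<in> borel_measurable borel \<and>
        (\<integral>\<^sup>+x. epow (N x) (p i) * ennreal (\<omega> i x powr q i) \<partial>lborel) \<le> ennreal (K i) * Et i (f i) \<and>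
        (\<forall>x t. 0 < t \<longrightarrow> Fb (f i) x t \<le> ennreal (K i * t powr nu i * Vi i x t powr (1 / p i - 1 / q i)) * N x)"
        unfolding Et_def Fb_def by (simp add: ennreal_mult)
    qed
    from bchoice[OF this] obtain N where N [measurable]: "\<And>i. i < m \<Longrightarrow> N i \<in> borel_measurable borel"
      and N1: "\<And>i. i < m \<Longrightarrow> (\<integral>\<^sup>+x. epow (N i x) (p i) * ennreal (\<omega> i x powr q i) \<partial>lborel) \<le> ennreal (K i) * Et i (f i)"
      and N2: "\<And>i x t. i < m \<Longrightarrow> 0 < t \<Longrightarrow> Fb (f i) x t \<le> ennreal (K i * t powr nu i * Vi i x t powr (1 / p i - 1 / q i)) * N i x"
      by blast
    define Tb where "Tb i x t = ennreal (t powr (- nu i)) * Fb (f i) x t" for i x t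
    have Tb1: "Tb i x t \<le> ennreal (H i * E i powr (1 / p i) * Vi i x t powr (- a i))" if i: "i < m" and t: "0 < t" for i x t
    proof -
      have "Tb i x t \<le> ennreal (H i * Vi i x t powr (- 1 / q i)) * epow (Eb i (f i) x t) (1 / p i)"
        unfolding Tb_def by (intro Tb_le i f t)
      also have "\<dots> \<le> ennreal (H i * Vi i x t powr (- 1 / q i)) * epow (ennreal (E i)) (1 / p i)"
        using Eb_le_Et[of i "f i" x t] E(2)[OF i] pq_facts(3)[OF i] by (intro mult_left_mono epow_mono) auto
      also have "\<dots> = ennreal (H i * E i powr (1 / p i) * Vi i x t powr (- a i))"
        using E(1)[OF i] pq_facts(5)[OF i] by (simp add: ennreal_mult[symmetric] a_def mult_ac)
      finally show ?thesis .
    qed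
    have Tb2: "Tb i x t \<le> ennreal (K i * Vi i x t powr b i) * N i x" if i: "i < m" and t: "0 < t" for i x t
    proof -
      have "Tb i x t \<le> ennreal (t powr (- nu i)) * (ennreal (K i * t powr nu i * Vi i x t powr b i) * N i x)"
        unfolding Tb_def b_def by (intro mult_left_mono N2 i t) auto
      also have "\<dots> = ennreal (t powr (- nu i) * (K i * t powr nu i * Vi i x t powr b i)) * N i x"
        using K(1)[OF i] by (simp add: ennreal_mult mult.assoc)
      also have "t powr (- nu i) * (K i * t powr nu i * Vi i x t powr b i) = K i * Vi i x t powr b i"
        using t by (simp add: powr_minus)
      finally show ?thesis .
    qed
    have pt: "mpot m sM f x \<le> ennreal B * (\<Prod>i<m. ennreal (E i powr b i) * epow (N i x) (p i / q i))" for x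
    proof (cases "\<exists>j<m. N j x = 0")
      case True
      then obtain j where j: "j < m" "N j x = 0" by auto
      then have "Tb j x t = 0" if "0 < t" for t using Tb2[OF j(1) that, of x] by simp
      then have "(\<Prod>i<m. Tb i x t) = 0" if "0 < t" for t
        using j(1) that by (auto simp: prod_zero_iff)
      then have "(\<Prod>i<m. Tb i x t) * ennreal (1 / t) * indicator {0<..} t = 0" for t
        by (cases "0 < t") auto
      then have "mpot m sM f x = 0" unfolding mpot_eq Tb_def[symmetric] by (simp only: nn_integral_const) simp
      then show ?thesis by simp
    next
      case nz: False
      show ?thesis
      proof (cases "\<exists>j<m. N j x = top")
        \<comment> \<open>An infinite majorant makes the right side infinite, since no other factor
          vanishes: all \<open>E i\<close> are positive and zero majorants were removed
          before.\<close>
        case True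
        then obtain j where j: "j < m" "N j x = top" by auto
        have E0: "ennreal (E i powr b i) \<noteq> 0" if "i < m" for i
          using E(1)[OF that] by (simp add: ennreal_eq_0_iff)
        then have "ennreal (E j powr b j) * epow (N j x) (p j / q j) = top"
          using j by (simp add: ennreal_mult_top)
        moreover have "ennreal (E i powr b i) * epow (N i x) (p i / q i) \<noteq> 0" if "i < m" for i
          using E0[OF that] nz that by simp
        ultimately have "(\<Prod>i<m. ennreal (E i powr b i) * epow (N i x) (p i / q i)) = top"
          using j(1) unfolding ennreal_prod_eq_top by blast
        then show ?thesis using B by (simp add: ennreal_mult_top)
      next
        case nt: False
        define n where "n i = enn2real (N i x)" for i
        have n: "N i x = ennreal (n i)" "0 < n i" if "i < m" for i
          using nz nt that unfolding n_def by (auto simp: less_top enn2real_positive_iff zero_less_iff_neq_zero)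
        define A where "A i = H i * E i powr (1 / p i)" for i
        define L where "L i = K i * n i" for i
        have A: "0 < A i" and L: "0 < L i" if "i < m" for i
          using pq_facts(5)[OF that] E(1)[OF that] K(1)[OF that] n(2)[OF that] by (auto simp: A_def L_def)
        define X where "X i = A i powr (b i / (a i + b i)) * L i powr (a i / (a i + b i))" for i
        have T1: "Tb i x t \<le> ennreal (A i * Vi i x t powr (- a i))" if "i < m" "0 < t" for i t
          using Tb1[OF that, of x] by (simp add: A_def)
        have T2: "Tb i x t \<le> ennreal (L i * Vi i x t powr b i)" if "i < m" "0 < t" for i t
          using Tb2[OF that, of x] K(1)[OF that(1)] n[OF that(1)] by (simp add: L_def ennreal_mult[symmetric] mult_ac)
        have TX: "Tb i x t \<le> ennreal (X i)" if i: "i < m" and t: "0 < t" for i t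
        proof -
          obtain r where r: "Tb i x t = ennreal r" "0 \<le> r"
            using T1[OF i t] by (cases "Tb i x t") (auto simp: top_unique)
          have "r \<le> X i"
            unfolding X_def
          proof (rule min_interpolate[OF A[OF i] L[OF i] Vi_pos[OF i t] ab[OF i]])
            show "r \<le> A i * Vi i x t powr (- a i)"
              using T1[OF i t] A[OF i] r by (simp add: ennreal_le_iff)
            show "r \<le> L i * Vi i x t powr b i"
              using T2[OF i t] L[OF i] r by (simp add: ennreal_le_iff)
          qed
          then show ?thesis using r by (simp add: ennreal_leI)
        qed
        have split: "{..<m} = insert 0 {1..<m}" using m_pos by auto
        have "mpot m sM f x = (\<integral>\<^sup>+t. (\<Prod>i<m. Tb i x t) * ennreal (1 / t) * indicator {0<..} t \<partial>lborel)"
          unfolding mpot_eq Tb_def ..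
        also have "\<dots> \<le> (\<integral>\<^sup>+t. (\<Prod>i\<in>{1..<m}. ennreal (X i)) * (Tb 0 x t * ennreal (1 / t) * indicator {0<..} t) \<partial>lborel)"
        proof (rule nn_integral_mono)
          fix t :: real
          show "(\<Prod>i<m. Tb i x t) * ennreal (1 / t) * indicator {0<..} t
            \<le> (\<Prod>i\<in>{1..<m}. ennreal (X i)) * (Tb 0 x t * ennreal (1 / t) * indicator {0<..} t)"
          proof (cases "0 < t")
            case True
            have "(\<Prod>i<m. Tb i x t) = Tb 0 x t * (\<Prod>i\<in>{1..<m}. Tb i x t)" unfolding split by simp
            also have "\<dots> \<le> Tb 0 x t * (\<Prod>i\<in>{1..<m}. ennreal (X i))"
              using TX True by (intro mult_left_mono prod_mono_ennreal) auto
            finally have "(\<Prod>i<m. Tb i x t) * ennreal (1 / t) \<le> Tb 0 x t * (\<Prod>i\<in>{1..<m}. ennreal (X i)) * ennreal (1 / t)"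
              by (rule mult_right_mono) simp
            then show ?thesis using True by (simp add: mult_ac)
          qed auto
        qed
        also have "\<dots> = (\<Prod>i\<in>{1..<m}. ennreal (X i)) * (\<integral>\<^sup>+t. Tb 0 x t * ennreal (1 / t) * indicator {0<..} t \<partial>lborel)"
        proof (rule nn_integral_cmult)
          have [measurable]: "f 0 \<in> borel_measurable borel" using f m_pos by simp
          have "(\<lambda>t. \<integral>\<^sup>+y. ennreal \<bar>f 0 y\<bar> * (if dist x y < t then 1 else 0) \<partial>lborel) \<in> borel_measurable borel"
            by measurable
          then have [measurable]: "(\<lambda>t. Fb (f 0) x t) \<in> borel_measurable borel"
            by (simp add: Fb_def indicator_def of_bool_def)
          show "(\<lambda>t. Tb 0 x t * ennreal (1 / t) * indicator {0<..} t) \<in> borel_measurable lborel"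
            unfolding Tb_def by measurable
        qed
        also have "\<dots> \<le> (\<Prod>i\<in>{1..<m}. ennreal (X i)) * ennreal (C2 * X 0)"
        proof (rule mult_left_mono)
          show "(\<integral>\<^sup>+t. Tb 0 x t * ennreal (1 / t) * indicator {0<..} t \<partial>lborel) \<le> ennreal (C2 * X 0)"
            unfolding C2_def X_def
            by (rule hedberg_integral[where G = "Vi 0 x"]) (use Vi_pos[OF m_pos] cd ab[OF m_pos] A[OF m_pos] L[OF m_pos] T1[OF m_pos] T2[OF m_pos] in auto)
        qed simp
        also have "\<dots> = ennreal (C2 * (\<Prod>i<m. X i))"
        proof -
          have X0: "0 \<le> X i" for i by (simp add: X_def)
          have "(\<Prod>i<m. X i) = X 0 * (\<Prod>i\<in>{1..<m}. X i)" unfolding split by simp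
          then show ?thesis using X0 C2
            by (simp add: prod_ennreal prod_nonneg ennreal_mult[symmetric] mult_ac)
        qed
        also have "C2 * (\<Prod>i<m. X i) = B * (\<Prod>i<m. E i powr b i * n i powr (p i / q i))"
        proof -
          have "X i = (H i powr (1 - p i / q i) * K i powr (p i / q i)) * (E i powr b i * n i powr (p i / q i))" if i: "i < m" for i
          proof -
            have e: "1 / p i * (1 - p i / q i) = b i" using pq_facts[OF i] by (simp add: b_def field_simps)
            show ?thesis
              unfolding X_def abs[OF i] A_def L_def powr_mult powr_powr e by (simp only: mult_ac)
          qed
          then show ?thesis by (simp add: B_def prod.distrib)
        qed
        also have "ennreal \<dots> = ennreal B * (\<Prod>i<m. ennreal (E i powr b i) * epow (N i x) (p i / q i))"
        proof -
          have "(\<Prod>i<m. ennreal (E i powr b i) * epow (N i x) (p i / q i)) = (\<Prod>i<m. ennreal (E i powr b i * n i powr (p i / q i)))"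
            using n by (intro prod.cong) (auto simp: ennreal_mult less_imp_le)
          also have "\<dots> = ennreal (\<Prod>i<m. E i powr b i * n i powr (p i / q i))"
            by (rule prod_ennreal) auto
          finally show ?thesis using B by (simp add: ennreal_mult prod_nonneg)
        qed
        finally show ?thesis .
      qed
    qed
    have "(\<integral>\<^sup>+x. epow (mpot m sM f x) Q \<partial>mW) = (\<integral>\<^sup>+x. ennreal ((\<Prod>i<m. \<omega> i x) powr Q) * epow (mpot m sM f x) Q \<partial>lborel)"
      unfolding mW_def by (subst nn_integral_density) auto
    also have "\<dots> \<le> (\<integral>\<^sup>+x. ennreal (B powr Q * (\<Prod>i<m. E i powr (b i * Q))) * (\<Prod>i<m. epow (epow (N i x) (p i) * ennreal (\<omega> i x powr q i)) (Q / q i)) \<partial>lborel)"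
    proof (rule nn_integral_mono)
      fix x
      have "epow (mpot m sM f x) Q \<le> epow (ennreal B * (\<Prod>i<m. ennreal (E i powr b i) * epow (N i x) (p i / q i))) Q"
        using pt Q_pos by (intro epow_mono) auto
      also have "\<dots> = ennreal (B powr Q * (\<Prod>i<m. E i powr (b i * Q))) * (\<Prod>i<m. epow (N i x) (p i * (Q / q i)))"
      proof -
        have "epow (\<Prod>i<m. ennreal (E i powr b i) * epow (N i x) (p i / q i)) Q
          = (\<Prod>i<m. ennreal (E i powr (b i * Q)) * epow (N i x) (p i * (Q / q i)))"
          using Q_pos pq_facts by (subst epow_prod) (auto simp: epow_mult epow_epow powr_powr intro!: prod.cong)
        also have "\<dots> = ennreal (\<Prod>i<m. E i powr (b i * Q)) * (\<Prod>i<m. epow (N i x) (p i * (Q / q i)))"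
          by (simp add: prod.distrib prod_ennreal)
        finally show ?thesis using Q_pos B by (simp add: epow_mult ennreal_mult prod_nonneg mult.assoc)
      qed
      finally have 1: "ennreal ((\<Prod>i<m. \<omega> i x) powr Q) * epow (mpot m sM f x) Q
         \<le> ennreal ((\<Prod>i<m. \<omega> i x) powr Q) * (ennreal (B powr Q * (\<Prod>i<m. E i powr (b i * Q))) * (\<Prod>i<m. epow (N i x) (p i * (Q / q i))))"
        by (intro mult_left_mono) auto
      \<comment> \<open>The product weight is distributed over the factors as powers
        \<open>Q / q i\<close> of the weights \<open>\<omega> i powr q i\<close>, which brings the
        integrand into the form required by Holder.\<close>
      have "ennreal ((\<Prod>i<m. \<omega> i x) powr Q) = (\<Prod>i<m. ennreal ((\<omega> i x powr q i) powr (Q / q i)))"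
        unfolding u_eq by (rule prod_ennreal[symmetric]) auto
      then have 2: "(\<Prod>i<m. epow (N i x) (p i * (Q / q i))) * ennreal ((\<Prod>i<m. \<omega> i x) powr Q)
         = (\<Prod>i<m. epow (epow (N i x) (p i) * ennreal (\<omega> i x powr q i)) (Q / q i))"
        using Q_pos pq_facts(3,4)
        by (simp only: prod.distrib[symmetric]) (intro prod.cong; auto simp: epow_mult epow_epow)
      have rot: "a * (b * c) = b * (c * a)" for a b c :: ennreal by (simp add: mult_ac)
      from 1 show "ennreal ((\<Prod>i<m. \<omega> i x) powr Q) * epow (mpot m sM f x) Q
         \<le> ennreal (B powr Q * (\<Prod>i<m. E i powr (b i * Q))) * (\<Prod>i<m. epow (epow (N i x) (p i) * ennreal (\<omega> i x powr q i)) (Q / q i))"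
        by (subst (asm) rot) (simp only: 2)
    qed
    also have "\<dots> = ennreal (B powr Q * (\<Prod>i<m. E i powr (b i * Q))) * (\<integral>\<^sup>+x. (\<Prod>i<m. epow (epow (N i x) (p i) * ennreal (\<omega> i x powr q i)) (Q / q i)) \<partial>lborel)"
      by (rule nn_integral_cmult) measurable
    also have "\<dots> \<le> ennreal (B powr Q * (\<Prod>i<m. E i powr (b i * Q))) * (\<Prod>i<m. epow (\<integral>\<^sup>+x. epow (N i x) (p i) * ennreal (\<omega> i x powr q i) \<partial>lborel) (Q / q i))"
      using sum_Q Q_pos pq_facts(4) by (intro mult_left_mono Holder_nn_integral) auto
    also have "\<dots> \<le> ennreal (B powr Q * (\<Prod>i<m. E i powr (b i * Q))) * (\<Prod>i<m. epow (ennreal (K i * E i)) (Q / q i))"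
    proof (intro mult_left_mono prod_mono_ennreal epow_mono)
      fix i assume "i \<in> {..<m}"
      then have i: "i < m" by simp
      show "(\<integral>\<^sup>+x. epow (N i x) (p i) * ennreal (\<omega> i x powr q i) \<partial>lborel) \<le> ennreal (K i * E i)"
        using N1[OF i] E(2)[OF i] E(1)[OF i] K(1)[OF i] by (simp add: ennreal_mult less_imp_le)
      show "0 \<le> Q / q i" using Q_pos pq_facts(4)[OF i] by simp
    qed simp
    also have "(\<Prod>i<m. epow (ennreal (K i * E i)) (Q / q i)) = ennreal (\<Prod>i<m. K i powr (Q / q i) * E i powr (Q / q i))"
      using K(1) E(1) by (subst prod_ennreal[symmetric]) (auto simp: powr_mult less_imp_le intro!: prod.cong)
    also have "ennreal (B powr Q * (\<Prod>i<m. E i powr (b i * Q))) * \<dots> = ennreal (C * (\<Prod>i<m. E i powr (b i * Q) * E i powr (Q / q i)))"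
      by (subst ennreal_mult[symmetric]) (simp_all add: prod_nonneg prod.distrib C_def mult_ac)
    also have "(\<Prod>i<m. E i powr (b i * Q) * E i powr (Q / q i)) = (\<Prod>i<m. E i powr (Q / p i))"
    proof (rule prod.cong[OF refl])
      fix i
      have "b i * Q + Q / q i = Q / p i" by (simp add: b_def algebra_simps)
      then show "E i powr (b i * Q) * E i powr (Q / q i) = E i powr (Q / p i)" by (simp add: powr_add[symmetric])
    qed
    finally show ?thesis .
  qed
  show ?thesis
  proof (rule that[OF C])
    fix f :: "nat \<Rightarrow> 'a \<Rightarrow> real" and E
    assume f: "\<And>i. i < m \<Longrightarrow> f i \<in> borel_measurable borel" and E: "\<And>i. i < m \<Longrightarrow> 0 \<le> E i"
      "\<And>i. i < m \<Longrightarrow> Et i (f i) = ennreal (E i)"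
    show "(\<integral>\<^sup>+x. epow (mpot m sM f x) Q \<partial>mW) \<le> ennreal (C * (\<Prod>i<m. E i powr (Q / p i)))"
    proof (cases "\<exists>j<m. E j = 0")
      case True
      then obtain j where "j < m" "Et j (f j) = 0" using E(2) by auto
      from mpot_zero[of f, OF f this] show ?thesis by simp
    next
      case False
      then have "0 < E i" if "i < m" for i using E(1)[OF that] that by (metis order_le_less)
      with main[OF f _ E(2)] show ?thesis by blast
    qed
  qed
qed

end

section \<open>Individual weight conditions from the joint ones\<close>

text \<open>The essential infimum is encoded as a real supremum, meaningful only for a bounded set
  of lower bounds. If every natural number were almost everywhere a lower bound of a real-valued
  function on \<open>A\<close>, then \<open>A\<close> would be null.\<close>

lemma ess_inf_on_bdd_above:
  fixes f :: "'b \<Rightarrow> real"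
  assumes "\<not> (AE y in M. y \<notin> A)"
  shows "bdd_above {c. AE y in M. y \<in> A \<longrightarrow> c \<le> f y}"
proof (rule ccontr)
  assume n: "\<not> bdd_above {c. AE y in M. y \<in> A \<longrightarrow> c \<le> f y}"
  have "AE y in M. y \<in> A \<longrightarrow> real k \<le> f y" for k :: nat
  proof -
    obtain c where c: "AE y in M. y \<in> A \<longrightarrow> c \<le> f y" "real k < c"
      using n by (auto simp: bdd_above_def not_le)
    from c(1) show ?thesis by eventually_elim (use c(2) in auto)
  qed
  then have "AE y in M. \<forall>k::nat. y \<in> A \<longrightarrow> real k \<le> f y"
    by (subst AE_all_countable) auto
  then have "AE y in M. y \<notin> A"
  proof eventually_elim
    case (elim y)
    obtain k :: nat where "f y < real k" using reals_Archimedean2 by blast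
    with elim show ?case by (meson not_le)
  qed
  with assms show False by simp
qed

lemma le_ess_inf_on:
  assumes "\<not> (AE y in M. y \<notin> A)" "AE y in M. y \<in> A \<longrightarrow> c \<le> f y"
  shows "c \<le> ess_inf_on M A f"
  unfolding ess_inf_on_def using assms by (intro cSup_upper ess_inf_on_bdd_above) auto

text \<open>The supremum is approached within \<open>1 / (k + 1)\<close> by lower bounds, and
  countably many null sets are united. Nonnegativity of \<open>f\<close> puts zero among the lower
  bounds.\<close>

lemma ess_inf_on_le_AE:
  assumes "\<And>y. 0 \<le> f y"
  shows "AE y in M. y \<in> A \<longrightarrow> ess_inf_on M A f \<le> f y"
proof -
  let ?S = "{c. AE y in M. y \<in> A \<longrightarrow> c \<le> f y}"
  have ne: "0 \<in> ?S" using assms by simp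
  show ?thesis
  proof (cases "AE y in M. y \<notin> A")
    case True
    then show ?thesis by eventually_elim auto
  next
    case False
    have "AE y in M. y \<in> A \<longrightarrow> Sup ?S - 1 / real (Suc k) \<le> f y" for k
    proof -
      have "Sup ?S - 1 / real (Suc k) < Sup ?S" by simp
      then obtain c where c: "c \<in> ?S" "Sup ?S - 1 / real (Suc k) < c"
        using less_cSup_iff[OF _ ess_inf_on_bdd_above[OF False, of f]] ne by blast
      from c(1) have "AE y in M. y \<in> A \<longrightarrow> c \<le> f y" by simp
      then show ?thesis by eventually_elim (use c(2) in linarith)
    qed
    then have "AE y in M. \<forall>k. y \<in> A \<longrightarrow> Sup ?S - 1 / real (Suc k) \<le> f y"
      by (subst AE_all_countable) auto
    then show ?thesis
    proof eventually_elim
      case (elim y)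
      show ?case
      proof
        assume "y \<in> A"
        show "ess_inf_on M A f \<le> f y"
        proof (rule field_le_epsilon)
          fix e :: real assume "0 < e"
          then obtain k where "inverse (real (Suc k)) < e" using reals_Archimedean by blast
          moreover have "Sup ?S - 1 / real (Suc k) \<le> f y" using elim \<open>y \<in> A\<close> by blast
          ultimately show "ess_inf_on M A f \<le> f y + e"
            unfolding ess_inf_on_def by (simp add: inverse_eq_divide)
        qed
      qed
    qed
  qed
qed

lemma not_AE_not_ball: "0 < r \<Longrightarrow> \<not> (AE y in lborel. y \<notin> ball (x::'a::euclidean_space) r)"
proof
  assume r: "0 < r" and "AE y in lborel. y \<notin> ball x r"
  then have "emeasure lborel (ball x r) = 0"
    by (simp add: AE_iff_measurable[OF _ refl] ball_def)
  then show False
    using r content_ball_pos[of r x] by (simp add: measure_def)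
qed

section \<open>Muckenhoupt weights and the reverse product inequality\<close>

lemma bavg_eq:
  "0 < r \<Longrightarrow> bavg g (x::'a::euclidean_space) r = wball g x r / (bvol TYPE('a) * r powr real DIM('a))"
  by (simp add: bavg_def wball_def content_ball_powr)

lemma A_inf_weight: "A_inf w \<Longrightarrow> weight w"
  by (auto simp: A_inf_def Ap_weight_def)

text \<open>The exponent can be taken above one: if \<open>p = 1\<close>, the essential infimum
  bounds the reciprocal of the weight, which puts the weight into the class with exponent 2.
  Averages are turned into integrals for later use in Holder.\<close>

lemma A_inf_Ap:
  fixes w :: "'a::euclidean_space \<Rightarrow> real"
  assumes "A_inf w"
  obtains s C where "1 < s" "0 < C"
    "\<And>x r. 0 < r \<Longrightarrow> set_integrable lborel (ball x r) (\<lambda>y. w y powr (- 1 / (s - 1)))"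
    "\<And>x r. 0 < r \<Longrightarrow> wball w x r * wball (\<lambda>y. w y powr (- 1 / (s - 1))) x r powr (s - 1)
        \<le> C * (bvol TYPE('a) * r powr real DIM('a)) powr s"
proof -
  have wt: "weight w" by (rule A_inf_weight) fact
  then have [measurable]: "w \<in> borel_measurable borel" and w0: "\<And>y. 0 \<le> w y" and wp: "AE y in lborel. 0 < w y"
    and wi: "\<And>x r. set_integrable lborel (ball x r) w"
    by (auto simp: weight_def)
  have conv: "wball w x r * S powr (s - 1) \<le> C * (bvol TYPE('a) * r powr real DIM('a)) powr s"
    if "bavg w x r * (S / (bvol TYPE('a) * r powr real DIM('a))) powr (s - 1) \<le> C" "0 < r" "0 \<le> S" for x r s S C
  proof -
    let ?B = "bvol TYPE('a) * r powr real DIM('a)"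
    have B: "0 < ?B" using bvol_pos[where 'a='a] that by simp
    have "bavg w x r * (S / ?B) powr (s - 1) = wball w x r * S powr (s - 1) / (?B * ?B powr (s - 1))"
      using that B by (simp add: bavg_eq powr_divide)
    also have "?B * ?B powr (s - 1) = ?B powr s"
      using powr_add[of ?B 1 "s - 1"] B by simp
    finally have e: "bavg w x r * (S / ?B) powr (s - 1) = wball w x r * S powr (s - 1) / ?B powr s" .
    have Bs: "0 < ?B powr s" using bvol_pos[where 'a='a] that by simp
    show ?thesis using that(1) unfolding e pos_divide_le_eq[OF Bs] .
  qed
  obtain p where p: "1 \<le> p" "Ap_weight p w" using assms by (auto simp: A_inf_def)
  then obtain C where C: "\<And>x r. 0 < r \<Longrightarrow> (if p = 1 then bavg w x r \<le> C * ess_inf_on lborel (ball x r) w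
       else set_integrable lborel (ball x r) (\<lambda>y. w y powr (- 1 / (p - 1))) \<and>
            bavg w x r * (bavg (\<lambda>y. w y powr (- 1 / (p - 1))) x r) powr (p - 1) \<le> C)"
    by (auto simp: Ap_weight_def)
  show ?thesis
  proof (cases "p = 1")
    case False
    show ?thesis
    proof (rule that[of p "max C 1"])
      show "1 < p" using p False by simp
      fix x :: 'a and r :: real assume r: "0 < r"
      show "set_integrable lborel (ball x r) (\<lambda>y. w y powr (- 1 / (p - 1)))" using C[OF r] False by simp
      have "bavg w x r * (bavg (\<lambda>y. w y powr (- 1 / (p - 1))) x r) powr (p - 1) \<le> max C 1"
        using C[OF r, of x] False by auto
      then show "wball w x r * wball (\<lambda>y. w y powr (- 1 / (p - 1))) x r powr (p - 1)
        \<le> max C 1 * (bvol TYPE('a) * r powr real DIM('a)) powr p"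
        using r by (intro conv) (auto simp: bavg_eq wball_nonneg)
    qed simp
  next
    case True
    have key: "set_integrable lborel (ball x r) (\<lambda>y. w y powr (- 1))
        \<and> bavg w x r * (wball (\<lambda>y. w y powr (- 1)) x r / (bvol TYPE('a) * r powr real DIM('a))) \<le> max C 1" if r: "0 < r" for x r
    proof -
      define e where "e = ess_inf_on lborel (ball x r) w"
      let ?B = "bvol TYPE('a) * r powr real DIM('a)"
      have B: "0 < ?B" using bvol_pos[where 'a='a] r by simp
      have b: "bavg w x r \<le> C * e" using C[OF r, of x] True by (simp add: e_def)
      have "0 < wball w x r" by (rule wball_pos) (use wi w0 wp r in auto)
      then have "0 < bavg w x r" using r B by (simp add: bavg_eq)
      \<comment> \<open>Positivity of the essential infimum is not built into the condition; it
        follows because the average is positive and at most \<open>C * e\<close>.\<close>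
      then have Ce: "0 < C * e" using b by simp
      have "0 \<le> e" unfolding e_def using w0 by (intro le_ess_inf_on not_AE_not_ball r) auto
      then have e: "0 < e" using Ce by (metis mult_zero_right order_less_irrefl order_le_less)
      have "AE y in lborel. y \<in> ball x r \<longrightarrow> e \<le> w y"
        unfolding e_def using w0 by (rule ess_inf_on_le_AE)
      then have inv: "AE y in lborel. y \<in> ball x r \<longrightarrow> w y powr (- 1) \<le> 1 / e"
        by eventually_elim (use e in \<open>auto simp: powr_minus inverse_eq_divide intro!: divide_left_mono\<close>)
      have le: "(\<integral>\<^sup>+y. ennreal (w y powr (- 1)) * indicator (ball x r) y \<partial>lborel) \<le> ennreal (?B / e)"
      proof -
        have "(\<integral>\<^sup>+y. ennreal (w y powr (- 1)) * indicator (ball x r) y \<partial>lborel) \<le> (\<integral>\<^sup>+y. ennreal (1 / e) * indicator (ball x r) y \<partial>lborel)"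
          using inv by (intro nn_integral_mono_AE) (auto elim!: eventually_mono simp: indicator_def intro!: ennreal_leI)
        also have "\<dots> = ennreal (?B / e)"
          using r B e by (simp add: nn_integral_cmult_indicator emeasure_ball_powr ennreal_mult[symmetric])
        finally show ?thesis .
      qed
      have int: "set_integrable lborel (ball x r) (\<lambda>y. w y powr (- 1))"
        unfolding set_integrable_def
      proof (rule integrableI_nonneg)
        have "(\<integral>\<^sup>+y. ennreal (indicator (ball x r) y *\<^sub>R w y powr (- 1)) \<partial>lborel) = (\<integral>\<^sup>+y. ennreal (w y powr (- 1)) * indicator (ball x r) y \<partial>lborel)"
          by (intro nn_integral_cong) (auto simp: indicator_def)
        also have "\<dots> < \<infinity>" using le by (simp add: le_less_trans)
        finally show "(\<integral>\<^sup>+y. ennreal (indicator (ball x r) y *\<^sub>R w y powr (- 1)) \<partial>lborel) < \<infinity>" .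
      qed auto
      have "ennreal (wball (\<lambda>y. w y powr (- 1)) x r) \<le> ennreal (?B / e)"
        using le int by (subst (asm) nn_integral_ball_eq_wball) auto
      then have "wball (\<lambda>y. w y powr (- 1)) x r \<le> ?B / e"
        using B e by (subst (asm) ennreal_le_iff) auto
      then have "wball (\<lambda>y. w y powr (- 1)) x r / ?B \<le> 1 / e" using B e by (simp add: field_simps)
      then have "bavg w x r * (wball (\<lambda>y. w y powr (- 1)) x r / ?B) \<le> (C * e) * (1 / e)"
        using b Ce B by (intro mult_mono) (auto intro!: divide_nonneg_nonneg wball_nonneg)
      also have "\<dots> = C" using e by simp
      finally show ?thesis using int by simp
    qed
    show ?thesis
    proof (rule that[of 2 "max C 1"])
      fix x :: 'a and r :: real assume r: "0 < r"
      show "set_integrable lborel (ball x r) (\<lambda>y. w y powr (- 1 / (2 - 1)))" using key[OF r] by simp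
      show "wball w x r * wball (\<lambda>y. w y powr (- 1 / (2 - 1))) x r powr (2 - 1)
        \<le> max C 1 * (bvol TYPE('a) * r powr real DIM('a)) powr 2"
        using key[OF r, of x] r bvol_pos[where 'a='a] by (intro conv) (auto simp: wball_nonneg)
    qed auto
  qed
qed

text \<open>Holder is applied to the constant one, written as a product of negative powers of the
  single weights and a positive power of the product weight. The Muckenhoupt condition trades each
  integral of a negative power for the reciprocal of the integral of the weight itself, and moving
  the reciprocals to the other side gives the desired product.\<close>

lemma A_inf_prod_le:
  fixes \<omega> :: "nat \<Rightarrow> 'a::euclidean_space \<Rightarrow> real"
  assumes m: "0 < m" and w0: "\<And>i x. i < m \<Longrightarrow> 0 \<le> \<omega> i x"
    and Ainf: "\<And>i. i < m \<Longrightarrow> A_inf (\<lambda>x. \<omega> i x powr q i)" and q: "\<And>i. i < m \<Longrightarrow> 0 < q i"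
    and wm: "\<And>i. i < m \<Longrightarrow> \<omega> i \<in> borel_measurable borel"
    and Q: "1 / Q = (\<Sum>i<m. 1 / q i)"
    and u_int: "\<And>x r. 0 < r \<Longrightarrow> set_integrable lborel (ball x r) (\<lambda>y. (\<Prod>i<m. \<omega> i y) powr Q)"
  obtains C where "0 < C" "\<And>x t. 0 < t \<Longrightarrow> (\<Prod>i<m. wball (\<lambda>y. \<omega> i y powr q i) x t powr (1 / q i))
        \<le> C * wball (\<lambda>y. (\<Prod>i<m. \<omega> i y) powr Q) x t powr (1 / Q)"
proof -
  note wm [measurable]
  have wpos: "AE y in lborel. \<forall>i\<in>{..<m}. 0 < \<omega> i y"
  proof (subst AE_finite_all)
    show "\<forall>i\<in>{..<m}. AE y in lborel. 0 < \<omega> i y"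
    proof
      fix i assume i: "i \<in> {..<m}"
      have "AE y in lborel. 0 < \<omega> i y powr q i" using A_inf_weight[OF Ainf, of i] i by (auto simp: weight_def)
      then show "AE y in lborel. 0 < \<omega> i y"
        by eventually_elim (use w0[of i] i in \<open>auto simp: order_less_le\<close>)
    qed
  qed simp
  have wi: "set_integrable lborel (ball x r) (\<lambda>y. \<omega> i y powr q i)" if "i < m" for i x r
    using A_inf_weight[OF Ainf[OF that]] by (auto simp: weight_def)
  have Qp: "0 < Q"
  proof -
    have "0 < (\<Sum>i<m. 1 / q i)" using m q by (intro sum_pos) auto
    then show ?thesis using Q by (metis zero_less_divide_1_iff)
  qed
  define \<theta> where "\<theta> i = Q / q i" for i
  have th: "0 < \<theta> i" if "i < m" for i using Qp q[OF that] by (simp add: \<theta>_def)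
  have sumth: "(\<Sum>i<m. \<theta> i) = 1"
  proof -
    have "(\<Sum>i<m. \<theta> i) = Q * (\<Sum>i<m. 1 / q i)" by (simp add: sum_distrib_left \<theta>_def)
    then show ?thesis using Q[symmetric] Qp by simp
  qed
  have "\<forall>i\<in>{..<m}. \<exists>sC. 1 < fst sC \<and> 0 < snd sC \<and>
    (\<forall>x r. 0 < r \<longrightarrow> set_integrable lborel (ball x r) (\<lambda>y. (\<omega> i y powr q i) powr (- 1 / (fst sC - 1)))) \<and>
    (\<forall>x r. 0 < r \<longrightarrow> wball (\<lambda>y. \<omega> i y powr q i) x r * wball (\<lambda>y. (\<omega> i y powr q i) powr (- 1 / (fst sC - 1))) x r powr (fst sC - 1)
        \<le> snd sC * (bvol TYPE('a) * r powr real DIM('a)) powr fst sC)"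
  proof
    fix i assume i: "i \<in> {..<m}"
    obtain s C where "1 < s" "0 < C"
      "\<And>x r. 0 < r \<Longrightarrow> set_integrable lborel (ball x r) (\<lambda>y. (\<omega> i y powr q i) powr (- 1 / (s - 1)))"
      "\<And>x r. 0 < r \<Longrightarrow> wball (\<lambda>y. \<omega> i y powr q i) x r * wball (\<lambda>y. (\<omega> i y powr q i) powr (- 1 / (s - 1))) x r powr (s - 1)
        \<le> C * (bvol TYPE('a) * r powr real DIM('a)) powr s"
      by (rule A_inf_Ap[OF Ainf, of i]) (use i in auto)
    then show "\<exists>sC. 1 < fst sC \<and> 0 < snd sC \<and>
      (\<forall>x r. 0 < r \<longrightarrow> set_integrable lborel (ball x r) (\<lambda>y. (\<omega> i y powr q i) powr (- 1 / (fst sC - 1)))) \<and>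
      (\<forall>x r. 0 < r \<longrightarrow> wball (\<lambda>y. \<omega> i y powr q i) x r * wball (\<lambda>y. (\<omega> i y powr q i) powr (- 1 / (fst sC - 1))) x r powr (fst sC - 1)
        \<le> snd sC * (bvol TYPE('a) * r powr real DIM('a)) powr fst sC)"
      by (intro exI[of _ "(s, C)"]) simp
  qed
  from bchoice[OF this] obtain sC where sC: "\<forall>i\<in>{..<m}. 1 < fst (sC i) \<and> 0 < snd (sC i) \<and>
    (\<forall>x r. 0 < r \<longrightarrow> set_integrable lborel (ball x r) (\<lambda>y. (\<omega> i y powr q i) powr (- 1 / (fst (sC i) - 1)))) \<and>
    (\<forall>x r. 0 < r \<longrightarrow> wball (\<lambda>y. \<omega> i y powr q i) x r * wball (\<lambda>y. (\<omega> i y powr q i) powr (- 1 / (fst (sC i) - 1))) x r powr (fst (sC i) - 1)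
        \<le> snd (sC i) * (bvol TYPE('a) * r powr real DIM('a)) powr fst (sC i))" ..
  define s where "s i = fst (sC i)" for i
  define C where "C i = snd (sC i)" for i
  define g where "g i y = (\<omega> i y powr q i) powr (- 1 / (s i - 1))" for i y
  have s: "1 < s i" and C: "0 < C i" if "i < m" for i using sC that by (auto simp: s_def C_def)
  have gi: "set_integrable lborel (ball x r) (g i)" if "i < m" "0 < r" for i x r
    using sC that unfolding g_def s_def by auto
  have Ap: "wball (\<lambda>y. \<omega> i y powr q i) x r * wball (g i) x r powr (s i - 1) \<le> C i * (bvol TYPE('a) * r powr real DIM('a)) powr s i"
    if "i < m" "0 < r" for i x r
    using sC that unfolding g_def s_def C_def by auto
  have g0: "0 \<le> g i y" for i y by (simp add: g_def)
  have gm [measurable]: "g i \<in> borel_measurable borel" if "i < m" for i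
    unfolding g_def using wm[OF that] by measurable
  \<comment> \<open>The exponents \<open>\<tau> * \<theta> i * (s i - 1)\<close> are forced by
    cancelling each \<open>\<omega> i\<close> against the power \<open>Q * \<tau>\<close> of the
    product weight; \<open>\<tau>\<close> then makes all exponents add up to one. The index
    \<open>m\<close> stands for the product weight.\<close>
  define \<tau> where "\<tau> = 1 / (\<Sum>i<m. \<theta> i * s i)"
  have ss: "0 < (\<Sum>i<m. \<theta> i * s i)" using m th s by (intro sum_pos) (auto intro!: mult_pos_pos dest: s)
  have \<tau>: "0 < \<tau>" using ss by (simp add: \<tau>_def)
  have \<tau>s: "\<tau> * (\<Sum>i<m. \<theta> i * s i) = 1" using ss by (simp add: \<tau>_def)
  define \<tau>i where "\<tau>i i = (if i = m then \<tau> else \<tau> * \<theta> i * (s i - 1))" for i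
  have ti: "0 < \<tau>i i" if "i < Suc m" for i using that \<tau> th[of i] s[of i] by (auto simp: \<tau>i_def)
  have sumt: "(\<Sum>i<Suc m. \<tau>i i) = 1"
  proof -
    have "(\<Sum>i<Suc m. \<tau>i i) = (\<Sum>i<m. \<tau> * (\<theta> i * s i) - \<tau> * \<theta> i) + \<tau>"
      by (simp add: \<tau>i_def algebra_simps)
    also have "\<dots> = 1"
      using \<tau>s sumth by (simp add: sum_subtractf sum_distrib_left[symmetric])
    finally show ?thesis .
  qed
  define K where "K = (\<Prod>i<m. C i powr \<theta> i)"
  have K: "0 < K" unfolding K_def using C by (intro prod_pos) force
  have main: "(\<Prod>i<m. wball (\<lambda>y. \<omega> i y powr q i) x t powr \<theta> i) \<le> K * wball (\<lambda>y. (\<Prod>i<m. \<omega> i y) powr Q) x t"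
    if t: "0 < t" for x t
  proof -
    define B where "B = bvol TYPE('a) * t powr real DIM('a)"
    define W where "W = wball (\<lambda>y. (\<Prod>i<m. \<omega> i y) powr Q) x t"
    define V where "V i = wball (\<lambda>y. \<omega> i y powr q i) x t" for i
    define S where "S i = wball (g i) x t" for i
    have B: "0 < B" using bvol_pos[where 'a='a] t by (simp add: B_def)
    have W0: "0 \<le> W" unfolding W_def by (intro wball_nonneg) auto
    have Vp: "0 < V i" if "i < m" for i
    proof -
      have "AE y in lborel. 0 < \<omega> i y powr q i"
        using A_inf_weight[OF Ainf[OF that]] by (auto simp: weight_def)
      then show ?thesis
        unfolding V_def using that wi[OF that] t by (intro wball_pos) auto
    qed
    have S0: "0 \<le> S i" for i unfolding S_def using g0 by (intro wball_nonneg) auto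
    define F where "F i y = (if i = m then ennreal ((\<Prod>i<m. \<omega> i y) powr Q) else ennreal (g i y)) * indicator (ball x t) y" for i y
    have "ennreal B = (\<integral>\<^sup>+y. indicator (ball x t) y \<partial>lborel)"
      using t by (simp add: emeasure_ball_powr B_def)
    also have "\<dots> = (\<integral>\<^sup>+y. (\<Prod>i<Suc m. epow (F i y) (\<tau>i i)) \<partial>lborel)"
    proof (rule nn_integral_cong_AE)
      show "AE y in lborel. indicator (ball x t) y = (\<Prod>i<Suc m. epow (F i y) (\<tau>i i))"
        using wpos
      proof eventually_elim
        case (elim y)
        show ?case
        proof (cases "y \<in> ball x t")
          case True
          have u: "0 < (\<Prod>i<m. \<omega> i y)" using elim by (intro prod_pos) auto
          have "g i y powr \<tau>i i = \<omega> i y powr (- (Q * \<tau>))" if "i < m" for i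
          proof -
            have "q i * (- 1 / (s i - 1)) * (\<tau> * \<theta> i * (s i - 1)) = - (Q * \<tau>)"
              using s[OF that] q[OF that] by (simp add: \<theta>_def field_simps)
            then show ?thesis using that unfolding g_def \<tau>i_def by (simp only: powr_powr) simp
          qed
          then have "(\<Prod>i<m. g i y powr \<tau>i i) = (\<Prod>i<m. \<omega> i y) powr (- (Q * \<tau>))"
            using elim by (subst prod_powr_distrib) (auto simp: less_imp_le)
          moreover have "\<forall>a\<in>{..<m}. \<omega> a y \<noteq> 0" using elim by force
          ultimately have pr: "(\<Prod>i<m. g i y powr \<tau>i i) * ((\<Prod>i<m. \<omega> i y) powr Q) powr \<tau>i m = 1"
            by (simp add: \<tau>i_def powr_powr powr_add[symmetric])
          have "(\<Prod>i<Suc m. epow (F i y) (\<tau>i i)) = (\<Prod>i<m. ennreal (g i y powr \<tau>i i)) * ennreal (((\<Prod>i<m. \<omega> i y) powr Q) powr \<tau>i m)"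
            using True g0 by (simp add: F_def)
          also have "\<dots> = ennreal ((\<Prod>i<m. g i y powr \<tau>i i) * ((\<Prod>i<m. \<omega> i y) powr Q) powr \<tau>i m)"
            by (simp add: prod_ennreal ennreal_mult prod_nonneg)
          finally show ?thesis using True pr by simp
        next
          case False
          then show ?thesis by (simp add: F_def)
        qed
      qed
    qed
    also have "\<dots> \<le> (\<Prod>i<Suc m. epow (\<integral>\<^sup>+y. F i y \<partial>lborel) (\<tau>i i))"
    proof (rule Holder_nn_integral)
      show "F i \<in> borel_measurable lborel" if "i \<in> {..<Suc m}" for i
        using that gm[of i] by (cases "i = m") (auto simp: F_def[abs_def])
    qed (use ti sumt in auto)
    also have "\<dots> = (\<Prod>i<m. epow (ennreal (S i)) (\<tau>i i)) * epow (ennreal W) \<tau>"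
    proof -
      have "(\<integral>\<^sup>+y. F i y \<partial>lborel) = ennreal (S i)" if "i < m" for i
        using that gi[OF that t] g0 unfolding F_def S_def by (simp add: nn_integral_ball_eq_wball)
      moreover have "(\<integral>\<^sup>+y. F m y \<partial>lborel) = ennreal W"
        unfolding F_def W_def using u_int[OF t] by (simp add: nn_integral_ball_eq_wball)
      moreover have "\<tau>i m = \<tau>" by (simp add: \<tau>i_def)
      ultimately show ?thesis by simp
    qed
    also have "\<dots> = ennreal ((\<Prod>i<m. S i powr \<tau>i i) * W powr \<tau>)"
      using S0 W0 by (simp add: prod_ennreal ennreal_mult prod_nonneg)
    finally have "B \<le> (\<Prod>i<m. S i powr \<tau>i i) * W powr \<tau>"
      by (subst (asm) ennreal_le_iff) (auto intro!: mult_nonneg_nonneg prod_nonneg)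
    also have "\<dots> \<le> (\<Prod>i<m. (C i powr \<theta> i) powr \<tau> * B powr (\<tau> * (\<theta> i * s i)) * (V i powr \<theta> i) powr (- \<tau>)) * W powr \<tau>"
    proof (intro mult_right_mono prod_mono conjI)
      fix i assume "i \<in> {..<m}"
      then have i: "i < m" by simp
      have "S i powr (s i - 1) \<le> C i * B powr s i / V i"
        using Ap[OF i t, of x] Vp[OF i] unfolding V_def[symmetric] S_def[symmetric] B_def[symmetric] by (simp add: field_simps)
      then have "(S i powr (s i - 1)) powr (\<tau> * \<theta> i) \<le> (C i * B powr s i / V i) powr (\<tau> * \<theta> i)"
        using \<tau> th[OF i] by (intro powr_mono2) auto
      also have "\<dots> = (C i powr \<theta> i) powr \<tau> * B powr (\<tau> * (\<theta> i * s i)) * (V i powr \<theta> i) powr (- \<tau>)"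
        using C[OF i] B Vp[OF i] by (simp add: powr_mult powr_divide powr_powr powr_minus field_simps)
      also have "(S i powr (s i - 1)) powr (\<tau> * \<theta> i) = S i powr \<tau>i i"
        using i by (simp add: powr_powr \<tau>i_def mult_ac)
      finally show "S i powr \<tau>i i \<le> (C i powr \<theta> i) powr \<tau> * B powr (\<tau> * (\<theta> i * s i)) * (V i powr \<theta> i) powr (- \<tau>)" .
    qed auto
    also have "\<dots> = K powr \<tau> * (\<Prod>i<m. B powr (\<tau> * (\<theta> i * s i))) * (\<Prod>i<m. V i powr \<theta> i) powr (- \<tau>) * W powr \<tau>"
    proof -
      have "K powr \<tau> = (\<Prod>i<m. (C i powr \<theta> i) powr \<tau>)" unfolding K_def by (rule prod_powr_distrib)
      moreover have "(\<Prod>i<m. V i powr \<theta> i) powr (- \<tau>) = (\<Prod>i<m. (V i powr \<theta> i) powr (- \<tau>))" by (rule prod_powr_distrib)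
      ultimately show ?thesis by (simp add: prod.distrib)
    qed
    \<comment> \<open>By the choice of \<open>\<tau>\<close> the powers of the volume multiply to
      its first power, which cancels against the left side.\<close>
    also have "(\<Prod>i<m. B powr (\<tau> * (\<theta> i * s i))) = B"
      using \<tau>s B by (simp add: powr_sum[symmetric] sum_distrib_left[symmetric])
    finally have "B * 1 \<le> B * (K powr \<tau> * (\<Prod>i<m. V i powr \<theta> i) powr (- \<tau>) * W powr \<tau>)"
      by (simp add: mult_ac)
    then have "1 \<le> K powr \<tau> * (\<Prod>i<m. V i powr \<theta> i) powr (- \<tau>) * W powr \<tau>"
      using B by (simp only: mult_le_cancel_left_pos)
    moreover have PV: "0 < (\<Prod>i<m. V i powr \<theta> i)" using Vp by (intro prod_pos) force
    moreover have "z powr \<tau> \<le> a * b" if "1 \<le> a * z powr (- \<tau>) * b" "0 < z" for a b z :: real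
      using that by (simp add: powr_minus field_simps)
    ultimately have "(\<Prod>i<m. V i powr \<theta> i) powr \<tau> \<le> K powr \<tau> * W powr \<tau>"
      by blast
    also have "\<dots> = (K * W) powr \<tau>" by (simp add: powr_mult)
    finally have le: "(\<Prod>i<m. V i powr \<theta> i) powr \<tau> \<le> (K * W) powr \<tau>" .
    have "((\<Prod>i<m. V i powr \<theta> i) powr \<tau>) powr (1 / \<tau>) \<le> ((K * W) powr \<tau>) powr (1 / \<tau>)"
      by (rule powr_mono2[OF _ powr_ge_zero le]) (use \<tau> in simp)
    then show ?thesis
      using \<tau> less_imp_le[OF PV] K W0 unfolding V_def[symmetric] W_def[symmetric] by (simp add: powr_powr)
  qed
  show ?thesis
  proof (rule that[of "K powr (1 / Q)"])
    show "0 < K powr (1 / Q)" using K by simp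
    fix x :: 'a and t :: real assume t: "0 < t"
    have "(\<Prod>i<m. wball (\<lambda>y. \<omega> i y powr q i) x t powr (1 / q i)) = (\<Prod>i<m. wball (\<lambda>y. \<omega> i y powr q i) x t powr \<theta> i) powr (1 / Q)"
      using Qp by (subst prod_powr_distrib) (auto simp: powr_powr \<theta>_def)
    also have "\<dots> \<le> (K * wball (\<lambda>y. (\<Prod>i<m. \<omega> i y) powr Q) x t) powr (1 / Q)"
      using main[OF t] Qp by (intro powr_mono2) (auto intro!: prod_nonneg)
    also have "\<dots> = K powr (1 / Q) * wball (\<lambda>y. (\<Prod>i<m. \<omega> i y) powr Q) x t powr (1 / Q)"
      by (simp add: powr_mult)
    finally show "(\<Prod>i<m. wball (\<lambda>y. \<omega> i y powr q i) x t powr (1 / q i))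
      \<le> K powr (1 / Q) * wball (\<lambda>y. (\<Prod>i<m. \<omega> i y) powr Q) x t powr (1 / Q)" .
  qed
qed

text \<open>For \<open>p > 1\<close> this is Holder on the ball against the dual weight. For
  \<open>p = 1\<close> the weight is at least its essential infimum on the ball, whose reciprocal
  takes the place of the dual norm.\<close>

lemma apq_weight_of_bound:
  fixes w :: "'a::euclidean_space \<Rightarrow> real"
  assumes p: "1 \<le> p" "p < q" and K: "0 < K"
    and w [measurable]: "w \<in> borel_measurable borel" "\<And>y. 0 \<le> w y" "AE y in lborel. 0 < w y"
    and wi: "\<And>x r. set_integrable lborel (ball x r) (\<lambda>y. w y powr q)"
    and si: "\<And>x r. 1 < p \<Longrightarrow> 0 < r \<Longrightarrow> set_integrable lborel (ball x r) (\<lambda>y. w y powr (- (p / (p - 1))))"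
    and sb: "\<And>x t. 1 < p \<Longrightarrow> 0 < t \<Longrightarrow> wball (\<lambda>y. w y powr q) x t powr (1 / q)
       * wball (\<lambda>y. w y powr (- (p / (p - 1)))) x t powr ((p - 1) / p)
       \<le> K * (bvol TYPE('a) * t powr real DIM('a)) powr ((p - 1) / p + 1 / q)"
    and e0: "\<And>x t. p = 1 \<Longrightarrow> 0 < t \<Longrightarrow> 0 < ess_inf_on lborel (ball x t) w"
    and eb: "\<And>x t. p = 1 \<Longrightarrow> 0 < t \<Longrightarrow> wball (\<lambda>y. w y powr q) x t powr (1 / q) / ess_inf_on lborel (ball x t) w
       \<le> K * (bvol TYPE('a) * t powr real DIM('a)) powr (1 / q)"
  shows "apq_weight p q (K * bvol TYPE('a) powr ((p - 1) / p + 1 / q)) w" (is "apq_weight p q ?H w")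
proof -
  have H: "0 < ?H" using K bvol_pos[where 'a='a] by simp
  have ex: "(p - 1) / p + 1 / q = 1 - 1 / p + 1 / q" using p by (simp add: diff_divide_distrib)
  have Bp: "K * (bvol TYPE('a) * t powr real DIM('a)) powr ((p - 1) / p + 1 / q) = ?H * t powr (real DIM('a) * (1 - 1/p + 1/q))" for t
    by (simp add: powr_mult powr_powr ex)
  have hol: "(\<integral>\<^sup>+y. h y * indicator (ball x t) y \<partial>lborel)
        \<le> ennreal (?H * t powr (real DIM('a) * (1 - 1/p + 1/q)) * wball (\<lambda>y. w y powr q) x t powr (- 1/q))
          * epow (\<integral>\<^sup>+y. epow (h y) p * ennreal (w y powr p) * indicator (ball x t) y \<partial>lborel) (1/p)"
    if h [measurable]: "h \<in> borel_measurable borel" and t: "0 < t" for h x t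
  proof -
    let ?E = "\<integral>\<^sup>+y. epow (h y) p * ennreal (w y powr p) * indicator (ball x t) y \<partial>lborel"
    define V where "V = wball (\<lambda>y. w y powr q) x t"
    have V: "0 < V" unfolding V_def using w wi t by (intro wball_pos) (auto elim!: eventually_mono)
    show ?thesis
    proof (cases "p = 1")
      case False
      then have p1: "1 < p" using p by simp
      define S where "S = wball (\<lambda>y. w y powr (- (p / (p - 1)))) x t"
      have S0: "0 \<le> S" unfolding S_def by (rule wball_nonneg) auto
      have "(\<integral>\<^sup>+y. h y * indicator (ball x t) y \<partial>lborel) =
        (\<integral>\<^sup>+y. epow (epow (h y) p * ennreal (w y powr p) * indicator (ball x t) y) (1/p)
           * epow (ennreal (w y powr (- (p / (p - 1)))) * indicator (ball x t) y) ((p - 1) / p) \<partial>lborel)"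
      proof (rule nn_integral_cong_AE)
        show "AE y in lborel. h y * indicator (ball x t) y = epow (epow (h y) p * ennreal (w y powr p) * indicator (ball x t) y) (1/p)
           * epow (ennreal (w y powr (- (p / (p - 1)))) * indicator (ball x t) y) ((p - 1) / p)"
          using w(3)
        proof eventually_elim
          case (elim y)
          have e: "p * (1 / p) = 1" "- (p / (p - 1)) * ((p - 1) / p) = - 1" using p1 by auto
          have "ennreal ((w y powr p) powr (1/p)) * ennreal ((w y powr (- (p / (p - 1)))) powr ((p - 1) / p)) = 1"
            unfolding powr_powr e using elim by (simp add: ennreal_mult[symmetric] powr_minus)
          then show ?case
            using p1 by (cases "y \<in> ball x t") (auto simp: epow_mult epow_epow mult.assoc)
        qed
      qed
      also have "\<dots> \<le> epow ?E (1/p) * epow (\<integral>\<^sup>+y. ennreal (w y powr (- (p / (p - 1)))) * indicator (ball x t) y \<partial>lborel) ((p - 1) / p)"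
        using p1 by (intro Holder_nn_integral2) (auto simp: field_simps)
      also have "(\<integral>\<^sup>+y. ennreal (w y powr (- (p / (p - 1)))) * indicator (ball x t) y \<partial>lborel) = ennreal S"
        unfolding S_def by (intro nn_integral_ball_eq_wball si p1 t) auto
      also have "epow (ennreal S) ((p - 1) / p) = ennreal (S powr ((p - 1) / p))" using S0 by simp
      finally have le: "(\<integral>\<^sup>+y. h y * indicator (ball x t) y \<partial>lborel) \<le> epow ?E (1/p) * ennreal (S powr ((p - 1) / p))" .
      have "S powr ((p - 1) / p) \<le> ?H * t powr (real DIM('a) * (1 - 1/p + 1/q)) * V powr (- 1/q)"
        using sb[OF p1 t, of x] V unfolding V_def[symmetric] S_def[symmetric] Bp by (simp add: powr_minus field_simps)
      then have "epow ?E (1/p) * ennreal (S powr ((p - 1) / p)) \<le> epow ?E (1/p) * ennreal (?H * t powr (real DIM('a) * (1 - 1/p + 1/q)) * V powr (- 1/q))"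
        by (intro mult_left_mono ennreal_leI) auto
      with le show ?thesis
        unfolding V_def by (subst mult.commute) (rule order_trans)
    next
      case True
      define e where "e = ess_inf_on lborel (ball x t) w"
      have e: "0 < e" unfolding e_def by (rule e0[OF True t])
      have "AE y in lborel. y \<in> ball x t \<longrightarrow> e \<le> w y" unfolding e_def by (rule ess_inf_on_le_AE) fact
      then have "(\<integral>\<^sup>+y. h y * indicator (ball x t) y \<partial>lborel) \<le> (\<integral>\<^sup>+y. ennreal (1 / e) * (h y * ennreal (w y) * indicator (ball x t) y) \<partial>lborel)"
      proof (intro nn_integral_mono_AE, eventually_elim)
        case (elim y)
        show ?case
        proof (cases "y \<in> ball x t")
          case True
          have "1 \<le> 1 / e * w y" using elim True e by (simp add: field_simps)
          then have "ennreal 1 \<le> ennreal (1 / e * w y)" by (rule ennreal_leI)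
          also have "\<dots> = ennreal (1 / e) * ennreal (w y)" using e w(2) by (intro ennreal_mult) auto
          finally have "h y * 1 \<le> h y * (ennreal (1 / e) * ennreal (w y))" by (intro mult_left_mono) auto
          then show ?thesis using True by (simp add: mult_ac)
        qed simp
      qed
      also have "\<dots> = ennreal (1 / e) * (\<integral>\<^sup>+y. h y * ennreal (w y) * indicator (ball x t) y \<partial>lborel)"
        by (rule nn_integral_cmult) measurable
      also have "(\<integral>\<^sup>+y. h y * ennreal (w y) * indicator (ball x t) y \<partial>lborel) = epow ?E (1/p)"
        using True w(2) by simp
      also have "1 / e \<le> ?H * t powr (real DIM('a) * (1 - 1/p + 1/q)) * V powr (- 1/q)"
      proof -
        have "V powr (1/q) / e \<le> K * (bvol TYPE('a) * t powr real DIM('a)) powr ((p - 1) / p + 1 / q)"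
          using eb[OF True t, of x] True unfolding V_def e_def by simp
        then have "V powr (1/q) * (1 / e) \<le> ?H * t powr (real DIM('a) * (1 - 1/p + 1/q))" unfolding Bp by simp
        then show ?thesis using V by (simp add: powr_minus field_simps)
      qed
      finally show ?thesis
        unfolding V_def by (simp add: ennreal_leI mult_right_mono)
    qed
  qed
  show ?thesis
    by (unfold_locales; (fact p H w wi hol)?)
qed

text \<open>Raising the weight condition to the conjugate exponent isolates the dual
  measure.\<close>

lemma apq_weight_strong_of_bound:
  fixes w :: "'a::euclidean_space \<Rightarrow> real"
  assumes apq: "apq_weight p q H w" and p: "1 < p" and K: "0 < K"
    and si: "\<And>x r. 0 < r \<Longrightarrow> set_integrable lborel (ball x r) (\<lambda>y. w y powr (- (p / (p - 1))))"
    and sb: "\<And>x t. 0 < t \<Longrightarrow> wball (\<lambda>y. w y powr q) x t powr (1 / q)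
       * wball (\<lambda>y. w y powr (- (p / (p - 1)))) x t powr ((p - 1) / p)
       \<le> K * (bvol TYPE('a) * t powr real DIM('a)) powr ((p - 1) / p + 1 / q)"
  shows "apq_weight_strong p q H w ((K * bvol TYPE('a) powr ((p - 1) / p + 1 / q)) powr (p / (p - 1)))"
proof -
  interpret apq_weight p q H w by (rule apq)
  let ?c = "p / (p - 1)" and ?k = "K * bvol TYPE('a) powr ((p - 1) / p + 1 / q)"
  show ?thesis
  proof
    show "1 < p" by fact
    show "0 < ?k powr ?c" using K bvol_pos[where 'a='a] by simp
    show "set_integrable lborel (ball x r) (\<lambda>y. w y powr (- ?c))" for x r
      using si[of r x] by (cases "0 < r") (auto simp: set_integrable_def ball_empty)
    show "wball (\<lambda>y. w y powr (- ?c)) x t \<le> ?k powr ?c * t powr (real DIM('a) * (1 + ?c / q)) * V x t powr (- (?c / q))"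
      if t: "0 < t" for x t
    proof -
      define S where "S = wball (\<lambda>y. w y powr (- ?c)) x t"
      have S0: "0 \<le> S" unfolding S_def by (rule wball_nonneg) auto
      have Vt: "0 < V x t" by (rule V_pos) fact
      have c: "(p - 1) / p * ?c = 1" "0 < ?c" using p by auto
      have "V x t powr (1 / q) * S powr ((p - 1) / p) \<le> ?k * t powr (real DIM('a) * ((p - 1) / p + 1 / q))"
        using sb[OF t, of x] unfolding V_def[symmetric] S_def[symmetric] by (simp add: powr_mult powr_powr)
      then have "S powr ((p - 1) / p) \<le> ?k * t powr (real DIM('a) * ((p - 1) / p + 1 / q)) * V x t powr (- (1 / q))"
        using Vt by (simp add: powr_minus field_simps)
      then have "(S powr ((p - 1) / p)) powr ?c \<le> (?k * t powr (real DIM('a) * ((p - 1) / p + 1 / q)) * V x t powr (- (1 / q))) powr ?c"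
        using c by (intro powr_mono2) auto
      also have "\<dots> = ?k powr ?c * t powr (real DIM('a) * ((p - 1) / p + 1 / q) * ?c) * V x t powr (- (1 / q) * ?c)"
        unfolding powr_mult[of ?k] powr_mult[of "?k * _"] powr_powr ..
      also have "real DIM('a) * ((p - 1) / p + 1 / q) * ?c = real DIM('a) * (1 + ?c / q)"
      proof -
        have "((p - 1) / p + 1 / q) * ?c = 1 + ?c / q" using c by (simp only: distrib_right) simp
        then show ?thesis by (simp only: mult.assoc)
      qed
      also have "- (1 / q) * ?c = - (?c / q)" by simp
      also have "(S powr ((p - 1) / p)) powr ?c = S"
        using S0 by (simp only: powr_powr c) simp
      finally show ?thesis unfolding S_def .
    qed
  qed
qed

text \<open>The normalised quantities \<open>X i x t\<close> are all at least one while their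
  product is bounded, so none can be large. The product is bounded because the reverse product
  inequality replaces the averages of the \<open>\<omega> i powr q i\<close> by the average of the
  product weight, which the joint condition controls.\<close>

lemma multi_weight_of_APq:
  fixes \<omega> :: "nat \<Rightarrow> 'a::euclidean_space \<Rightarrow> real"
  assumes m: "0 < m" and p: "\<And>i. i < m \<Longrightarrow> 1 \<le> p i" and pq: "\<And>i. i < m \<Longrightarrow> p i < q i"
    and Q: "1 / Q = (\<Sum>i<m. 1 / q i)" and A: "APq m p Q \<omega>"
    and w0: "\<And>i x. i < m \<Longrightarrow> 0 \<le> \<omega> i x" and Ainf: "\<And>i. i < m \<Longrightarrow> A_inf (\<lambda>x. \<omega> i x powr q i)"
  obtains H H2 :: "nat \<Rightarrow> real" and CQ where "multi_weight m p q H \<omega> Q CQ"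
    "\<And>i. i < m \<Longrightarrow> 1 < p i \<Longrightarrow> apq_weight_strong (p i) (q i) (H i) (\<omega> i) (H2 i)"
proof -
  have q0: "0 < q i" if "i < m" for i using p[OF that] pq[OF that] by simp
  have wm [measurable]: "\<omega> i \<in> borel_measurable borel" if i: "i < m" for i
  proof -
    have "(\<lambda>x. \<omega> i x powr q i) \<in> borel_measurable borel" using A_inf_weight[OF Ainf[OF i]] by (simp add: weight_def)
    \<comment> \<open>Measurability is given for \<open>\<omega> i powr q i\<close> and recovered by
      taking the root of a nonnegative function.\<close>
    then have "(\<lambda>x. (\<omega> i x powr q i) powr (1 / q i)) \<in> borel_measurable borel" by measurable
    then show ?thesis using q0[OF i] w0[OF i] by (simp add: powr_powr)
  qed
  have wpos: "AE y in lborel. 0 < \<omega> i y" if i: "i < m" for i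
  proof -
    have "AE y in lborel. 0 < \<omega> i y powr q i" using A_inf_weight[OF Ainf[OF i]] by (auto simp: weight_def)
    then show ?thesis by eventually_elim (use w0[OF i] in \<open>auto simp: order_less_le\<close>)
  qed
  have wi: "set_integrable lborel (ball x r) (\<lambda>y. \<omega> i y powr q i)" if "i < m" for i x r
    using A_inf_weight[OF Ainf[OF that]] by (auto simp: weight_def)
  obtain C0 where C0: "\<And>x r. 0 < r \<Longrightarrow>
     set_integrable lborel (ball x r) (\<lambda>y. (\<Prod>i<m. \<omega> i y) powr Q) \<and>
     (\<forall>i<m. 1 < p i \<longrightarrow>
        set_integrable lborel (ball x r) (\<lambda>y. \<omega> i y powr (- (p i / (p i - 1))))) \<and>
     (\<forall>i<m. p i = 1 \<longrightarrow> 0 < ess_inf_on lborel (ball x r) (\<omega> i)) \<and>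
     (bavg (\<lambda>y. (\<Prod>i<m. \<omega> i y) powr Q) x r) powr (1 / Q) *
       (\<Prod>i<m. if p i = 1 then 1 / ess_inf_on lborel (ball x r) (\<omega> i)
               else (bavg (\<lambda>y. \<omega> i y powr (- (p i / (p i - 1)))) x r) powr ((p i - 1) / p i))
       \<le> C0"
    using A unfolding APq_def by blast
  have u_int: "set_integrable lborel (ball x r) (\<lambda>y. (\<Prod>i<m. \<omega> i y) powr Q)" for x r
    using C0[of r x] by (cases "0 < r") (auto simp: set_integrable_def ball_empty)
  have si: "set_integrable lborel (ball x r) (\<lambda>y. \<omega> i y powr (- (p i / (p i - 1))))" if "i < m" "1 < p i" "0 < r" for i x r
    using C0[OF that(3)] that by blast
  have ep: "0 < ess_inf_on lborel (ball x r) (\<omega> i)" if "i < m" "p i = 1" "0 < r" for i x r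
    using C0[OF that(3)] that by blast
  obtain CQ where CQ: "0 < CQ" "\<And>x t. 0 < t \<Longrightarrow> (\<Prod>i<m. wball (\<lambda>y. \<omega> i y powr q i) x t powr (1 / q i))
        \<le> CQ * wball (\<lambda>y. (\<Prod>i<m. \<omega> i y) powr Q) x t powr (1 / Q)"
    using A_inf_prod_le[OF m w0 Ainf q0 wm Q u_int] by blast
  define K where "K = max 1 (CQ * C0)"
  have K: "0 < K" by (simp add: K_def)
  define Sx where "Sx i x t = (if p i = 1 then 1 / ess_inf_on lborel (ball x t) (\<omega> i)
               else (bavg (\<lambda>y. \<omega> i y powr (- (p i / (p i - 1)))) x t) powr ((p i - 1) / p i))" for i x t
  define X where "X i x t = bavg (\<lambda>y. \<omega> i y powr q i) x t powr (1 / q i) * Sx i x t" for i x t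
  define B where "B t = bvol TYPE('a) * t powr real DIM('a)" for t
  have B: "0 < B t" if "0 < t" for t using bvol_pos[where 'a='a] that by (simp add: B_def)
  have bav: "bavg g x t = wball g x t / B t" if "0 < t" for g and x :: 'a and t
    using bavg_eq[OF that] by (simp add: B_def)
  have X1: "1 \<le> X i x t" if i: "i < m" and t: "0 < t" for i x t
  proof (cases "p i = 1")
    case False
    then have p1: "1 < p i" using p[OF i] by simp
    have "B t powr ((p i - 1) / p i + 1 / q i) \<le> wball (\<lambda>y. \<omega> i y powr q i) x t powr (1 / q i) *
        wball (\<lambda>y. \<omega> i y powr (- (p i / (p i - 1)))) x t powr ((p i - 1) / p i)"
      unfolding B_def by (rule Holder_weight_lower[OF p1 pq[OF i] t wm[OF i] w0[OF i] wpos[OF i] wi[OF i] si[OF i p1 t]])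
    moreover have "X i x t = wball (\<lambda>y. \<omega> i y powr q i) x t powr (1 / q i) *
        wball (\<lambda>y. \<omega> i y powr (- (p i / (p i - 1)))) x t powr ((p i - 1) / p i) / B t powr ((p i - 1) / p i + 1 / q i)"
      unfolding X_def Sx_def bav[OF t] using False by (simp add: powr_divide powr_add)
    ultimately show ?thesis using B[OF t] by simp
  next
    case True
    define e where "e = ess_inf_on lborel (ball x t) (\<omega> i)"
    have e: "0 < e" unfolding e_def by (rule ep[OF i True t])
    have "AE y in lborel. y \<in> ball x t \<longrightarrow> e \<le> \<omega> i y" unfolding e_def by (rule ess_inf_on_le_AE) (rule w0[OF i])
    then have "(\<integral>\<^sup>+y. ennreal (e powr q i) * indicator (ball x t) y \<partial>lborel) \<le> (\<integral>\<^sup>+y. ennreal (\<omega> i y powr q i) * indicator (ball x t) y \<partial>lborel)"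
    proof (intro nn_integral_mono_AE, eventually_elim)
      case (elim y)
      then show ?case using e q0[OF i] by (auto simp: indicator_def intro!: ennreal_leI powr_mono2)
    qed
    also have "\<dots> = ennreal (wball (\<lambda>y. \<omega> i y powr q i) x t)"
      by (intro nn_integral_ball_eq_wball wi i) auto
    also have "(\<integral>\<^sup>+y. ennreal (e powr q i) * indicator (ball x t) y \<partial>lborel) = ennreal (e powr q i * B t)"
      using t B[OF t] by (simp add: nn_integral_cmult_indicator emeasure_ball_powr ennreal_mult B_def)
    finally have "e powr q i * B t \<le> wball (\<lambda>y. \<omega> i y powr q i) x t"
      by (subst (asm) ennreal_le_iff) (auto intro!: wball_nonneg)
    then have "e powr q i \<le> bavg (\<lambda>y. \<omega> i y powr q i) x t" using B[OF t] by (simp add: bav[OF t] field_simps)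
    then have "(e powr q i) powr (1 / q i) \<le> bavg (\<lambda>y. \<omega> i y powr q i) x t powr (1 / q i)"
      using q0[OF i] by (intro powr_mono2) auto
    then have "e \<le> bavg (\<lambda>y. \<omega> i y powr q i) x t powr (1 / q i)" using e q0[OF i] by (simp add: powr_powr)
    then show ?thesis unfolding X_def Sx_def using True e by (simp add: e_def[symmetric])
  qed
  have XK: "X j x t \<le> K" if j: "j < m" and t: "0 < t" for j x t
  proof -
    have Sx0: "0 \<le> Sx i x t" if "i < m" for i
      unfolding Sx_def using ep[OF that _ t, of x] by (auto simp: less_imp_le)
    \<comment> \<open>The other factors are at least one, so inserting them can only increase the
      value.\<close>
    have "X j x t * 1 \<le> X j x t * (\<Prod>i\<in>{..<m} - {j}. X i x t)"
      using X1[OF _ t] j by (intro mult_left_mono prod_ge_1) (auto intro: order_trans[OF zero_le_one])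
    also have "\<dots> = (\<Prod>i<m. X i x t)" using j by (subst prod.remove[of _ j]) auto
    also have "\<dots> = (\<Prod>i<m. bavg (\<lambda>y. \<omega> i y powr q i) x t powr (1 / q i)) * (\<Prod>i<m. Sx i x t)"
      unfolding X_def prod.distrib ..
    also have "(\<Prod>i<m. bavg (\<lambda>y. \<omega> i y powr q i) x t powr (1 / q i))
        = (\<Prod>i<m. wball (\<lambda>y. \<omega> i y powr q i) x t powr (1 / q i)) / B t powr (1 / Q)"
      unfolding Q using B[OF t] by (simp add: bav[OF t] powr_divide prod_dividef powr_sum)
    also have "\<dots> * (\<Prod>i<m. Sx i x t) \<le> (CQ * wball (\<lambda>y. (\<Prod>i<m. \<omega> i y) powr Q) x t powr (1 / Q)) / B t powr (1 / Q) * (\<Prod>i<m. Sx i x t)"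
      using CQ(2)[OF t, of x] Sx0 by (intro mult_right_mono divide_right_mono prod_nonneg) auto
    also have "\<dots> = CQ * (bavg (\<lambda>y. (\<Prod>i<m. \<omega> i y) powr Q) x t powr (1 / Q) * (\<Prod>i<m. Sx i x t))"
      by (simp add: bav[OF t] powr_divide)
    also have "\<dots> \<le> CQ * C0"
      using C0[OF t, of x] CQ(1) unfolding Sx_def by (intro mult_left_mono) auto
    finally show ?thesis by (simp add: K_def)
  qed
  have sb: "wball (\<lambda>y. \<omega> i y powr q i) x t powr (1 / q i)
       * wball (\<lambda>y. \<omega> i y powr (- (p i / (p i - 1)))) x t powr ((p i - 1) / p i)
       \<le> K * B t powr ((p i - 1) / p i + 1 / q i)" if i: "i < m" "1 < p i" and t: "0 < t" for i x t
  proof -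
    have aux: "a * b \<le> K * (y * x)" if "a / x * (b / y) \<le> K" "0 < x" "0 < y" for a b x y :: real
      using that by (simp add: field_simps)
    show ?thesis
      unfolding powr_add
      by (rule aux) (use XK[OF i(1) t, of x] i(2) B[OF t] in \<open>auto simp: X_def Sx_def bav[OF t] powr_divide\<close>)
  qed
  have eb: "wball (\<lambda>y. \<omega> i y powr q i) x t powr (1 / q i) / ess_inf_on lborel (ball x t) (\<omega> i) \<le> K * B t powr (1 / q i)"
    if i: "i < m" "p i = 1" and t: "0 < t" for i x t
    using XK[OF i(1) t, of x] i(2) B[OF t] ep[OF i t, of x] unfolding X_def Sx_def by (simp add: bav[OF t] powr_divide field_simps)
  define H where "H i = K * bvol TYPE('a) powr ((p i - 1) / p i + 1 / q i)" for i
  have apq: "apq_weight (p i) (q i) (H i) (\<omega> i)" if i: "i < m" for i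
    unfolding H_def
    by (rule apq_weight_of_bound[OF p[OF i] pq[OF i] K wm[OF i] w0[OF i] wpos[OF i] wi[OF i] si[OF i] _ ep[OF i]])
      (use sb[OF i] eb[OF i] in \<open>auto simp: B_def\<close>)
  have "multi_weight m p q H \<omega> Q CQ"
    by (intro multi_weight.intro m apq Q CQ u_int)
  moreover have "apq_weight_strong (p i) (q i) (H i) (\<omega> i) ((K * bvol TYPE('a) powr ((p i - 1) / p i + 1 / q i)) powr (p i / (p i - 1)))"
    if i: "i < m" "1 < p i" for i
    by (rule apq_weight_strong_of_bound[OF apq[OF i(1)] i(2) K si[OF i]]) (use sb[OF i] in \<open>auto simp: B_def\<close>)
  ultimately show ?thesis by (rule that)
qed

section \<open>Local estimates\<close>

lemma measurable_ball_radius: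
  fixes g :: "'a::euclidean_space \<Rightarrow> ennreal"
  assumes [measurable]: "g \<in> borel_measurable borel"
  shows "(\<lambda>t. \<integral>\<^sup>+y. g y * indicator (ball x t) y \<partial>lborel) \<in> borel_measurable borel"
proof -
  have "(\<lambda>t. \<integral>\<^sup>+y. g y * (if dist x y < t then 1 else 0) \<partial>lborel) \<in> borel_measurable borel"
    by measurable
  then show ?thesis by (simp add: indicator_def of_bool_def)
qed

context multi_weight
begin

text \<open>Up to a constant, the bound for the integrand of the potential at scale
  \<open>t\<close>. Its tail integral \<open>Sint\<close> links all local estimates: it bounds the
  far part pointwise, dominates the local norms, and is what the condition on the Morrey functions
  controls.\<close>

definition Psi :: "(nat \<Rightarrow> 'a \<Rightarrow> real) \<Rightarrow> 'a \<Rightarrow> real \<Rightarrow> ennreal" where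
  "Psi f x t = (\<Prod>i<m. epow (Eb i (f i) x t) (1 / p i)) * ennreal (G x t powr (- 1 / Q))"

definition Sint :: "(nat \<Rightarrow> 'a \<Rightarrow> real) \<Rightarrow> 'a \<Rightarrow> real \<Rightarrow> ennreal" where
  "Sint f x r = (\<integral>\<^sup>+t. Psi f x t * ennreal (1 / t) * indicator {r<..} t \<partial>lborel)"

lemma Psi_measurable [measurable]:
  assumes f: "\<And>i. i < m \<Longrightarrow> f i \<in> borel_measurable borel"
  shows "Psi f x \<in> borel_measurable borel"
proof -
  have E [measurable]: "(\<lambda>t. Eb i (f i) x t) \<in> borel_measurable borel" if i: "i < m" for i
  proof -
    have [measurable]: "f i \<in> borel_measurable borel" "\<omega> i \<in> borel_measurable borel" using i f omega_meas by auto
    show ?thesis unfolding Eb_def by (rule measurable_ball_radius) measurable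
  qed
  have V [measurable]: "(\<lambda>t. Vi i x t) \<in> borel_measurable borel" if i: "i < m" for i
  proof -
    have [measurable]: "\<omega> i \<in> borel_measurable borel" using i omega_meas by auto
    have "(\<lambda>t. \<integral>\<^sup>+y. ennreal (\<omega> i y powr q i) * indicator (ball x t) y \<partial>lborel) \<in> borel_measurable borel"
      by (rule measurable_ball_radius) measurable
    then have "(\<lambda>t. enn2real (ennreal (Vi i x t))) \<in> borel_measurable borel"
      unfolding Vi_eq[OF i] by measurable
    then show ?thesis by (simp add: Vi_nonneg)
  qed
  show ?thesis unfolding Psi_def[abs_def] G_def by measurable
qed

section \<open>Splitting the potential at the radius of a ball\<close>

lemma Fb_mono: "ball x t \<subseteq> ball y r \<Longrightarrow> Fb f x t \<le> Fb f y r"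
  unfolding Fb_def by (intro nn_integral_mono mult_left_mono) (auto simp: indicator_def)

text \<open>For \<open>t\<close> at least \<open>r\<close> the ball of radius \<open>t\<close> about
  \<open>x\<close> lies in the ball of radius \<open>2 * t\<close> about the fixed centre, so the
  bound no longer depends on \<open>x\<close>; replacing \<open>t\<close> by \<open>2 * t\<close>
  leaves \<open>dt / t\<close> invariant.\<close>

lemma far_le:
  assumes f: "\<And>i. i < m \<Longrightarrow> f i \<in> borel_measurable borel" and r: "0 < r" and x: "x \<in> ball x0 r"
  shows "(\<integral>\<^sup>+t. (\<Prod>i<m. ennreal (t powr (- nu i)) * Fb (f i) x t) * ennreal (1 / t) * indicator {r..} t \<partial>lborel)
    \<le> ennreal (2 powr sM * (\<Prod>i<m. H i)) * Sint f x0 r"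
proof -
  define HH where "HH = (\<Prod>i<m. H i)"
  have HH: "0 < HH" unfolding HH_def using pq_facts(5) by (intro prod_pos) auto
  have pt: "(\<Prod>i<m. ennreal (t powr (- nu i)) * Fb (f i) x t) \<le> ennreal (2 powr sM * HH) * Psi f x0 (2 * t)" if t: "r \<le> t" for t
  proof -
    have t0: "0 < 2 * t" using r t by simp
    have sub: "ball x t \<subseteq> ball x0 (2 * t)"
      using x t by (auto simp: subset_iff) (smt (verit) dist_triangle dist_commute)
    have "(\<Prod>i<m. ennreal (t powr (- nu i)) * Fb (f i) x t) \<le> (\<Prod>i<m. ennreal (2 powr nu i) * (ennreal ((2 * t) powr (- nu i)) * Fb (f i) x0 (2 * t)))"
    proof (rule prod_mono_ennreal)
      fix i
      have "t powr (- nu i) = 2 powr nu i * (2 * t) powr (- nu i)"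
        by (simp add: powr_mult powr_minus)
      then have "ennreal (t powr (- nu i)) = ennreal (2 powr nu i) * ennreal ((2 * t) powr (- nu i))"
        by (simp add: ennreal_mult)
      then show "ennreal (t powr (- nu i)) * Fb (f i) x t \<le> ennreal (2 powr nu i) * (ennreal ((2 * t) powr (- nu i)) * Fb (f i) x0 (2 * t))"
        using Fb_mono[OF sub] by (simp add: mult.assoc mult_left_mono)
    qed
    also have "\<dots> = ennreal (2 powr sM) * (\<Prod>i<m. ennreal ((2 * t) powr (- nu i)) * Fb (f i) x0 (2 * t))"
    proof -
      have "(\<Prod>i<m. ennreal (2 powr nu i)) = ennreal (2 powr sM)"
        by (simp add: prod_ennreal sM_def powr_sum)
      then show ?thesis unfolding prod.distrib[of "\<lambda>i. ennreal (2 powr nu i)"] by simp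
    qed
    also have "\<dots> \<le> ennreal (2 powr sM) * (ennreal (HH * G x0 (2 * t) powr (- 1 / Q)) * (\<Prod>i<m. epow (Eb i (f i) x0 (2 * t)) (1 / p i)))"
      unfolding HH_def by (intro mult_left_mono prod_Tb_le f t0) auto
    also have "\<dots> = ennreal (2 powr sM * HH) * Psi f x0 (2 * t)"
      using HH by (simp add: Psi_def ennreal_mult mult_ac)
    finally show ?thesis .
  qed
  have [measurable]: "Psi f x0 \<in> borel_measurable borel" by (rule Psi_measurable) fact
  \<comment> \<open>Change of variables; the doubled scales start at \<open>2 * r\<close>, inside
    the domain of the tail integral.\<close>
  have "Sint f x0 r = ennreal \<bar>2\<bar> * (\<integral>\<^sup>+t. Psi f x0 (0 + 2 * t) * ennreal (1 / (0 + 2 * t)) * indicator {r<..} (0 + 2 * t) \<partial>lborel)"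
    unfolding Sint_def by (rule nn_integral_real_affine) simp_all
  also have "\<dots> = (\<integral>\<^sup>+t. 2 * (Psi f x0 (2 * t) * ennreal (1 / (2 * t)) * indicator {r<..} (2 * t)) \<partial>lborel)"
    by (subst nn_integral_cmult) simp_all
  finally have S: "Sint f x0 r = (\<integral>\<^sup>+t. 2 * (Psi f x0 (2 * t) * ennreal (1 / (2 * t)) * indicator {r<..} (2 * t)) \<partial>lborel)" .
  have "(\<integral>\<^sup>+t. (\<Prod>i<m. ennreal (t powr (- nu i)) * Fb (f i) x t) * ennreal (1 / t) * indicator {r..} t \<partial>lborel)
    \<le> (\<integral>\<^sup>+t. ennreal (2 powr sM * HH) * (2 * (Psi f x0 (2 * t) * ennreal (1 / (2 * t)) * indicator {r<..} (2 * t))) \<partial>lborel)"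
  proof (rule nn_integral_mono)
    fix t :: real
    show "(\<Prod>i<m. ennreal (t powr (- nu i)) * Fb (f i) x t) * ennreal (1 / t) * indicator {r..} t
      \<le> ennreal (2 powr sM * HH) * (2 * (Psi f x0 (2 * t) * ennreal (1 / (2 * t)) * indicator {r<..} (2 * t)))"
    proof (cases "r \<le> t")
      case True
      have e: "2 * ennreal (1 / (2 * t)) = ennreal (1 / t)"
        using True r by (simp add: ennreal_mult''[symmetric] flip: ennreal_numeral)
      have "(\<Prod>i<m. ennreal (t powr (- nu i)) * Fb (f i) x t) * ennreal (1 / t) \<le> ennreal (2 powr sM * HH) * Psi f x0 (2 * t) * (2 * ennreal (1 / (2 * t)))"
        unfolding e using pt[OF True] by (intro mult_right_mono) auto
      then show ?thesis using True r by (simp add: mult_ac)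
    qed simp
  qed
  also have "\<dots> = ennreal (2 powr sM * HH) * Sint f x0 r"
    unfolding S by (rule nn_integral_cmult) measurable
  finally show ?thesis unfolding HH_def .
qed

definition cutoff :: "(nat \<Rightarrow> 'a \<Rightarrow> real) \<Rightarrow> 'a \<Rightarrow> real \<Rightarrow> nat \<Rightarrow> 'a \<Rightarrow> real" where
  "cutoff f x r i y = f i y * indicator (ball x r) y"

text \<open>For \<open>t < r\<close> the balls about \<open>x\<close> stay in the doubled ball, so
  the cutoff changes nothing at these scales; the scales from \<open>r\<close> on form the far
  part.\<close>

lemma mpot_near_far:
  assumes f: "\<And>i. i < m \<Longrightarrow> f i \<in> borel_measurable borel" and r: "0 < r" and x: "x \<in> ball x0 r"
  shows "mpot m sM f x \<le> mpot m sM (cutoff f x0 (2 * r)) x + ennreal (2 powr sM * (\<Prod>i<m. H i)) * Sint f x0 r"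
proof -
  have Fm [measurable]: "(\<lambda>t. Fb (g i) x t) \<in> borel_measurable borel" if "i < m" "\<And>i. i < m \<Longrightarrow> g i \<in> borel_measurable borel" for i g
    unfolding Fb_def using that(2)[OF that(1)] by (intro measurable_ball_radius) measurable
  have c: "cutoff f x0 (2 * r) i \<in> borel_measurable borel" if "i < m" for i
    unfolding cutoff_def using f[OF that] by measurable
  have eq: "Fb (f i) x t = Fb (cutoff f x0 (2 * r) i) x t" if "t < r" for i t
    unfolding Fb_def
  proof (rule nn_integral_cong)
    fix y
    have "y \<in> ball x0 (2 * r)" if "y \<in> ball x t"
      using that x \<open>t < r\<close> by (auto) (smt (verit) dist_triangle dist_commute)
    then show "ennreal \<bar>f i y\<bar> * indicator (ball x t) y = ennreal \<bar>cutoff f x0 (2 * r) i y\<bar> * indicator (ball x t) y"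
      by (auto simp: cutoff_def indicator_def)
  qed
  have "mpot m sM f x \<le> (\<integral>\<^sup>+t. (\<Prod>i<m. ennreal (t powr (- nu i)) * Fb (cutoff f x0 (2 * r) i) x t) * ennreal (1 / t) * indicator {0<..} t
      + (\<Prod>i<m. ennreal (t powr (- nu i)) * Fb (f i) x t) * ennreal (1 / t) * indicator {r..} t \<partial>lborel)"
    unfolding mpot_eq
  proof (rule nn_integral_mono)
    fix t :: real
    show "(\<Prod>i<m. ennreal (t powr (- nu i)) * Fb (f i) x t) * ennreal (1 / t) * indicator {0<..} t
      \<le> (\<Prod>i<m. ennreal (t powr (- nu i)) * Fb (cutoff f x0 (2 * r) i) x t) * ennreal (1 / t) * indicator {0<..} t
      + (\<Prod>i<m. ennreal (t powr (- nu i)) * Fb (f i) x t) * ennreal (1 / t) * indicator {r..} t"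
    proof (cases "t < r")
      case True
      then show ?thesis by (simp add: eq)
    next
      case False
      then show ?thesis using r by (simp add: add_increasing)
    qed
  qed
  also have "\<dots> = mpot m sM (cutoff f x0 (2 * r)) x
      + (\<integral>\<^sup>+t. (\<Prod>i<m. ennreal (t powr (- nu i)) * Fb (f i) x t) * ennreal (1 / t) * indicator {r..} t \<partial>lborel)"
  proof -
    have [measurable]: "(\<lambda>t. Fb (f i) x t) \<in> borel_measurable borel" "(\<lambda>t. Fb (cutoff f x0 (2 * r) i) x t) \<in> borel_measurable borel" if "i < m" for i
      using Fm[of i f] Fm[of i "cutoff f x0 (2 * r)"] f c that by auto
    show ?thesis unfolding mpot_eq by (rule nn_integral_add) measurable
  qed
  also have "\<dots> \<le> mpot m sM (cutoff f x0 (2 * r)) x + ennreal (2 powr sM * (\<Prod>i<m. H i)) * Sint f x0 r"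
    by (intro add_left_mono far_le f r x)
  finally show ?thesis .
qed

lemma Et_cutoff: "i < m \<Longrightarrow> Et i (cutoff f x r i) = Eb i (f i) x r"
  unfolding Et_def Eb_def cutoff_def using pq_facts(3)[of i] by (intro nn_integral_cong) (auto simp: indicator_def)

text \<open>Restrict the tail integral to scales between \<open>2 * r\<close> and
  \<open>4 * r\<close>: there the energies are at least those at \<open>2 * r\<close>, and
  \<open>G\<close> is at most its value at \<open>4 * r\<close>, which doubling compares with
  \<open>W x r\<close>. Thus near and far parts are governed by the same integral.\<close>

lemma near_norm_le:
  obtains C where "0 < C" "\<And>f x r. 0 < r \<Longrightarrow>
    (\<Prod>i<m. epow (Eb i (f i) x (2 * r)) (1 / p i)) \<le> ennreal (C * W x r powr (1 / Q)) * Sint f x r"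
proof -
  obtain K where K: "K > 0" "\<And>x t y r. 0 < t \<Longrightarrow> r \<le> 5 * t \<Longrightarrow> ball x t \<subseteq> ball y r \<Longrightarrow> G y r \<le> K * G x t"
    using G_doubling by blast
  define C where "C = 2 * (K * CQ powr Q) powr (1 / Q)"
  have C: "0 < C" using K CQ_pos by (simp add: C_def)
  have "(\<Prod>i<m. epow (Eb i (f i) x (2 * r)) (1 / p i)) \<le> ennreal (C * W x r powr (1 / Q)) * Sint f x r" if r: "0 < r" for f x r
  proof -
    define A where "A = (\<Prod>i<m. epow (Eb i (f i) x (2 * r)) (1 / p i))"
    define g where "g = G x (4 * r) powr (- 1 / Q)"
    have g: "0 < g" unfolding g_def using G_pos[of "4 * r" x] r by simp
    \<comment> \<open>The constant integrand is the lower bound on an interval of length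
      \<open>2 * r\<close>, so its integral is \<open>A * g / 2\<close>.\<close>
    have "A * ennreal (g / (4 * r)) * ennreal (2 * r) = (\<integral>\<^sup>+t. A * ennreal (g / (4 * r)) * indicator {2 * r<..<4 * r} t \<partial>lborel)"
      using r by (simp add: nn_integral_cmult_indicator)
    also have "\<dots> \<le> Sint f x r"
      unfolding Sint_def
    proof (rule nn_integral_mono)
      fix t :: real
      show "A * ennreal (g / (4 * r)) * indicator {2 * r<..<4 * r} t \<le> Psi f x t * ennreal (1 / t) * indicator {r<..} t"
      proof (cases "t \<in> {2 * r<..<4 * r}")
        case True
        have "A \<le> (\<Prod>i<m. epow (Eb i (f i) x t) (1 / p i))"
          unfolding A_def using True pq_facts(3) by (intro prod_mono_ennreal epow_mono Eb_mono subset_ball) (auto simp: less_imp_le)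
        moreover have "g \<le> G x t powr (- 1 / Q)"
          unfolding g_def using True r Q_pos G_pos[of t x] by (intro powr_mono2' G_mono subset_ball) auto
        ultimately have "A * ennreal g * ennreal (1 / (4 * r)) \<le> Psi f x t * ennreal (1 / t)"
          unfolding Psi_def using True r by (intro mult_mono ennreal_leI) (auto simp: field_simps)
        moreover have "ennreal (g / (4 * r)) = ennreal g * ennreal (1 / (4 * r))"
          using g r by (simp add: ennreal_mult[symmetric])
        ultimately show ?thesis using True r by (simp add: mult.assoc)
      qed auto
    qed
    finally have "A * (ennreal (g / (4 * r)) * ennreal (2 * r)) \<le> Sint f x r" by (simp add: mult.assoc)
    moreover have "ennreal (g / (4 * r)) * ennreal (2 * r) = ennreal (g / 2)"
      using g r by (simp add: ennreal_mult[symmetric])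
    ultimately have "A * ennreal (g / 2) * ennreal (2 / g) \<le> Sint f x r * ennreal (2 / g)"
      by (intro mult_right_mono) auto
    moreover have "ennreal (g / 2) * ennreal (2 / g) = 1"
      using g by (simp add: ennreal_mult[symmetric])
    ultimately have "A * 1 \<le> Sint f x r * ennreal (2 / g)" by (simp only: mult.assoc)
    then have "A \<le> ennreal (2 / g) * Sint f x r" by (simp add: mult.commute)
    also have "\<dots> \<le> ennreal (C * W x r powr (1 / Q)) * Sint f x r"
    proof (intro mult_right_mono ennreal_leI)
      have "G x (4 * r) \<le> K * G x r" using r by (intro K) (auto simp: subset_ball)
      also have "\<dots> \<le> K * (CQ powr Q * W x r)" using G_le_W[OF r, of x] K(1) by (intro mult_left_mono) auto
      finally have "G x (4 * r) powr (1 / Q) \<le> (K * CQ powr Q * W x r) powr (1 / Q)"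
        using Q_pos G_pos[of "4 * r" x] r by (intro powr_mono2) (auto simp: mult.assoc)
      then have "2 * G x (4 * r) powr (1 / Q) \<le> C * W x r powr (1 / Q)"
        by (simp add: C_def powr_mult[of "K * _"])
      then show "2 / g \<le> C * W x r powr (1 / Q)" by (simp add: g_def powr_minus_divide)
    qed auto
    finally show ?thesis unfolding A_def .
  qed
  with C show ?thesis by (rule that)
qed

section \<open>Weak and strong estimates on a ball\<close>

lemma epow_norm_prod:
  assumes "\<And>i. i < m \<Longrightarrow> 0 \<le> E i"
  shows "ennreal (\<Prod>i<m. E i powr (Q / p i)) = epow (\<Prod>i<m. epow (ennreal (E i)) (1 / p i)) Q"
  using assms Q_pos pq_facts(3)
  by (subst epow_prod) (auto simp: prod_ennreal[symmetric] powr_powr intro!: prod.cong)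

lemma near_const_le:
  obtains C where "0 < C" "\<And>f x r E. 0 < r \<Longrightarrow> (\<And>i. i < m \<Longrightarrow> 0 \<le> E i) \<Longrightarrow>
    (\<And>i. i < m \<Longrightarrow> Eb i (f i) x (2 * r) = ennreal (E i)) \<Longrightarrow>
    ennreal (\<Prod>i<m. E i powr (Q / p i)) \<le> ennreal (C * W x r) * epow (Sint f x r) Q"
proof -
  obtain C where C: "0 < C" "\<And>f x r. 0 < r \<Longrightarrow>
    (\<Prod>i<m. epow (Eb i (f i) x (2 * r)) (1 / p i)) \<le> ennreal (C * W x r powr (1 / Q)) * Sint f x r"
    using near_norm_le by blast
  show ?thesis
  proof (rule that[of "C powr Q"])
    show "0 < C powr Q" using C by simp
    fix f x r E assume r: "0 < (r::real)" and E: "\<And>i. i < m \<Longrightarrow> 0 \<le> E i" "\<And>i. i < m \<Longrightarrow> Eb i (f i) x (2 * r) = ennreal (E i)"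
    have "ennreal (\<Prod>i<m. E i powr (Q / p i)) = epow (\<Prod>i<m. epow (Eb i (f i) x (2 * r)) (1 / p i)) Q"
      using epow_norm_prod[of E, OF E(1)] E(2) by simp
    also have "\<dots> \<le> epow (ennreal (C * W x r powr (1 / Q)) * Sint f x r) Q"
      using C(2)[OF r] Q_pos by (intro epow_mono) auto
    also have "\<dots> = ennreal (C powr Q * W x r) * epow (Sint f x r) Q"
      using C(1) Q_pos W_nonneg[of x r] by (simp add: epow_mult powr_mult powr_powr)
    finally show "ennreal (\<Prod>i<m. E i powr (Q / p i)) \<le> ennreal (C powr Q * W x r) * epow (Sint f x r) Q" .
  qed
qed

lemma cutoff_measurable: "(\<And>i. i < m \<Longrightarrow> f i \<in> borel_measurable borel) \<Longrightarrow> i < m \<Longrightarrow> cutoff f x r i \<in> borel_measurable borel"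
  unfolding cutoff_def by (intro borel_measurable_times borel_measurable_indicator) auto

text \<open>If \<open>l\<close> is at most twice the far part, bounding the level set by the whole
  ball is good enough. Otherwise the far part is at most \<open>l / 2\<close>, and the level set
  lies in the level set at \<open>l / 2\<close> of the potential of the cut-off functions, where the
  global weak bound applies.\<close>

lemma local_weak:
  obtains C :: real where "0 < C" "\<And>f x r l. (\<And>i. i < m \<Longrightarrow> f i \<in> borel_measurable borel) \<Longrightarrow> 0 < r \<Longrightarrow> 0 < l \<Longrightarrow>
    (\<And>i. i < m \<Longrightarrow> Eb i (f i) x (2 * r) < top) \<Longrightarrow>
    ennreal (l powr Q) * emeasure mW {y \<in> ball x r. ennreal l < mpot m sM f y} \<le> ennreal (C * W x r) * epow (Sint f x r) Q"
proof -
  obtain C1 where C1: "0 < C1" "\<And>f E l. (\<And>i. i < m \<Longrightarrow> f i \<in> borel_measurable borel) \<Longrightarrow> (\<And>i. i < m \<Longrightarrow> 0 \<le> E i) \<Longrightarrow>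
       (\<And>i. i < m \<Longrightarrow> Et i (f i) = ennreal (E i)) \<Longrightarrow> 0 < l \<Longrightarrow>
       ennreal (l powr Q) * emeasure mW {x. ennreal l < mpot m sM f x} \<le> ennreal (C1 * (\<Prod>i<m. E i powr (Q / p i)))"
    using weak_type by blast
  obtain C2 where C2: "0 < C2" "\<And>f x r E. 0 < r \<Longrightarrow> (\<And>i. i < m \<Longrightarrow> 0 \<le> E i) \<Longrightarrow>
    (\<And>i. i < m \<Longrightarrow> Eb i (f i) x (2 * r) = ennreal (E i)) \<Longrightarrow>
    ennreal (\<Prod>i<m. E i powr (Q / p i)) \<le> ennreal (C2 * W x r) * epow (Sint f x r) Q"
    using near_const_le by blast
  define C3 where "C3 = 2 powr sM * (\<Prod>i<m. H i)"
  have C3: "0 < C3" unfolding C3_def using pq_facts(5) by (intro mult_pos_pos prod_pos) auto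
  define C where "C = max ((2 * C3) powr Q) (2 powr Q * C1 * C2)"
  have C: "0 < C" using C3 by (simp add: C_def less_max_iff_disj)
  have sets_mW: "sets mW = sets borel" by (simp add: mW_def)
  show ?thesis
  proof (rule that[OF C])
    fix f x r l assume f: "\<And>i. i < m \<Longrightarrow> f i \<in> borel_measurable borel" and r: "0 < (r::real)" and l: "0 < (l::real)"
      and fin: "\<And>i. i < m \<Longrightarrow> Eb i (f i) x (2 * r) < top"
    note f [measurable]
    let ?S = "Sint f x r"
    show "ennreal (l powr Q) * emeasure mW {y \<in> ball x r. ennreal l < mpot m sM f y} \<le> ennreal (C * W x r) * epow ?S Q"
    proof (cases "ennreal l \<le> 2 * (ennreal C3 * ?S)")
      case True
      then have "epow (ennreal l) Q \<le> epow (2 * (ennreal C3 * ?S)) Q" using Q_pos by (intro epow_mono) auto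
      also have "2 * (ennreal C3 * ?S) = ennreal (2 * C3) * ?S"
        using C3 by (simp add: ennreal_mult mult.assoc)
      also have "epow (ennreal (2 * C3) * ?S) Q = ennreal ((2 * C3) powr Q) * epow ?S Q"
        using C3 Q_pos by (simp add: epow_mult)
      finally have "ennreal (l powr Q) \<le> ennreal ((2 * C3) powr Q) * epow ?S Q" using l by simp
      also have "\<dots> \<le> ennreal C * epow ?S Q" by (intro mult_right_mono ennreal_leI) (auto simp: C_def)
      finally have "ennreal (l powr Q) * emeasure mW {y \<in> ball x r. ennreal l < mpot m sM f y} \<le> ennreal C * epow ?S Q * emeasure mW (ball x r)"
        by (intro mult_mono emeasure_mono) (auto simp: sets_mW)
      also have "\<dots> = ennreal (C * W x r) * epow ?S Q"
        unfolding emeasure_mW_ball using C W_nonneg by (simp add: ennreal_mult mult_ac)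
      finally show ?thesis .
    next
      case False
      define E where "E i = enn2real (Eb i (f i) x (2 * r))" for i
      have E: "0 \<le> E i" "Eb i (f i) x (2 * r) = ennreal (E i)" if "i < m" for i
        using fin[OF that] by (auto simp: E_def)
      have cm: "cutoff f x (2 * r) i \<in> borel_measurable borel" if "i < m" for i using cutoff_measurable[of f] f that by blast
      have sub: "{y \<in> ball x r. ennreal l < mpot m sM f y} \<subseteq> {y. ennreal (l / 2) < mpot m sM (cutoff f x (2 * r)) y}"
      proof (rule ccontr)
        assume "\<not> ?thesis"
        then obtain y where y: "y \<in> ball x r" "ennreal l < mpot m sM f y" "mpot m sM (cutoff f x (2 * r)) y \<le> ennreal (l / 2)"
          unfolding subset_iff by (auto simp: not_less)
        have "mpot m sM f y \<le> mpot m sM (cutoff f x (2 * r)) y + ennreal C3 * ?S"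
          unfolding C3_def by (intro mpot_near_far f r y)
        moreover have "ennreal C3 * ?S \<le> ennreal (l / 2)"
        proof -
          have "2 * (ennreal C3 * ?S) \<le> 2 * ennreal (l / 2)"
            using False l by (simp add: ennreal_mult''[symmetric] flip: ennreal_numeral)
          then show ?thesis by (subst (asm) ennreal_mult_le_mult_iff) auto
        qed
        ultimately have "mpot m sM f y \<le> ennreal (l / 2) + ennreal (l / 2)" using y(3) by (meson add_mono order_trans)
        then show False using y(2) l by (simp flip: ennreal_plus)
      qed
      have "emeasure mW {y \<in> ball x r. ennreal l < mpot m sM f y} \<le> emeasure mW {y. ennreal (l / 2) < mpot m sM (cutoff f x (2 * r)) y}"
        using sub cm by (intro emeasure_mono) (auto simp: sets_mW)
      then have "ennreal (l powr Q) * emeasure mW {y \<in> ball x r. ennreal l < mpot m sM f y}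
         \<le> ennreal (l powr Q) * emeasure mW {y. ennreal (l / 2) < mpot m sM (cutoff f x (2 * r)) y}"
        by (intro mult_left_mono) auto
      also have "\<dots> = ennreal (2 powr Q) * (ennreal ((l / 2) powr Q) * emeasure mW {y. ennreal (l / 2) < mpot m sM (cutoff f x (2 * r)) y})"
      proof -
        have "l powr Q = 2 powr Q * (l / 2) powr Q" by (simp add: powr_mult[symmetric])
        then have "ennreal (l powr Q) = ennreal (2 powr Q) * ennreal ((l / 2) powr Q)" by (simp add: ennreal_mult)
        then show ?thesis by (simp add: mult.assoc)
      qed
      also have "\<dots> \<le> ennreal (2 powr Q) * ennreal (C1 * (\<Prod>i<m. E i powr (Q / p i)))"
        using l E cm by (intro mult_left_mono C1(2)) (auto simp: Et_cutoff)
      also have "\<dots> = ennreal (2 powr Q * C1) * ennreal (\<Prod>i<m. E i powr (Q / p i))"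
        using C1(1) by (simp add: ennreal_mult prod_nonneg mult.assoc)
      also have "\<dots> \<le> ennreal (2 powr Q * C1) * (ennreal (C2 * W x r) * epow ?S Q)"
        by (intro mult_left_mono C2(2) r E) auto
      also have "\<dots> = ennreal (2 powr Q * C1 * C2) * (ennreal (W x r) * epow ?S Q)"
        using C1(1) C2(1) W_nonneg[of x r] by (simp add: ennreal_mult mult_ac)
      also have "\<dots> \<le> ennreal C * (ennreal (W x r) * epow ?S Q)"
        by (intro mult_right_mono ennreal_leI) (auto simp: C_def)
      also have "\<dots> = ennreal (C * W x r) * epow ?S Q"
        using C W_nonneg[of x r] by (simp add: ennreal_mult mult_ac)
      finally show ?thesis .
    qed
  qed
qed

text \<open>The global strong bound handles the near part, and the far part is bounded by a constant
  on the ball; splitting the power of the sum costs \<open>2 powr Q\<close>.\<close>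

lemma local_strong:
  assumes strong: "\<And>i. i < m \<Longrightarrow> apq_weight_strong (p i) (q i) (H i) (\<omega> i) (H2 i)"
  obtains C :: real where "0 < C" "\<And>f x r. (\<And>i. i < m \<Longrightarrow> f i \<in> borel_measurable borel) \<Longrightarrow> 0 < r \<Longrightarrow>
    (\<And>i. i < m \<Longrightarrow> Eb i (f i) x (2 * r) < top) \<Longrightarrow>
    (\<integral>\<^sup>+y. epow (mpot m sM f y) Q * indicator (ball x r) y \<partial>mW) \<le> ennreal (C * W x r) * epow (Sint f x r) Q"
proof -
  obtain C1 where C1: "0 < C1" "\<And>f E. (\<And>i. i < m \<Longrightarrow> f i \<in> borel_measurable borel) \<Longrightarrow> (\<And>i. i < m \<Longrightarrow> 0 \<le> E i) \<Longrightarrow>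
       (\<And>i. i < m \<Longrightarrow> Et i (f i) = ennreal (E i)) \<Longrightarrow>
       (\<integral>\<^sup>+x. epow (mpot m sM f x) Q \<partial>mW) \<le> ennreal (C1 * (\<Prod>i<m. E i powr (Q / p i)))"
    using strong_type[OF strong] by blast
  obtain C2 where C2: "0 < C2" "\<And>f x r E. 0 < r \<Longrightarrow> (\<And>i. i < m \<Longrightarrow> 0 \<le> E i) \<Longrightarrow>
    (\<And>i. i < m \<Longrightarrow> Eb i (f i) x (2 * r) = ennreal (E i)) \<Longrightarrow>
    ennreal (\<Prod>i<m. E i powr (Q / p i)) \<le> ennreal (C2 * W x r) * epow (Sint f x r) Q"
    using near_const_le by blast
  define C3 where "C3 = 2 powr sM * (\<Prod>i<m. H i)"
  have C3: "0 < C3" unfolding C3_def using pq_facts(5) by (intro mult_pos_pos prod_pos) auto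
  define C where "C = 2 powr Q * (C1 * C2 + C3 powr Q)"
  have C: "0 < C" using C1 C2 C3 by (simp add: C_def add_pos_pos)
  have sets_mW [measurable_cong]: "sets mW = sets borel" by (simp add: mW_def)
  show ?thesis
  proof (rule that[OF C])
    fix f x r assume f: "\<And>i. i < m \<Longrightarrow> f i \<in> borel_measurable borel" and r: "0 < (r::real)"
      and fin: "\<And>i. i < m \<Longrightarrow> Eb i (f i) x (2 * r) < top"
    note f [measurable]
    let ?S = "Sint f x r"
    define E where "E i = enn2real (Eb i (f i) x (2 * r))" for i
    have E: "0 \<le> E i" "Eb i (f i) x (2 * r) = ennreal (E i)" if "i < m" for i
      using fin[OF that] by (auto simp: E_def)
    have cm [measurable]: "cutoff f x (2 * r) i \<in> borel_measurable borel" if "i < m" for i using cutoff_measurable[of f] f that by blast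
    have "(\<integral>\<^sup>+y. epow (mpot m sM f y) Q * indicator (ball x r) y \<partial>mW)
      \<le> (\<integral>\<^sup>+y. ennreal (2 powr Q) * (epow (mpot m sM (cutoff f x (2 * r)) y) Q + epow (ennreal C3 * ?S) Q * indicator (ball x r) y) \<partial>mW)"
    proof (rule nn_integral_mono)
      fix y
      show "epow (mpot m sM f y) Q * indicator (ball x r) y \<le> ennreal (2 powr Q) * (epow (mpot m sM (cutoff f x (2 * r)) y) Q + epow (ennreal C3 * ?S) Q * indicator (ball x r) y)"
      proof (cases "y \<in> ball x r")
        case True
        have "mpot m sM f y \<le> mpot m sM (cutoff f x (2 * r)) y + ennreal C3 * ?S"
          unfolding C3_def by (intro mpot_near_far f r True)
        then have "epow (mpot m sM f y) Q \<le> epow (mpot m sM (cutoff f x (2 * r)) y + ennreal C3 * ?S) Q"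
          using Q_pos by (intro epow_mono) auto
        also have "\<dots> \<le> ennreal (2 powr Q) * (epow (mpot m sM (cutoff f x (2 * r)) y) Q + epow (ennreal C3 * ?S) Q)"
          using Q_pos by (rule epow_add_le)
        finally show ?thesis using True by simp
      qed auto
    qed
    also have "\<dots> = ennreal (2 powr Q) * ((\<integral>\<^sup>+y. epow (mpot m sM (cutoff f x (2 * r)) y) Q \<partial>mW) + epow (ennreal C3 * ?S) Q * emeasure mW (ball x r))"
      by (simp add: nn_integral_cmult nn_integral_add nn_integral_cmult_indicator sets_mW)
    also have "\<dots> \<le> ennreal (2 powr Q) * (ennreal (C1 * C2 * W x r) * epow ?S Q + ennreal (C3 powr Q * W x r) * epow ?S Q)"
    proof (intro mult_left_mono add_mono)
      have "(\<integral>\<^sup>+y. epow (mpot m sM (cutoff f x (2 * r)) y) Q \<partial>mW) \<le> ennreal (C1 * (\<Prod>i<m. E i powr (Q / p i)))"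
        using E cm by (intro C1(2)) (auto simp: Et_cutoff)
      also have "\<dots> = ennreal C1 * ennreal (\<Prod>i<m. E i powr (Q / p i))"
        using C1(1) by (simp add: ennreal_mult prod_nonneg)
      also have "\<dots> \<le> ennreal C1 * (ennreal (C2 * W x r) * epow ?S Q)"
        by (intro mult_left_mono C2(2) r E) auto
      also have "\<dots> = ennreal (C1 * C2 * W x r) * epow ?S Q"
        using C1(1) C2(1) W_nonneg[of x r] by (simp add: ennreal_mult mult_ac)
      finally show "(\<integral>\<^sup>+y. epow (mpot m sM (cutoff f x (2 * r)) y) Q \<partial>mW) \<le> ennreal (C1 * C2 * W x r) * epow ?S Q" .
      show "epow (ennreal C3 * ?S) Q * emeasure mW (ball x r) \<le> ennreal (C3 powr Q * W x r) * epow ?S Q"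
        unfolding emeasure_mW_ball using C3 Q_pos W_nonneg[of x r] by (simp add: epow_mult ennreal_mult mult_ac)
    qed auto
    also have "\<dots> = ennreal (C * W x r) * epow ?S Q"
    proof -
      have "ennreal (2 powr Q) * (ennreal a * z + ennreal b * z) = ennreal (2 powr Q * (a + b)) * z" if "0 \<le> a" "0 \<le> b" for a b z
        using that by (simp add: ennreal_mult ring_distribs mult.assoc)
      then have "ennreal (2 powr Q) * (ennreal (C1 * C2 * W x r) * epow ?S Q + ennreal (C3 powr Q * W x r) * epow ?S Q)
        = ennreal (2 powr Q * (C1 * C2 * W x r + C3 powr Q * W x r)) * epow ?S Q"
        using C1(1) C2(1) W_nonneg[of x r] by simp
      then show ?thesis by (simp add: C_def algebra_simps)
    qed
    finally show "(\<integral>\<^sup>+y. epow (mpot m sM f y) Q * indicator (ball x r) y \<partial>mW) \<le> ennreal (C * W x r) * epow ?S Q" .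
  qed
qed

end

section \<open>Morrey spaces\<close>

text \<open>For each ball the right side depends continuously on the constant, so the infimum
  defining the norm is attained. The norms themselves can therefore serve as constants.\<close>

lemma morrey_bound_norm:
  assumes "in_morrey s \<phi> w f" and s: "0 < s" and \<phi>: "\<And>x r. 0 < r \<Longrightarrow> 0 \<le> \<phi> x r" and w: "\<And>x. 0 \<le> w x"
  shows "morrey_bound s \<phi> w f (morrey_norm s \<phi> w f)" "0 \<le> morrey_norm s \<phi> w f"
proof -
  let ?S = "{K. 0 \<le> K \<and> morrey_bound s \<phi> w f K}"
  have ne: "?S \<noteq> {}" using assms(1) by (auto simp: in_morrey_def)
  define k where "k = morrey_norm s \<phi> w f"
  have k: "k = Inf ?S" by (simp add: k_def morrey_norm_def)
  have bb: "bdd_below ?S" by (rule bdd_belowI[of _ 0]) auto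
  show k0: "0 \<le> morrey_norm s \<phi> w f"
    unfolding morrey_norm_def using ne by (intro cInf_greatest) auto
  show "morrey_bound s \<phi> w f (morrey_norm s \<phi> w f)"
    unfolding morrey_bound_def k_def[symmetric]
  proof (intro allI impI)
    fix x and r :: real assume r: "0 < r"
    let ?I = "\<integral>\<^sup>+y\<in>ball x r. ennreal (\<bar>f y\<bar> powr s * w y) \<partial>lborel"
    have le: "?I \<le> ennreal (((k + 1 / real (Suc n)) * \<phi> x r) powr s * wball w x r)" for n
    proof -
      have "Inf ?S < k + 1 / real (Suc n)" unfolding k by simp
      then obtain K where K: "K \<in> ?S" "K < k + 1 / real (Suc n)" using cInf_less_iff[OF ne bb] by auto
      have "?I \<le> ennreal ((K * \<phi> x r) powr s * wball w x r)" using K(1) r by (auto simp: morrey_bound_def)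
      also have "\<dots> \<le> ennreal (((k + 1 / real (Suc n)) * \<phi> x r) powr s * wball w x r)"
        using K \<phi>[OF r, of x] w s wball_nonneg[of w x r]
        by (intro ennreal_leI mult_right_mono powr_mono2) (auto intro: mult_right_mono)
      finally show ?thesis .
    qed
    have "(\<lambda>n. ((k + 1 / real (Suc n)) * \<phi> x r) powr s * wball w x r) \<longlonglongrightarrow> ((k + 0) * \<phi> x r) powr s * wball w x r"
      using k0 \<phi>[OF r, of x] s unfolding k_def[symmetric]
      by (intro tendsto_intros tendsto_powr' LIMSEQ_Suc[OF lim_1_over_n])
         (auto intro!: always_eventually mult_nonneg_nonneg)
    then have "(\<lambda>n. ennreal (((k + 1 / real (Suc n)) * \<phi> x r) powr s * wball w x r)) \<longlonglongrightarrow> ennreal (((k + 0) * \<phi> x r) powr s * wball w x r)"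
      by (rule tendsto_ennrealI)
    then show "?I \<le> ennreal ((k * \<phi> x r) powr s * wball w x r)"
      using le by (intro LIMSEQ_le_const) (auto simp: exI)
  qed
qed

section \<open>The integral operator: measurability and domination by the potential\<close>

lemma measurable_mfrac_int:
  fixes f :: "nat \<Rightarrow> 'a::euclidean_space \<Rightarrow> real"
  assumes [measurable]: "\<And>i. i < m \<Longrightarrow> f i \<in> borel_measurable borel"
  shows "mfrac_int m \<alpha> f \<in> borel_measurable borel"
    and "mfrac_kernel m \<alpha> f x \<in> borel_measurable (\<Pi>\<^sub>M i\<in>{..<m}. (lborel :: 'a measure))"
proof -
  define PM where "PM = (\<Pi>\<^sub>M i\<in>{..<m}. (lborel :: 'a measure))"
  interpret PS: product_sigma_finite "\<lambda>i::nat. (lborel :: 'a measure)" ..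
  interpret sigma_finite_measure PM unfolding PM_def by (rule PS.sigma_finite) simp
  have [measurable]: "(\<lambda>y. y i) \<in> measurable PM borel" if "i < m" for i
    unfolding PM_def using that measurable_component_singleton[of i "{..<m}" "\<lambda>_. lborel :: 'a measure"] by simp
  have "(\<lambda>x. \<integral>y. mfrac_kernel m \<alpha> f x y \<partial>PM) \<in> borel_measurable borel"
    unfolding mfrac_kernel_def by measurable
  then show "mfrac_int m \<alpha> f \<in> borel_measurable borel"
    unfolding mfrac_int_def[abs_def] PM_def .
  have "mfrac_kernel m \<alpha> f x \<in> borel_measurable PM"
    unfolding mfrac_kernel_def[abs_def] by measurable
  then show "mfrac_kernel m \<alpha> f x \<in> borel_measurable (\<Pi>\<^sub>M i\<in>{..<m}. (lborel :: 'a measure))"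
    unfolding PM_def .
qed

text \<open>Where the kernel is not integrable the Bochner integral is zero by convention, so the
  bound holds at every point.\<close>

lemma abs_mfrac_int_le_mpot:
  fixes f :: "nat \<Rightarrow> 'a::euclidean_space \<Rightarrow> real"
  assumes f: "\<And>i. i < m \<Longrightarrow> f i \<in> borel_measurable borel" and s: "0 < real m * real DIM('a) - \<alpha>"
  shows "ennreal \<bar>mfrac_int m \<alpha> f x\<bar> \<le> ennreal (real m * real DIM('a) - \<alpha>) * mpot m (real m * real DIM('a) - \<alpha>) f x"
proof -
  have "ennreal \<bar>mfrac_int m \<alpha> f x\<bar> \<le> (\<integral>\<^sup>+y. ennreal \<bar>mfrac_kernel m \<alpha> f x y\<bar> \<partial>(\<Pi>\<^sub>M i\<in>{..<m}. (lborel :: 'a measure)))"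
  proof (cases "integrable (\<Pi>\<^sub>M i\<in>{..<m}. (lborel :: 'a measure)) (mfrac_kernel m \<alpha> f x)")
    case True
    from integral_norm_bound_ennreal[OF True] show ?thesis by (simp add: mfrac_int_def)
  next
    case False
    then show ?thesis by (simp add: mfrac_int_def not_integrable_integral_eq)
  qed
  also have "\<dots> \<le> ennreal (real m * real DIM('a) - \<alpha>) * mpot m (real m * real DIM('a) - \<alpha>) f x"
    by (rule mfrac_kernel_le_mpot[OF f s])
  finally show ?thesis .
qed

context multi_weight
begin

section \<open>From the Morrey condition to the tail integral\<close>

lemma sM_pos: "0 < sM"
  unfolding sM_def nu_def
proof (rule sum_pos)
  show "0 < real DIM('a) * (1 - 1 / p i + 1 / q i)" if "i \<in> {..<m}" for i
    using pq_facts[of i] that by (intro mult_pos_pos add_nonneg_pos) (auto simp: DIM_positive)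
qed (use m_pos in auto)

lemma Eb_eq: "Eb i f x r = (\<integral>\<^sup>+y\<in>ball x r. ennreal (\<bar>f y\<bar> powr p i * \<omega> i y powr p i) \<partial>lborel)"
  by (simp add: Eb_def)

text \<open>The energies at radius \<open>t\<close> are bounded by the Morrey majorant at every
  larger radius, so after division by the constants they are a lower bound in the essential infimum.
  The denominators agree because the product of the norms of the \<open>\<omega> i\<close> is
  \<open>G powr (1 / Q)\<close>.\<close>

lemma Sint_le:
  assumes f: "\<And>i. i < m \<Longrightarrow> f i \<in> borel_measurable borel"
    and \<phi>1: "\<And>i x r. i < m \<Longrightarrow> 0 < r \<Longrightarrow> 0 \<le> \<phi>1 i x r"
    and K: "\<And>i. i < m \<Longrightarrow> 0 \<le> K i" "\<And>i. i < m \<Longrightarrow> morrey_bound (p i) (\<phi>1 i) (\<lambda>x. \<omega> i x powr p i) (f i) (K i)"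
    and C: "\<And>x r. 0 < r \<Longrightarrow> (\<integral>\<^sup>+ t\<in>{r<..}. ennreal (
         ess_inf_on lborel {t<..} (\<lambda>\<eta>. \<Prod>i<m. \<phi>1 i x \<eta> * Lnorm_ball (p i) (\<omega> i) x \<eta>)
         / (\<Prod>i<m. Lnorm_ball (q i) (\<omega> i) x t) / t) \<partial>lborel) \<le> ennreal (C * \<phi>2 x r)"
    and C0: "0 \<le> C" and \<phi>2: "0 \<le> \<phi>2 x r" and r: "0 < r"
  shows "Sint f x r \<le> ennreal ((\<Prod>i<m. K i) * C * \<phi>2 x r)"
proof -
  define KK where "KK = (\<Prod>i<m. K i)"
  have KK: "0 \<le> KK" unfolding KK_def using K(1) by (intro prod_nonneg) auto
  define g where "g \<eta> = (\<Prod>i<m. \<phi>1 i x \<eta> * Lnorm_ball (p i) (\<omega> i) x \<eta>)" for \<eta>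
  have Eb_fin: "Eb i (f i) x \<eta> \<le> ennreal ((K i * \<phi>1 i x \<eta>) powr p i * wball (\<lambda>x. \<omega> i x powr p i) x \<eta>)" if "i < m" "0 < \<eta>" for i \<eta>
    using K(2)[OF that(1)] that(2) unfolding morrey_bound_def Eb_eq by auto
  have norm_le: "epow (Eb i (f i) x \<eta>) (1 / p i) \<le> ennreal (K i * (\<phi>1 i x \<eta> * Lnorm_ball (p i) (\<omega> i) x \<eta>))" if i: "i < m" and eta: "0 < \<eta>" for i \<eta>
  proof -
    have "epow (Eb i (f i) x \<eta>) (1 / p i) \<le> epow (ennreal ((K i * \<phi>1 i x \<eta>) powr p i * wball (\<lambda>x. \<omega> i x powr p i) x \<eta>)) (1 / p i)"
      using pq_facts(3)[OF i] by (intro epow_mono Eb_fin i eta) auto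
    also have "\<dots> = ennreal (((K i * \<phi>1 i x \<eta>) powr p i * wball (\<lambda>x. \<omega> i x powr p i) x \<eta>) powr (1 / p i))"
      by (intro epow_ennreal mult_nonneg_nonneg wball_nonneg) auto
    also have "((K i * \<phi>1 i x \<eta>) powr p i * wball (\<lambda>x. \<omega> i x powr p i) x \<eta>) powr (1 / p i) = K i * (\<phi>1 i x \<eta> * Lnorm_ball (p i) (\<omega> i) x \<eta>)"
      using K(1)[OF i] \<phi>1[OF i eta, of x] pq_facts(3)[OF i] by (simp add: powr_mult powr_powr Lnorm_ball_def wball_def)
    finally show ?thesis .
  qed
  have Afin: "(\<Prod>i<m. epow (Eb i (f i) x t) (1 / p i)) \<le> ennreal (KK * g \<eta>)" if t: "0 < t" "t < \<eta>" for t \<eta>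
  proof -
    have "(\<Prod>i<m. epow (Eb i (f i) x t) (1 / p i)) \<le> (\<Prod>i<m. ennreal (K i * (\<phi>1 i x \<eta> * Lnorm_ball (p i) (\<omega> i) x \<eta>)))"
    proof (rule prod_mono_ennreal)
      fix i assume "i \<in> {..<m}"
      then have i: "i < m" by simp
      have "epow (Eb i (f i) x t) (1 / p i) \<le> epow (Eb i (f i) x \<eta>) (1 / p i)"
        using t pq_facts(3)[OF i] by (intro epow_mono Eb_mono subset_ball) auto
      also have "\<dots> \<le> ennreal (K i * (\<phi>1 i x \<eta> * Lnorm_ball (p i) (\<omega> i) x \<eta>))"
        using t by (intro norm_le i) auto
      finally show "epow (Eb i (f i) x t) (1 / p i) \<le> ennreal (K i * (\<phi>1 i x \<eta> * Lnorm_ball (p i) (\<omega> i) x \<eta>))" .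
    qed
    also have "\<dots> = ennreal (\<Prod>i<m. K i * (\<phi>1 i x \<eta> * Lnorm_ball (p i) (\<omega> i) x \<eta>))"
      using K(1) \<phi>1[of _ \<eta> x] t by (intro prod_ennreal) (auto simp: Lnorm_ball_def)
    also have "(\<Prod>i<m. K i * (\<phi>1 i x \<eta> * Lnorm_ball (p i) (\<omega> i) x \<eta>)) = KK * g \<eta>"
      unfolding KK_def g_def by (rule prod.distrib)
    finally show ?thesis .
  qed
  show ?thesis
  \<comment> \<open>The estimate will be divided by \<open>KK\<close>; if \<open>KK\<close> is zero,
    \<open>Psi\<close> vanishes at all positive scales.\<close>
  proof (cases "KK = 0")
    case True
    have "Psi f x t = 0" if "0 < t" for t
      using Afin[of t "t + 1"] that True by (simp add: Psi_def)
    then have "Psi f x t * ennreal (1 / t) * indicator {r<..} t = 0" for t using r by (cases "r < t") auto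
    then show ?thesis unfolding Sint_def by (simp only: nn_integral_const) simp
  next
    case False
    then have KKp: "0 < KK" using KK by simp
    have le: "ennreal (1 / KK) * (Psi f x t * ennreal (1 / t)) \<le> ennreal (ess_inf_on lborel {t<..} g / (\<Prod>i<m. Lnorm_ball (q i) (\<omega> i) x t) / t)"
      if t: "0 < t" for t
    proof -
      define a where "a = enn2real (\<Prod>i<m. epow (Eb i (f i) x t) (1 / p i))"
      have "(\<Prod>i<m. epow (Eb i (f i) x t) (1 / p i)) < top"
        using Afin[of t "t + 1"] t by (simp add: le_less_trans)
      then have a: "(\<Prod>i<m. epow (Eb i (f i) x t) (1 / p i)) = ennreal a" "0 \<le> a" by (auto simp: a_def)
      have ag: "a / KK \<le> g \<eta>" if "t < \<eta>" for \<eta>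
      proof -
        have g0: "0 \<le> g \<eta>" unfolding g_def using \<phi>1[of _ \<eta> x] t that by (intro prod_nonneg) (auto simp: Lnorm_ball_def)
        have "ennreal a \<le> ennreal (KK * g \<eta>)" using Afin[OF t that] a by simp
        then have "a \<le> KK * g \<eta>" using KK g0 by (subst (asm) ennreal_le_iff) auto
        then show ?thesis using KKp by (simp add: field_simps)
      qed
      have "a / KK \<le> ess_inf_on lborel {t<..} g"
      proof (rule le_ess_inf_on)
        show "\<not> (AE y in lborel. y \<notin> {t<..})"
        proof
          assume "AE y in lborel. y \<notin> {t<..}"
          then have "AE y in lborel. y \<notin> ball (t + 1) 1"
            by eventually_elim (auto simp: dist_real_def)
          then show False using not_AE_not_ball[of 1 "t + 1"] by simp
        qed
        show "AE y in lborel. y \<in> {t<..} \<longrightarrow> a / KK \<le> g y" using ag by simp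
      qed
      then have "a / KK / (\<Prod>i<m. Lnorm_ball (q i) (\<omega> i) x t) / t \<le> ess_inf_on lborel {t<..} g / (\<Prod>i<m. Lnorm_ball (q i) (\<omega> i) x t) / t"
        using t by (intro divide_right_mono prod_nonneg) (auto simp: Lnorm_ball_def)
      moreover have "(\<Prod>i<m. Lnorm_ball (q i) (\<omega> i) x t) = G x t powr (1 / Q)"
        unfolding G_powr using Q_pos by (simp add: Lnorm_ball_def Vi_def wball_def)
      moreover have "ennreal (1 / KK) * (Psi f x t * ennreal (1 / t)) = ennreal (a / KK / G x t powr (1 / Q) / t)"
        using a KKp t by (simp add: Psi_def ennreal_mult[symmetric] powr_minus divide_inverse mult_ac)
      ultimately show ?thesis by (metis ennreal_leI)
    qed
    have "ennreal (1 / KK) * Sint f x r = (\<integral>\<^sup>+t. ennreal (1 / KK) * (Psi f x t * ennreal (1 / t) * indicator {r<..} t) \<partial>lborel)"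
    proof -
      have [measurable]: "Psi f x \<in> borel_measurable borel" by (rule Psi_measurable) fact
      show ?thesis unfolding Sint_def by (rule nn_integral_cmult[symmetric]) simp
    qed
    also have "\<dots> \<le> (\<integral>\<^sup>+ t\<in>{r<..}. ennreal (ess_inf_on lborel {t<..} g / (\<Prod>i<m. Lnorm_ball (q i) (\<omega> i) x t) / t) \<partial>lborel)"
    proof (rule nn_integral_mono)
      fix t
      show "ennreal (1 / KK) * (Psi f x t * ennreal (1 / t) * indicator {r<..} t)
        \<le> ennreal (ess_inf_on lborel {t<..} g / (\<Prod>i<m. Lnorm_ball (q i) (\<omega> i) x t) / t) * indicator {r<..} t"
        using le[of t] r by (cases "r < t") auto
    qed
    also have "\<dots> \<le> ennreal (C * \<phi>2 x r)" using C[OF r, of x] unfolding g_def .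
    finally have "ennreal KK * (ennreal (1 / KK) * Sint f x r) \<le> ennreal KK * ennreal (C * \<phi>2 x r)"
      by (intro mult_left_mono) auto
    moreover have "ennreal KK * (ennreal (1 / KK) * Sint f x r) = Sint f x r"
      using KKp by (simp add: mult.assoc[symmetric] ennreal_mult[symmetric])
    moreover have "ennreal KK * ennreal (C * \<phi>2 x r) = ennreal (KK * C * \<phi>2 x r)"
      using KK C0 \<phi>2 by (simp add: ennreal_mult[symmetric] mult.assoc)
    ultimately show ?thesis unfolding KK_def by simp
  qed
qed

text \<open>On each ball the local weak bound gives the set of infinite values measure at most a
  constant times \<open>l powr (- Q)\<close> for every \<open>l\<close>, hence zero. As the weights
  are positive almost everywhere, null sets of \<open>mW\<close> are Lebesgue null, and countably
  many balls exhaust the space.\<close>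

lemma mpot_finite_AE:
  assumes f: "\<And>i. i < m \<Longrightarrow> f i \<in> borel_measurable borel"
    and Ef: "\<And>i x r. i < m \<Longrightarrow> 0 < r \<Longrightarrow> Eb i (f i) x r < top"
    and Sf: "\<And>x r. 0 < r \<Longrightarrow> Sint f x r < top"
  shows "AE x in lborel. mpot m sM f x < top"
proof -
  note f [measurable]
  obtain C where C: "0 < C" "\<And>f x r l. (\<And>i. i < m \<Longrightarrow> f i \<in> borel_measurable borel) \<Longrightarrow> 0 < r \<Longrightarrow> 0 < l \<Longrightarrow>
    (\<And>i. i < m \<Longrightarrow> Eb i (f i) x (2 * r) < top) \<Longrightarrow>
    ennreal (l powr Q) * emeasure mW {y \<in> ball x r. ennreal l < mpot m sM f y} \<le> ennreal (C * W x r) * epow (Sint f x r) Q"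
    using local_weak by blast
  have sets_mW [measurable_cong]: "sets mW = sets borel" by (simp add: mW_def)
  have "AE y in lborel. y \<in> ball 0 (real (Suc n)) \<longrightarrow> mpot m sM f y < top" for n
  proof -
    let ?r = "real (Suc n)"
    define U where "U = {y \<in> ball 0 ?r. mpot m sM f y = top}"
    have U [measurable]: "U \<in> sets borel" unfolding U_def by measurable
    define M where "M = ennreal (C * W 0 ?r) * epow (Sint f 0 ?r) Q"
    have "M < top" unfolding M_def using Sf[of ?r 0] by (auto simp: less_top[symmetric] ennreal_mult_eq_top_iff)
    then obtain M' where M': "M = ennreal M'" "0 \<le> M'" by (cases M) auto
    have Ul: "ennreal (l powr Q) * emeasure mW U \<le> ennreal M'" if l: "0 < l" for l
    proof -
      have "ennreal (l powr Q) * emeasure mW U \<le> ennreal (l powr Q) * emeasure mW {y \<in> ball 0 ?r. ennreal l < mpot m sM f y}"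
        by (intro mult_left_mono emeasure_mono) (auto simp: U_def sets_mW)
      also have "\<dots> \<le> M" unfolding M_def by (intro C(2) f l Ef) auto
      finally show ?thesis using M' by simp
    qed
    have "emeasure mW U \<le> emeasure mW (ball 0 ?r)" by (intro emeasure_mono) (auto simp: U_def sets_mW)
    then have "emeasure mW U < top" unfolding emeasure_mW_ball by (simp add: le_less_trans)
    then obtain v where v: "emeasure mW U = ennreal v" "0 \<le> v" by (cases "emeasure mW U") auto
    have "v = 0"
    proof (rule ccontr)
      assume "v \<noteq> 0"
      then have v0: "0 < v" using v by simp
      \<comment> \<open>Chosen so that \<open>l powr Q * v = M' + 1\<close>, against the uniform
        bound \<open>M'\<close>.\<close>
      define l where "l = ((M' + 1) / v) powr (1 / Q)"
      have "0 < l" using v0 M' by (simp add: l_def)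
      have "ennreal ((M' + 1) / v * v) \<le> ennreal M'"
        using Ul[OF \<open>0 < l\<close>] v v0 M' Q_pos by (simp add: l_def powr_powr ennreal_mult[symmetric])
      then show False using v0 M' by (simp add: ennreal_le_iff)
    qed
    then have "emeasure mW U = 0" using v by simp
    then have "(\<integral>\<^sup>+y. ennreal ((\<Prod>i<m. \<omega> i y) powr Q) * indicator U y \<partial>lborel) = 0"
      unfolding mW_def by (subst (asm) emeasure_density) auto
    then have "AE y in lborel. ennreal ((\<Prod>i<m. \<omega> i y) powr Q) * indicator U y = 0"
      by (subst (asm) nn_integral_0_iff_AE) auto
    then show ?thesis
      using omega_pos
    proof eventually_elim
      case (elim y)
      have "(\<Prod>i<m. \<omega> i y) \<noteq> 0" using elim(2) by force
      then have "0 < (\<Prod>i<m. \<omega> i y) powr Q" by simp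
      then have "ennreal ((\<Prod>i<m. \<omega> i y) powr Q) \<noteq> 0" by (simp only: ennreal_eq_0_iff not_le)
      then have "y \<notin> U" using elim(1) by auto
      then show ?case by (auto simp: U_def less_top)
    qed
  qed
  then have "AE y in lborel. \<forall>n. y \<in> ball 0 (real (Suc n)) \<longrightarrow> mpot m sM f y < top"
    by (subst AE_all_countable) auto
  then show ?thesis
  proof eventually_elim
    case (elim y)
    obtain n :: nat where "norm y < real n" using reals_Archimedean2 by blast
    then have "y \<in> ball 0 (real (Suc n))" by simp
    then show ?case using elim by blast
  qed
qed

end

theorem theorem1p7:
  fixes m :: nat and p q :: "nat \<Rightarrow> real" and P Q \<alpha> :: real
    and \<omega> :: "nat \<Rightarrow> 'a::euclidean_space \<Rightarrow> real"
    and \<phi>1 :: "nat \<Rightarrow> 'a \<Rightarrow> real \<Rightarrow> real" and \<phi>2 :: "'a \<Rightarrow> real \<Rightarrow> real"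
  assumes "2 \<le> m"
    and "\<forall>i<m. 1 \<le> p i"
    and "1 / P = (\<Sum>i<m. 1 / p i)"
    and "\<forall>i<m. 0 < q i \<and> 0 < 1 / p i - 1 / q i \<and> 1 / p i - 1 / q i < 1"
    and "\<alpha> = (\<Sum>i<m. real DIM('a) * (1 / p i - 1 / q i))"
    and "1 / Q = (\<Sum>i<m. 1 / q i)"
    and "APq m p Q \<omega>"
    and "\<forall>i<m. (\<forall>x. 0 \<le> \<omega> i x) \<and> A_inf (\<lambda>x. \<omega> i x powr q i)"
    and "\<forall>i<m. (\<lambda>(x, r). \<phi>1 i x r) \<in> borel_measurable (restrict_space borel (UNIV \<times> {0<..}))
               \<and> (\<forall>x r. 0 < r \<longrightarrow> 0 \<le> \<phi>1 i x r)"
    and "(\<lambda>(x, r). \<phi>2 x r) \<in> borel_measurable (restrict_space borel (UNIV \<times> {0<..}))"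
    and "\<forall>x r. 0 < r \<longrightarrow> 0 \<le> \<phi>2 x r"
    and "phiB_finite m p q \<omega> \<phi>1 \<phi>2"
  shows "(1 < Min (p ` {..<m}) \<longrightarrow>
           (\<exists>C. \<forall>f :: nat \<Rightarrow> 'a \<Rightarrow> real.
              (\<forall>i<m. in_morrey (p i) (\<phi>1 i) (\<lambda>x. \<omega> i x powr p i) (f i)) \<longrightarrow>
                mfrac_defined m \<alpha> f \<and>
                in_morrey Q \<phi>2 (\<lambda>x. (\<Prod>i<m. \<omega> i x) powr Q) (mfrac_int m \<alpha> f) \<and>
                morrey_norm Q \<phi>2 (\<lambda>x. (\<Prod>i<m. \<omega> i x) powr Q) (mfrac_int m \<alpha> f)
                  \<le> C * (\<Prod>i<m. morrey_norm (p i) (\<phi>1 i) (\<lambda>x. \<omega> i x powr p i) (f i))))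
       \<and> (Min (p ` {..<m}) = 1 \<longrightarrow>
           (\<exists>C. \<forall>f :: nat \<Rightarrow> 'a \<Rightarrow> real.
              (\<forall>i<m. in_morrey (p i) (\<phi>1 i) (\<lambda>x. \<omega> i x powr p i) (f i)) \<longrightarrow>
                mfrac_defined m \<alpha> f \<and>
                in_wmorrey Q \<phi>2 (\<lambda>x. (\<Prod>i<m. \<omega> i x) powr Q) (mfrac_int m \<alpha> f) \<and>
                wmorrey_norm Q \<phi>2 (\<lambda>x. (\<Prod>i<m. \<omega> i x) powr Q) (mfrac_int m \<alpha> f)
                  \<le> C * (\<Prod>i<m. morrey_norm (p i) (\<phi>1 i) (\<lambda>x. \<omega> i x powr p i) (f i))))"
proof -
  have pq: "p i < q i" if "i < m" for i
  proof -
    have "1 / q i < 1 / p i" "0 < q i" "0 < p i" using assms(2,4) that by force+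
    then show ?thesis by (simp add: field_simps)
  qed
  obtain H H2 CQ where MW: "multi_weight m p q H \<omega> Q CQ"
    and str: "\<And>i. i < m \<Longrightarrow> 1 < p i \<Longrightarrow> apq_weight_strong (p i) (q i) (H i) (\<omega> i) (H2 i)"
  proof (rule multi_weight_of_APq[of m p q Q \<omega>])
    show "0 < m" using assms(1) by simp
  qed (use assms pq in auto)
  interpret M: multi_weight m p q H \<omega> Q CQ by (rule MW)
  \<comment> \<open>\<open>\<alpha>\<close> is the sum of the one-variable orders, so the
    homogeneity of the kernel is the sum of the \<open>nu i\<close>.\<close>
  have \<alpha>: "real m * real DIM('a) - \<alpha> = M.sM"
  proof -
    have "M.sM + \<alpha> = (\<Sum>i<m. real DIM('a))"
      unfolding M.sM_def M.nu_def assms(5) sum.distrib[symmetric] by (simp add: algebra_simps)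
    then show ?thesis by simp
  qed
  let ?u = "\<lambda>x. (\<Prod>i<m. \<omega> i x) powr Q"
  obtain C0 where C0: "\<And>x r. 0 < r \<Longrightarrow> (\<integral>\<^sup>+ t\<in>{r<..}. ennreal (
         ess_inf_on lborel {t<..} (\<lambda>\<eta>. \<Prod>i<m. \<phi>1 i x \<eta> * Lnorm_ball (p i) (\<omega> i) x \<eta>)
         / (\<Prod>i<m. Lnorm_ball (q i) (\<omega> i) x t) / t) \<partial>lborel) \<le> ennreal (C0 * \<phi>2 x r)"
    using assms(12) unfolding phiB_finite_def by blast
  \<comment> \<open>The constant in the condition is an arbitrary real and is replaced by its
    positive part; the bound persists as \<open>\<phi>2\<close> is nonnegative.\<close>
  define B where "B = max C0 0"
  have B0: "0 \<le> B" by (simp add: B_def)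
  have B: "(\<integral>\<^sup>+ t\<in>{r<..}. ennreal (
         ess_inf_on lborel {t<..} (\<lambda>\<eta>. \<Prod>i<m. \<phi>1 i x \<eta> * Lnorm_ball (p i) (\<omega> i) x \<eta>)
         / (\<Prod>i<m. Lnorm_ball (q i) (\<omega> i) x t) / t) \<partial>lborel) \<le> ennreal (B * \<phi>2 x r)" if "0 < r" for x r
    using assms(11) that unfolding B_def
    by (intro order_trans[OF C0[OF that]] ennreal_leI mult_right_mono) auto
  define N where "N f i = morrey_norm (p i) (\<phi>1 i) (\<lambda>x. \<omega> i x powr p i) (f i)" for f i
  let ?adm = "\<lambda>f. \<forall>i<m. in_morrey (p i) (\<phi>1 i) (\<lambda>x. \<omega> i x powr p i) (f i)"
  have meas: "f i \<in> borel_measurable borel" if "?adm f" "i < m" for f i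
    using that by (auto simp: in_morrey_def)
  have N: "0 \<le> N f i" "morrey_bound (p i) (\<phi>1 i) (\<lambda>x. \<omega> i x powr p i) (f i) (N f i)" if "?adm f" "i < m" for f i
    unfolding N_def using that assms(9) M.pq_facts(3)[OF that(2)]
    by (auto intro!: morrey_bound_norm)
  have Ef: "M.Eb i (f i) x r < top" if "?adm f" "i < m" "0 < r" for f i x r
    using N(2)[OF that(1,2)] that(3) unfolding morrey_bound_def M.Eb_eq
    by (meson ennreal_less_top le_less_trans)
  have S: "M.Sint f x r \<le> ennreal ((\<Prod>i<m. N f i) * B * \<phi>2 x r)" if "?adm f" "0 < r" for f x r
    using assms(9,11) that(2) by (intro M.Sint_le[OF meas[OF that(1)] _ N[OF that(1)] B B0]) auto
  \<comment> \<open>The operator is encoded by a Bochner integral, so absolute convergence at almost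
    every point is part of the claim; it follows from finiteness of the potential.\<close>
  have defd: "mfrac_defined m \<alpha> f" if f: "?adm f" for f
    unfolding mfrac_defined_def
  proof -
    have "AE x in lborel. mpot m M.sM f x < top"
      by (intro M.mpot_finite_AE meas[OF f] Ef[OF f] le_less_trans[OF S[OF f] ennreal_less_top])
    then show "AE x in lborel. integrable (\<Pi>\<^sub>M i\<in>{..<m}. (lborel :: 'a measure)) (mfrac_kernel m \<alpha> f x)"
    proof eventually_elim
      case (elim x)
      show ?case
      proof (rule integrableI_bounded)
        show "mfrac_kernel m \<alpha> f x \<in> borel_measurable (\<Pi>\<^sub>M i\<in>{..<m}. (lborel :: 'a measure))"
          by (rule measurable_mfrac_int) (rule meas[OF f])
        have "(\<integral>\<^sup>+y. ennreal \<bar>mfrac_kernel m \<alpha> f x y\<bar> \<partial>(\<Pi>\<^sub>M i\<in>{..<m}. (lborel :: 'a measure))) \<le> ennreal M.sM * mpot m M.sM f x"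
          using mfrac_kernel_le_mpot[of m f \<alpha> x, OF meas[OF f]] M.sM_pos unfolding \<alpha> by simp
        also have "\<dots> < top" using elim by (simp add: ennreal_mult_less_top)
        finally show "(\<integral>\<^sup>+y. ennreal (norm (mfrac_kernel m \<alpha> f x y)) \<partial>(\<Pi>\<^sub>M i\<in>{..<m}. (lborel :: 'a measure))) < \<infinity>" by simp
      qed
    qed
  qed
  have Im: "mfrac_int m \<alpha> f \<in> borel_measurable borel" if "?adm f" for f
    by (rule measurable_mfrac_int) (rule meas[OF that])
  have Ile: "ennreal \<bar>mfrac_int m \<alpha> f x\<bar> \<le> ennreal M.sM * mpot m M.sM f x" if "?adm f" for f x
    using abs_mfrac_int_le_mpot[of m f \<alpha> x, OF meas[OF that]] M.sM_pos unfolding \<alpha> by simp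
  \<comment> \<open>The final step common to both parts: the bound of the tail integral turns a
    local estimate into a Morrey bound. The root \<open>c powr (1 / Q)\<close> appears because
    Morrey bounds are stated after raising to the power \<open>Q\<close>.\<close>
  have const: "ennreal (M.sM powr Q) * (ennreal (c * M.W x r) * epow (M.Sint f x r) Q)
      \<le> ennreal ((M.sM * c powr (1 / Q) * B * (\<Prod>i<m. N f i) * \<phi>2 x r) powr Q * wball ?u x r)"
    if f: "?adm f" and r: "0 < r" and c: "0 < c" for f x r c
  proof -
    let ?K = "(\<Prod>i<m. N f i)"
    have K: "0 \<le> ?K" using N(1)[OF f] by (intro prod_nonneg) auto
    have \<phi>: "0 \<le> \<phi>2 x r" using assms(11) r by simp
    have "epow (M.Sint f x r) Q \<le> epow (ennreal (?K * B * \<phi>2 x r)) Q"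
      using S[OF f r] M.Q_pos by (intro epow_mono) auto
    also have "\<dots> = ennreal ((?K * B * \<phi>2 x r) powr Q)"
      using K B0 \<phi> by simp
    finally have "ennreal (M.sM powr Q) * (ennreal (c * M.W x r) * epow (M.Sint f x r) Q)
       \<le> ennreal (M.sM powr Q) * (ennreal (c * M.W x r) * ennreal ((?K * B * \<phi>2 x r) powr Q))"
      by (intro mult_left_mono) auto
    also have "\<dots> = ennreal (M.sM powr Q * (c * M.W x r * (?K * B * \<phi>2 x r) powr Q))"
      using c M.W_nonneg by (simp add: ennreal_mult[symmetric])
    also have "M.sM powr Q * (c * M.W x r * (?K * B * \<phi>2 x r) powr Q)
       = (M.sM * c powr (1 / Q) * B * ?K * \<phi>2 x r) powr Q * wball ?u x r"
      using c M.Q_pos by (simp add: powr_mult powr_powr M.W_def)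
    finally show ?thesis .
  qed
  have norm_nonneg: "0 \<le> M.sM * c powr (1 / Q) * B * (\<Prod>i<m. N f i)" if "?adm f" for f c
    using M.sM_pos B0 N(1)[OF that] by (intro mult_nonneg_nonneg prod_nonneg) auto
  show ?thesis
  proof (intro conjI impI)
    assume min: "1 < Min (p ` {..<m})"
    have p1: "1 < p i" if "i < m" for i
    proof -
      have "Min (p ` {..<m}) \<le> p i" using that by (intro Min_le) auto
      then show ?thesis using min by simp
    qed
    obtain c where c: "0 < c" "\<And>f x r. (\<And>i. i < m \<Longrightarrow> f i \<in> borel_measurable borel) \<Longrightarrow> 0 < r \<Longrightarrow>
      (\<And>i. i < m \<Longrightarrow> M.Eb i (f i) x (2 * r) < top) \<Longrightarrow>
      (\<integral>\<^sup>+y. epow (mpot m M.sM f y) Q * indicator (ball x r) y \<partial>M.mW) \<le> ennreal (c * M.W x r) * epow (M.Sint f x r) Q"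
      using M.local_strong[of H2] str p1 by blast
    have bound: "morrey_bound Q \<phi>2 ?u (mfrac_int m \<alpha> f) (M.sM * c powr (1 / Q) * B * (\<Prod>i<m. N f i))" if f: "?adm f" for f
      unfolding morrey_bound_def
    proof (intro allI impI)
      fix x :: 'a and r :: real assume r: "0 < r"
      note [measurable] = meas[OF f]
      have "(\<integral>\<^sup>+y\<in>ball x r. ennreal (\<bar>mfrac_int m \<alpha> f y\<bar> powr Q * ?u y) \<partial>lborel)
        \<le> (\<integral>\<^sup>+y. ennreal (?u y) * (ennreal (M.sM powr Q) * (epow (mpot m M.sM f y) Q * indicator (ball x r) y)) \<partial>lborel)"
      proof (rule nn_integral_mono)
        fix y
        have "ennreal (\<bar>mfrac_int m \<alpha> f y\<bar> powr Q) = epow (ennreal \<bar>mfrac_int m \<alpha> f y\<bar>) Q" by simp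
        also have "\<dots> \<le> epow (ennreal M.sM * mpot m M.sM f y) Q"
          using Ile[OF f] M.Q_pos by (intro epow_mono) auto
        also have "\<dots> = ennreal (M.sM powr Q) * epow (mpot m M.sM f y) Q"
          using M.Q_pos M.sM_pos by (simp add: epow_mult)
        finally have "ennreal (\<bar>mfrac_int m \<alpha> f y\<bar> powr Q) * (ennreal (?u y) * indicator (ball x r) y)
          \<le> ennreal (M.sM powr Q) * epow (mpot m M.sM f y) Q * (ennreal (?u y) * indicator (ball x r) y)"
          by (rule mult_right_mono) simp
        then show "ennreal (\<bar>mfrac_int m \<alpha> f y\<bar> powr Q * ?u y) * indicator (ball x r) y
          \<le> ennreal (?u y) * (ennreal (M.sM powr Q) * (epow (mpot m M.sM f y) Q * indicator (ball x r) y))"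
          by (simp add: ennreal_mult mult_ac)
      qed
      also have "\<dots> = (\<integral>\<^sup>+y. ennreal (M.sM powr Q) * (epow (mpot m M.sM f y) Q * indicator (ball x r) y) \<partial>M.mW)"
        unfolding M.mW_def by (subst nn_integral_density) auto
      also have "\<dots> = ennreal (M.sM powr Q) * (\<integral>\<^sup>+y. epow (mpot m M.sM f y) Q * indicator (ball x r) y \<partial>M.mW)"
        by (rule nn_integral_cmult) (simp add: M.mW_def)
      also have "\<dots> \<le> ennreal (M.sM powr Q) * (ennreal (c * M.W x r) * epow (M.Sint f x r) Q)"
        using r by (intro mult_left_mono c(2) meas[OF f] Ef[OF f]) auto
      also have "\<dots> \<le> ennreal ((M.sM * c powr (1 / Q) * B * (\<Prod>i<m. N f i) * \<phi>2 x r) powr Q * wball ?u x r)"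
        by (rule const[OF f r c(1)])
      finally show "(\<integral>\<^sup>+y\<in>ball x r. ennreal (\<bar>mfrac_int m \<alpha> f y\<bar> powr Q * ?u y) \<partial>lborel)
        \<le> ennreal ((M.sM * c powr (1 / Q) * B * (\<Prod>i<m. N f i) * \<phi>2 x r) powr Q * wball ?u x r)" .
    qed
    have concl: "in_morrey Q \<phi>2 ?u (mfrac_int m \<alpha> f) \<and>
        morrey_norm Q \<phi>2 ?u (mfrac_int m \<alpha> f) \<le> M.sM * c powr (1 / Q) * B * (\<Prod>i<m. N f i)" if f: "?adm f" for f
    proof
      show "in_morrey Q \<phi>2 ?u (mfrac_int m \<alpha> f)"
        unfolding in_morrey_def using Im[OF f] bound[OF f] norm_nonneg[OF f] by auto
      show "morrey_norm Q \<phi>2 ?u (mfrac_int m \<alpha> f) \<le> M.sM * c powr (1 / Q) * B * (\<Prod>i<m. N f i)"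
        unfolding morrey_norm_def using bound[OF f] norm_nonneg[OF f]
        by (intro cInf_lower bdd_belowI[of _ 0]) auto
    qed
    show "\<exists>C. \<forall>f :: nat \<Rightarrow> 'a \<Rightarrow> real. ?adm f \<longrightarrow> mfrac_defined m \<alpha> f \<and> in_morrey Q \<phi>2 ?u (mfrac_int m \<alpha> f) \<and>
        morrey_norm Q \<phi>2 ?u (mfrac_int m \<alpha> f) \<le> C * (\<Prod>i<m. morrey_norm (p i) (\<phi>1 i) (\<lambda>x. \<omega> i x powr p i) (f i))"
      using defd concl unfolding N_def by (intro exI[of _ "M.sM * c powr (1 / Q) * B"]) blast
  next
    obtain c where c: "0 < c" "\<And>f x r l. (\<And>i. i < m \<Longrightarrow> f i \<in> borel_measurable borel) \<Longrightarrow> 0 < r \<Longrightarrow> 0 < l \<Longrightarrow>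
      (\<And>i. i < m \<Longrightarrow> M.Eb i (f i) x (2 * r) < top) \<Longrightarrow>
      ennreal (l powr Q) * emeasure M.mW {y \<in> ball x r. ennreal l < mpot m M.sM f y} \<le> ennreal (c * M.W x r) * epow (M.Sint f x r) Q"
      using M.local_weak by blast
    have bound: "wmorrey_bound Q \<phi>2 ?u (mfrac_int m \<alpha> f) (M.sM * c powr (1 / Q) * B * (\<Prod>i<m. N f i))" if f: "?adm f" for f
      unfolding wmorrey_bound_def
    proof (intro allI impI)
      fix x :: 'a and r l :: real assume r: "0 < r" and l: "0 < l"
      note [measurable] = meas[OF f] Im[OF f]
      \<comment> \<open>The level is rescaled by the factor \<open>sM\<close> with which the
        potential dominates the operator.\<close>
      define l' where "l' = l / M.sM"
      have l': "0 < l'" "l = M.sM * l'" using l M.sM_pos by (auto simp: l'_def)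
      have sub: "{y \<in> ball x r. l < \<bar>mfrac_int m \<alpha> f y\<bar>} \<subseteq> {y \<in> ball x r. ennreal l' < mpot m M.sM f y}"
      proof safe
        fix y assume "l < \<bar>mfrac_int m \<alpha> f y\<bar>"
        then have less: "ennreal l < ennreal M.sM * mpot m M.sM f y"
          using Ile[OF f, of y] l by (intro less_le_trans[OF _ Ile[OF f]]) (simp add: ennreal_less_iff)
        show "ennreal l' < mpot m M.sM f y"
        proof (rule ccontr)
          assume "\<not> ennreal l' < mpot m M.sM f y"
          then have "ennreal M.sM * mpot m M.sM f y \<le> ennreal M.sM * ennreal l'" by (intro mult_left_mono) auto
          also have "\<dots> = ennreal l" using l' M.sM_pos by (simp add: ennreal_mult[symmetric])
          finally show False using less by simp
        qed
      qed
      have [measurable]: "{y \<in> ball x r. l < \<bar>mfrac_int m \<alpha> f y\<bar>} \<in> sets borel" by measurable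
      have "(\<integral>\<^sup>+ y\<in>{y \<in> ball x r. l < \<bar>mfrac_int m \<alpha> f y\<bar>}. ennreal (?u y) \<partial>lborel) = emeasure M.mW {y \<in> ball x r. l < \<bar>mfrac_int m \<alpha> f y\<bar>}"
        unfolding M.mW_def by (subst emeasure_density) auto
      also have "\<dots> \<le> emeasure M.mW {y \<in> ball x r. ennreal l' < mpot m M.sM f y}"
        using sub by (intro emeasure_mono) (auto simp: M.mW_def)
      finally have "ennreal (l powr Q) * (\<integral>\<^sup>+ y\<in>{y \<in> ball x r. l < \<bar>mfrac_int m \<alpha> f y\<bar>}. ennreal (?u y) \<partial>lborel)
        \<le> ennreal (l powr Q) * emeasure M.mW {y \<in> ball x r. ennreal l' < mpot m M.sM f y}"
        by (rule mult_left_mono) simp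
      also have "\<dots> = ennreal (M.sM powr Q) * (ennreal (l' powr Q) * emeasure M.mW {y \<in> ball x r. ennreal l' < mpot m M.sM f y})"
        unfolding l'(2) by (simp add: powr_mult ennreal_mult mult.assoc)
      also have "\<dots> \<le> ennreal (M.sM powr Q) * (ennreal (c * M.W x r) * epow (M.Sint f x r) Q)"
        using r l' by (intro mult_left_mono c(2) meas[OF f] Ef[OF f]) auto
      also have "\<dots> \<le> ennreal ((M.sM * c powr (1 / Q) * B * (\<Prod>i<m. N f i) * \<phi>2 x r) powr Q * wball ?u x r)"
        by (rule const[OF f r c(1)])
      finally show "ennreal (l powr Q) * (\<integral>\<^sup>+ y\<in>{y \<in> ball x r. l < \<bar>mfrac_int m \<alpha> f y\<bar>}. ennreal (?u y) \<partial>lborel)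
        \<le> ennreal ((M.sM * c powr (1 / Q) * B * (\<Prod>i<m. N f i) * \<phi>2 x r) powr Q * wball ?u x r)" .
    qed
    have concl: "in_wmorrey Q \<phi>2 ?u (mfrac_int m \<alpha> f) \<and>
        wmorrey_norm Q \<phi>2 ?u (mfrac_int m \<alpha> f) \<le> M.sM * c powr (1 / Q) * B * (\<Prod>i<m. N f i)" if f: "?adm f" for f
    proof
      show "in_wmorrey Q \<phi>2 ?u (mfrac_int m \<alpha> f)"
        unfolding in_wmorrey_def using Im[OF f] bound[OF f] norm_nonneg[OF f] by auto
      show "wmorrey_norm Q \<phi>2 ?u (mfrac_int m \<alpha> f) \<le> M.sM * c powr (1 / Q) * B * (\<Prod>i<m. N f i)"
        unfolding wmorrey_norm_def using bound[OF f] norm_nonneg[OF f]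
        by (intro cInf_lower bdd_belowI[of _ 0]) auto
    qed
    show "\<exists>C. \<forall>f :: nat \<Rightarrow> 'a \<Rightarrow> real. ?adm f \<longrightarrow> mfrac_defined m \<alpha> f \<and> in_wmorrey Q \<phi>2 ?u (mfrac_int m \<alpha> f) \<and>
        wmorrey_norm Q \<phi>2 ?u (mfrac_int m \<alpha> f) \<le> C * (\<Prod>i<m. morrey_norm (p i) (\<phi>1 i) (\<lambda>x. \<omega> i x powr p i) (f i))"
      using defd concl unfolding N_def by (intro exI[of _ "M.sM * c powr (1 / Q) * B"]) blast
  qed
qed

end
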